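(* Let $G=(V,E)$ be a finite graph, $J:E\to[0,\infty)$, $\beta\ge0$, $h\ge0$, and let $P\in\mathcal E$ (with reference measure $\lambda$ satisfying the super-Gaussian tail assumption). Let $(\varphi^+,\varphi^-,\omega^+,\omega^-)\sim\mathbf P_{G,\beta,h}$ be the double cluster swapping representation and $\xi^\pm=|\varphi^\pm|$. Then the quadruple $$(\xi^+,-\xi^-,\omega^+,-\omega^-)$$ satisfies the FKG inequality under $\mathbf P_{G,\beta,h}$. In particular, $\omega^+$ and $\omega^-$ are negatively associated with each other.
   Context: A reference measure is a symmetric probability measure $\lambda\neq\delta_0$ on $\mathbb R$ satisfying the super-Gaussian tail assumption $\int e^{\alpha x^2}\mathrm d\lambda(x)<\infty$ for all $\alpha\ge0$. A potential $P$ corresponds to $\mathrm d\lambda(x)\propto e^{-P(x)}\mathrm dx$. The spin model $\langle\cdot\rangle_{G,\beta,h}$ is the probability measure on $\varphi\in\mathbb R^V$ proportional to $\exp\big(\beta\sum_{uv\in E}J_{uv}\varphi_u\varphi_v+h\sum_{u\in V}\varphi_u\big)\prod_{u\in V}\mathrm d\lambda(\varphi_u)$. Class $\mathcal E$: $P\in\mathcal E$ if either $P(x)=C\int_0^{|x|}g(t)\,\mathrm dt$ for $|x|\le A$ and $P(x)=\infty$ for $|x|>A$, for some $A\in(0,\infty]$, $C>0$ and a convex function $g:[0,A]\to\mathbb R$ ($g:[0,\infty)\to\mathbb R$ if $A=\infty$) with $g(0)=0$; or the reference measure is a weak limit of the probability measures $\propto e^{-P(x)}\mathrm dx$ with such $P$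 (e.g. $\frac12\delta_1+\frac12\delta_{-1}$; one still says $P\in\mathcal E$). Extended graph: $\overline V=V\cup\{\mathfrak g\}$ ($\mathfrak g$ is the ghost vertex) and $\overline E=E\cup\{v\mathfrak g:v\in V\}$. Double cluster swapping representation $\mathbf P_{G,\beta,h}$: the law of $(\varphi^+,\varphi^-,\omega^+,\omega^-)\in\mathbb R^V\times\mathbb R^V\times\{0,1\}^{\overline E}\times\{0,1\}^E$ constructed as follows. (1) Sample $(\varphi,\varphi')$ from $\langle\cdot\rangle_{G,\beta,h}\otimes\langle\cdot\rangle_{G,\beta,h}$ and set $\varphi^\pm=(\varphi\pm\varphi')/2$, $\xi^\pm=|\varphi^\pm|$ (coordinatewise). (2) For each $uv\in E$, set $\omega^+_{uv}=0$ if $\varphi^+_u\varphi^+_v\le0$, and otherwise set $\omega^+_{uv}=1$ with probability $1-\exp(-4\beta J_{uv}\xi^+_u\xi^+_v)$. For each $u\in V$ set $\omega^+_{u\mathfrak g}=0$ if $\varphi^+_u\le0$, and otherwise set $\omega^+_{u\mathfrak g}=1$ with probability $1-\exp(-4h\xi^+_u)$. (3) For each $uv\in E$, set $\omega^-_{uv}=0$ if $\varphi^-_u\varphi^-_v\le0$, and otherwise set $\omega^-_{uv}=1$ with probability $1-\exp(-4\beta J_{uv}\xi^-_u\xi^-_v)$. All additional randomness used to open edges is independent. FKG inequality: a random variable $X$ with values in a finite product $\Omega$ of totally ordered sets (with the product partial order) satisfies the FKG inequality if $\mathbf E[F(X)G(X)]\ge\mathbf E[F(X)]\,\mathbf E[G(X)]$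 for all increasing measurable $F,G:\Omega\to[0,\infty)$. Minus signs indicate that the order is reversed on those components: the statement concerns functions increasing in $\xi^+,\omega^+$ and decreasing in $\xi^-,\omega^-$. "Negatively associated with each other" means that $\mathbf E[F(\omega^+)G(\omega^-)]\le\mathbf E[F(\omega^+)]\mathbf E[G(\omega^-)]$ for all increasing $F,G\ge0$. *)

theory Defs
  imports "HOL-Probability.Probability"
begin

definition normalized_density :: "'a measure \<Rightarrow> ('a \<Rightarrow> real) \<Rightarrow> 'a measure" where
  "normalized_density M f = density M (\<lambda>x. ennreal (f x) / (\<integral>\<^sup>+y. ennreal (f y) \<partial>M))"

definition finite_graph :: "'v set \<Rightarrow> 'v set set \<Rightarrow> bool" where
  "finite_graph V E \<longleftrightarrow> finite V \<and> (\<forall>e\<in>E. e \<subseteq> V \<and> card e = 2)"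

definition reference_measure :: "real measure \<Rightarrow> bool" where
  "reference_measure \<rho> \<longleftrightarrow>
     real_distribution \<rho> \<and>
     distr \<rho> borel uminus = \<rho> \<and>
     \<rho> \<noteq> return borel 0 \<and>
     (\<forall>\<alpha>\<ge>0. integrable \<rho> (\<lambda>x. exp (\<alpha> * x\<^sup>2)))"

(* The value A = \<infinity> is allowed; the interval below is then [0, \<infinity>). *)
definition convex_force_potential :: "(real \<Rightarrow> ereal) \<Rightarrow> bool" where
  "convex_force_potential P \<longleftrightarrow>
     (\<exists>A::ereal. \<exists>C::real. \<exists>g::real \<Rightarrow> real.
        0 < A \<and> 0 < C \<and> convex_on {t. 0 \<le> t \<and> ereal t \<le> A} g \<and> g 0 = 0 \<and>
        (\<forall>x. P x = (if ereal \<bar>x\<bar> \<le> A then ereal (C * integral {0..\<bar>x\<bar>} g) else \<infinity>)))"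

definition boltzmann_factor :: "ereal \<Rightarrow> real" where
  "boltzmann_factor p = (if p = \<infinity> then 0 else exp (- real_of_ereal p))"

(* A probability measure exactly when the integral of exp (-P) is positive and finite. *)
definition potential_measure :: "(real \<Rightarrow> ereal) \<Rightarrow> real measure" where
  "potential_measure P = normalized_density lborel (\<lambda>x. boltzmann_factor (P x))"

definition class_E :: "real measure \<Rightarrow> bool" where
  "class_E \<rho> \<longleftrightarrow>
     (\<exists>P. convex_force_potential P \<and> \<rho> = potential_measure P) \<or>
     (\<exists>P. (\<forall>n::nat. convex_force_potential (P n) \<and> prob_space (potential_measure (P n))) \<and>
          weak_conv_m (\<lambda>n. potential_measure (P n)) \<rho>)"

(* For an edge e = {u, v}, the product over x \<in> e of \<phi> x is \<phi> u * \<phi> v. *)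
definition spin_weight ::
  "'v set \<Rightarrow> 'v set set \<Rightarrow> ('v set \<Rightarrow> real) \<Rightarrow> real \<Rightarrow> real \<Rightarrow> ('v \<Rightarrow> real) \<Rightarrow> real" where
  "spin_weight V E J \<beta> h \<phi> = exp (\<beta> * (\<Sum>e\<in>E. J e * (\<Prod>x\<in>e. \<phi> x)) + h * (\<Sum>u\<in>V. \<phi> u))"

definition spin_model ::
  "'v set \<Rightarrow> 'v set set \<Rightarrow> ('v set \<Rightarrow> real) \<Rightarrow> real \<Rightarrow> real \<Rightarrow> real measure \<Rightarrow> ('v \<Rightarrow> real) measure" where
  "spin_model V E J \<beta> h \<rho> = normalized_density (\<Pi>\<^sub>M u\<in>V. \<rho>) (spin_weight V E J \<beta> h)"

(* In the extended graph None is the ghost vertex and Some v is the vertex v. *)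
definition ext_edges :: "'v set \<Rightarrow> 'v set set \<Rightarrow> 'v option set set" where
  "ext_edges V E = (`) Some ` E \<union> (\<lambda>v. {Some v, None}) ` V"

(* The field h acts as a coupling to a ghost spin frozen at 1. *)
definition ext_spin :: "('v \<Rightarrow> real) \<Rightarrow> 'v option \<Rightarrow> real" where
  "ext_spin \<phi> = case_option 1 \<phi>"

definition ext_coupling :: "('v set \<Rightarrow> real) \<Rightarrow> real \<Rightarrow> real \<Rightarrow> 'v option set \<Rightarrow> real" where
  "ext_coupling J \<beta> h e = (if None \<in> e then h else \<beta> * J (Some -` e))"

definition edge_prob :: "('a set \<Rightarrow> real) \<Rightarrow> ('a \<Rightarrow> real) \<Rightarrow> 'a set \<Rightarrow> real" where
  "edge_prob K \<phi> e =
     (if (\<Prod>x\<in>e. \<phi> x) \<le> 0 then 0 else 1 - exp (- 4 * K e * (\<Prod>x\<in>e. \<bar>\<phi> x\<bar>)))"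

definition open_edges :: "'a set set \<Rightarrow> ('a set \<Rightarrow> real) \<Rightarrow> ('a \<Rightarrow> real) \<Rightarrow> ('a set \<Rightarrow> bool) measure" where
  "open_edges E K \<phi> = (\<Pi>\<^sub>M e\<in>E. measure_pmf (bernoulli_pmf (edge_prob K \<phi> e)))"

abbreviation spin_space :: "'v set \<Rightarrow> ('v \<Rightarrow> real) measure" where
  "spin_space V \<equiv> (\<Pi>\<^sub>M u\<in>V. borel)"

abbreviation edge_space :: "'a set set \<Rightarrow> ('a set \<Rightarrow> bool) measure" where
  "edge_space E \<equiv> (\<Pi>\<^sub>M e\<in>E. count_space UNIV)"

abbreviation config_space ::
  "'v set \<Rightarrow> 'v set set \<Rightarrow> (('v \<Rightarrow> real) \<times> ('v \<Rightarrow> real) \<times> ('v option set \<Rightarrow> bool) \<times> ('v set \<Rightarrow> bool)) measure" where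
  "config_space V E \<equiv>
     spin_space V \<Otimes>\<^sub>M spin_space V \<Otimes>\<^sub>M edge_space (ext_edges V E) \<Otimes>\<^sub>M edge_space E"

definition double_cluster_swapping ::
  "'v set \<Rightarrow> 'v set set \<Rightarrow> ('v set \<Rightarrow> real) \<Rightarrow> real \<Rightarrow> real \<Rightarrow> real measure \<Rightarrow>
     (('v \<Rightarrow> real) \<times> ('v \<Rightarrow> real) \<times> ('v option set \<Rightarrow> bool) \<times> ('v set \<Rightarrow> bool)) measure" where
  "double_cluster_swapping V E J \<beta> h \<rho> =
     do {
       (\<phi>, \<phi>') \<leftarrow> spin_model V E J \<beta> h \<rho> \<Otimes>\<^sub>M spin_model V E J \<beta> h \<rho>;
       let \<phi>\<^sub>p = (\<lambda>u\<in>V. (\<phi> u + \<phi>' u) / 2);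
       let \<phi>\<^sub>m = (\<lambda>u\<in>V. (\<phi> u - \<phi>' u) / 2);
       \<omega>\<^sub>p \<leftarrow> open_edges (ext_edges V E) (ext_coupling J \<beta> h) (ext_spin \<phi>\<^sub>p);
       \<omega>\<^sub>m \<leftarrow> open_edges E (\<lambda>e. \<beta> * J e) \<phi>\<^sub>m;
       return (config_space V E) (\<phi>\<^sub>p, \<phi>\<^sub>m, \<omega>\<^sub>p, \<omega>\<^sub>m)
     }"

(* In the applications the elements of space \<Omega> are tuples of extensional functions, on which the
   order of 'b is the componentwise one. Expectations are taken in [0, \<infinity>]. *)
definition satisfies_FKG :: "'a measure \<Rightarrow> 'b::order measure \<Rightarrow> ('a \<Rightarrow> 'b) \<Rightarrow> bool" where
  "satisfies_FKG M \<Omega> X \<longleftrightarrow>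
     (\<forall>F\<in>borel_measurable \<Omega>. \<forall>G\<in>borel_measurable \<Omega>.
        (\<forall>x\<in>space \<Omega>. 0 \<le> F x \<and> 0 \<le> G x) \<longrightarrow>
        mono_on (space \<Omega>) F \<longrightarrow> mono_on (space \<Omega>) (G :: 'b \<Rightarrow> real) \<longrightarrow>
        (\<integral>\<^sup>+x. ennreal (F (X x)) \<partial>M) * (\<integral>\<^sup>+x. ennreal (G (X x)) \<partial>M)
          \<le> (\<integral>\<^sup>+x. ennreal (F (X x) * G (X x)) \<partial>M))"

definition negatively_associated ::
  "'a measure \<Rightarrow> 'b::order measure \<Rightarrow> ('a \<Rightarrow> 'b) \<Rightarrow> 'c::order measure \<Rightarrow> ('a \<Rightarrow> 'c) \<Rightarrow> bool" where
  "negatively_associated M \<Omega>\<^sub>1 X \<Omega>\<^sub>2 Y \<longleftrightarrow>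
     (\<forall>F\<in>borel_measurable \<Omega>\<^sub>1. \<forall>G\<in>borel_measurable \<Omega>\<^sub>2.
        (\<forall>x\<in>space \<Omega>\<^sub>1. 0 \<le> F x) \<longrightarrow> (\<forall>y\<in>space \<Omega>\<^sub>2. 0 \<le> G y) \<longrightarrow>
        mono_on (space \<Omega>\<^sub>1) (F :: 'b \<Rightarrow> real) \<longrightarrow> mono_on (space \<Omega>\<^sub>2) (G :: 'c \<Rightarrow> real) \<longrightarrow>
        (\<integral>\<^sup>+x. ennreal (F (X x) * G (Y x)) \<partial>M)
          \<le> (\<integral>\<^sup>+x. ennreal (F (X x)) \<partial>M) * (\<integral>\<^sup>+x. ennreal (G (Y x)) \<partial>M))"

lemma edge_prob_ext_ordinary:
  assumes "u \<noteq> v"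
  shows "edge_prob (ext_coupling J \<beta> h) (ext_spin \<phi>) {Some u, Some v} =
    (if \<phi> u * \<phi> v \<le> 0 then 0 else 1 - exp (- 4 * (\<beta> * J {u, v}) * (\<bar>\<phi> u\<bar> * \<bar>\<phi> v\<bar>)))"
proof -
  have "Some -` {Some u, Some v} = {u, v}" by auto
  then show ?thesis using assms by (simp add: edge_prob_def ext_coupling_def ext_spin_def)
qed

lemma edge_prob_ext_ghost:
  "edge_prob (ext_coupling J \<beta> h) (ext_spin \<phi>) {Some u, None} =
    (if \<phi> u \<le> 0 then 0 else 1 - exp (- 4 * h * \<bar>\<phi> u\<bar>))"
  by (simp add: edge_prob_def ext_coupling_def ext_spin_def)

lemma prob_space_open_edges: "prob_space (open_edges E K \<phi>)"
  unfolding open_edges_def by (intro prob_space_PiM prob_space_measure_pmf)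

lemma sets_open_edges: "sets (open_edges E K \<phi>) = sets (edge_space E)"
  unfolding open_edges_def by (intro sets_PiM_cong) auto

lemma measurable_open_edges:
  assumes fin: "finite E" and m: "\<And>e. e \<in> E \<Longrightarrow> (\<lambda>x. edge_prob K (\<phi> x) e) \<in> borel_measurable M"
    and pr: "\<And>e x. e \<in> E \<Longrightarrow> edge_prob K (\<phi> x) e \<in> {0..1}"
  shows "(\<lambda>x. open_edges E K (\<phi> x)) \<in> M \<rightarrow>\<^sub>M prob_algebra (edge_space E)"
proof (rule measurable_prob_algebra_generated[OF sets_PiM Int_stable_prod_algebra prod_algebra_sets_into_space])
  fix A assume A: "A \<in> prod_algebra E (\<lambda>_. count_space UNIV :: bool measure)"
  obtain B where B: "A = (\<Pi>\<^sub>E e\<in>E. B e)" using prod_algebraE_all[OF A] by blast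
  have bm: "(\<lambda>x. emeasure (measure_pmf (bernoulli_pmf (edge_prob K (\<phi> x) e))) (B e)) \<in> borel_measurable M"
    if e: "e \<in> E" for e
  proof -
    have 1: "emeasure (measure_pmf (bernoulli_pmf (edge_prob K (\<phi> x) e))) (B e)
      = ennreal (\<Sum>b\<in>B e. if b then edge_prob K (\<phi> x) e else 1 - edge_prob K (\<phi> x) e)" for x
      using pr[OF e, of x]
      by (subst emeasure_measure_pmf_finite) (auto simp: sum_ennreal intro!: arg_cong[where f=ennreal] sum.cong split: if_splits)
    show ?thesis unfolding 1 using m[OF e] by measurable
  qed
  interpret product_sigma_finite "\<lambda>e. measure_pmf (bernoulli_pmf (edge_prob K (\<phi> x) e))" for x
    by (simp add: product_sigma_finite_def measure_pmf.sigma_finite_measure_axioms)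
  have "emeasure (open_edges E K (\<phi> x)) A = (\<Prod>e\<in>E. emeasure (measure_pmf (bernoulli_pmf (edge_prob K (\<phi> x) e))) (B e))" for x
    unfolding open_edges_def B by (intro emeasure_PiM fin) auto
  then show "(\<lambda>x. emeasure (open_edges E K (\<phi> x)) A) \<in> borel_measurable M"
    using bm by simp
qed (auto simp: prob_space_open_edges sets_open_edges)

lemma edge_prob_range:
  assumes "K e \<ge> 0" shows "edge_prob K \<phi> e \<in> {0..1}"
  using assms by (auto simp: edge_prob_def intro!: mult_nonneg_nonneg prod_nonneg)

lemma abs_mult_le_squares:
  fixes x y :: real shows "\<bar>x * y\<bar> \<le> x\<^sup>2 + y\<^sup>2"
proof -
  have "0 \<le> (\<bar>x\<bar> - \<bar>y\<bar>)\<^sup>2" by simp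
  then have "2 * (\<bar>x\<bar> * \<bar>y\<bar>) \<le> x\<^sup>2 + y\<^sup>2" by (simp add: power2_diff)
  moreover have "0 \<le> \<bar>x\<bar> * \<bar>y\<bar>" by simp
  ultimately show ?thesis unfolding abs_mult by linarith
qed

lemma spin_weight_bound:
  assumes g: "finite_graph V E" and J: "\<And>e. e \<in> E \<Longrightarrow> 0 \<le> J e" and \<beta>: "0 \<le> \<beta>" and h: "0 \<le> h"
  defines "c \<equiv> \<beta> * (\<Sum>e\<in>E. J e) + h"
  shows "spin_weight V E J \<beta> h \<phi> \<le> exp (h * card V) * (\<Prod>u\<in>V. exp (c * (\<phi> u)\<^sup>2))"
proof -
  have E: "e \<subseteq> V \<and> card e = 2" if "e \<in> E" for e using g that by (auto simp: finite_graph_def)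
  have fV: "finite V" using g by (auto simp: finite_graph_def)
  have "(\<Prod>x\<in>e. \<phi> x) \<le> (\<Sum>u\<in>V. (\<phi> u)\<^sup>2)" if "e \<in> E" for e
  proof -
    obtain u v where e: "e = {u,v}" "u \<noteq> v" using E[OF \<open>e \<in> E\<close>] by (auto simp: card_2_iff)
    have "(\<Prod>x\<in>e. \<phi> x) \<le> (\<phi> u)\<^sup>2 + (\<phi> v)\<^sup>2" using e abs_mult_le_squares[of "\<phi> u" "\<phi> v"] by simp
    also have "\<dots> = (\<Sum>x\<in>e. (\<phi> x)\<^sup>2)" using e by simp
    also have "\<dots> \<le> (\<Sum>u\<in>V. (\<phi> u)\<^sup>2)" using E[OF that] fV by (intro sum_mono2) auto
    finally show ?thesis .
  qed
  then have "(\<Sum>e\<in>E. J e * (\<Prod>x\<in>e. \<phi> x)) \<le> (\<Sum>e\<in>E. J e * (\<Sum>u\<in>V. (\<phi> u)\<^sup>2))"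
    using J by (intro sum_mono mult_left_mono) auto
  then have 1: "\<beta> * (\<Sum>e\<in>E. J e * (\<Prod>x\<in>e. \<phi> x)) \<le> \<beta> * ((\<Sum>e\<in>E. J e) * (\<Sum>u\<in>V. (\<phi> u)\<^sup>2))"
    using \<beta> by (intro mult_left_mono) (auto simp: sum_distrib_right)
  have "\<phi> u \<le> 1 + (\<phi> u)\<^sup>2" for u
    using abs_mult_le_squares[of 1 "\<phi> u"] by simp
  then have "(\<Sum>u\<in>V. \<phi> u) \<le> (\<Sum>u\<in>V. 1 + (\<phi> u)\<^sup>2)" by (intro sum_mono)
  then have 2: "h * (\<Sum>u\<in>V. \<phi> u) \<le> h * (card V + (\<Sum>u\<in>V. (\<phi> u)\<^sup>2))"
    using h by (intro mult_left_mono) (auto simp: sum.distrib)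
  have "\<beta> * (\<Sum>e\<in>E. J e * (\<Prod>x\<in>e. \<phi> x)) + h * (\<Sum>u\<in>V. \<phi> u) \<le> h * card V + c * (\<Sum>u\<in>V. (\<phi> u)\<^sup>2)"
    using 1 2 unfolding c_def by (simp add: algebra_simps)
  then show ?thesis unfolding spin_weight_def
    by (simp add: exp_sum[symmetric] exp_add[symmetric] fV sum_distrib_left)
qed

lemma measurable_spin_weight:
  assumes g: "finite_graph V E" 
  shows "spin_weight V E J \<beta> h \<in> borel_measurable (spin_space V)"
proof -
  have [measurable]: "(\<lambda>\<phi>. \<phi> x) \<in> borel_measurable (spin_space V)" if "e \<in> E" "x \<in> e" for e x
    using g that by (intro measurable_component_singleton) (auto simp: finite_graph_def)
  show ?thesis unfolding spin_weight_def by measurable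
qed

lemma prob_space_normalized_density:
  assumes [measurable]: "f \<in> borel_measurable M" and "(\<integral>\<^sup>+x. ennreal (f x) \<partial>M) \<noteq> 0" "(\<integral>\<^sup>+x. ennreal (f x) \<partial>M) \<noteq> \<infinity>"
  shows "prob_space (normalized_density M f)"
  unfolding normalized_density_def using assms
  by (auto simp: emeasure_density nn_integral_divide ennreal_divide_self less_top cong: nn_integral_cong intro!: prob_spaceI)

lemma spin_model_in_prob_algebra:
  assumes g: "finite_graph V E" and J: "\<And>e. e \<in> E \<Longrightarrow> 0 \<le> J e" and \<beta>: "0 \<le> \<beta>" and h: "0 \<le> h"
    and r: "reference_measure \<rho>"
  shows "spin_model V E J \<beta> h \<rho> \<in> space (prob_algebra (spin_space V))"
proof -
  interpret real_distribution \<rho> using r by (simp add: reference_measure_def)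
  interpret product_sigma_finite "\<lambda>_. \<rho>" ..
  interpret P: prob_space "\<Pi>\<^sub>M u\<in>V. \<rho>" by (intro prob_space_PiM) unfold_locales
  have fV: "finite V" using g by (auto simp: finite_graph_def)
  have s: "sets (\<Pi>\<^sub>M u\<in>V. \<rho>) = sets (spin_space V)" by (intro sets_PiM_cong) auto
  have m: "spin_weight V E J \<beta> h \<in> borel_measurable (\<Pi>\<^sub>M u\<in>V. \<rho>)"
    using measurable_spin_weight[OF g] by (simp cong: measurable_cong_sets add: measurable_cong_sets[OF s])
  define c where "c = \<beta> * (\<Sum>e\<in>E. J e) + h"
  have c: "c \<ge> 0" unfolding c_def using J \<beta> h by (intro add_nonneg_nonneg mult_nonneg_nonneg sum_nonneg) auto
  have "(\<integral>\<^sup>+\<phi>. ennreal (spin_weight V E J \<beta> h \<phi>) \<partial>(\<Pi>\<^sub>M u\<in>V. \<rho>))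
     \<le> (\<integral>\<^sup>+\<phi>. ennreal (exp (h * card V)) * (\<Prod>u\<in>V. ennreal (exp (c * (\<phi> u)\<^sup>2))) \<partial>(\<Pi>\<^sub>M u\<in>V. \<rho>))"
    using spin_weight_bound[of V E J \<beta> h, OF g J \<beta> h, folded c_def]
    by (intro nn_integral_mono) (auto simp: prod_ennreal prod_nonneg ennreal_mult[symmetric] intro!: ennreal_leI)
  also have "\<dots> = ennreal (exp (h * card V)) * (\<integral>\<^sup>+\<phi>. (\<Prod>u\<in>V. ennreal (exp (c * (\<phi> u)\<^sup>2))) \<partial>(\<Pi>\<^sub>M u\<in>V. \<rho>))"
    by (intro nn_integral_cmult) measurable
  also have "(\<integral>\<^sup>+\<phi>. (\<Prod>u\<in>V. ennreal (exp (c * (\<phi> u)\<^sup>2))) \<partial>(\<Pi>\<^sub>M u\<in>V. \<rho>)) = (\<Prod>u\<in>V. \<integral>\<^sup>+x. ennreal (exp (c * x\<^sup>2)) \<partial>\<rho>)"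
    by (intro product_nn_integral_prod fV) measurable
  also have "ennreal (exp (h * card V)) * \<dots> < \<infinity>"
  proof -
    have "integrable \<rho> (\<lambda>x. exp (c * x\<^sup>2))" using r c by (auto simp: reference_measure_def)
    then have "(\<integral>\<^sup>+x. ennreal (exp (c * x\<^sup>2)) \<partial>\<rho>) = ennreal (integral\<^sup>L \<rho> (\<lambda>x. exp (c * x\<^sup>2)))"
      by (intro nn_integral_eq_integral) auto
    then show ?thesis by (simp add: ennreal_power ennreal_mult[symmetric] less_top[symmetric] del: ennreal_mult_less_top)
  qed
  finally have fin: "(\<integral>\<^sup>+\<phi>. ennreal (spin_weight V E J \<beta> h \<phi>) \<partial>(\<Pi>\<^sub>M u\<in>V. \<rho>)) < \<infinity>" .
  have nz: "(\<integral>\<^sup>+\<phi>. ennreal (spin_weight V E J \<beta> h \<phi>) \<partial>(\<Pi>\<^sub>M u\<in>V. \<rho>)) \<noteq> 0"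
  proof
    assume "(\<integral>\<^sup>+\<phi>. ennreal (spin_weight V E J \<beta> h \<phi>) \<partial>(\<Pi>\<^sub>M u\<in>V. \<rho>)) = 0"
    then have "AE \<phi> in (\<Pi>\<^sub>M u\<in>V. \<rho>). ennreal (spin_weight V E J \<beta> h \<phi>) = 0"
      using m by (subst (asm) nn_integral_0_iff_AE) auto
    then have "AE \<phi> in (\<Pi>\<^sub>M u\<in>V. \<rho>). False" by eventually_elim (simp add: spin_weight_def ennreal_eq_0_iff)
    then show False by simp
  qed
  show ?thesis unfolding space_prob_algebra spin_model_def
    using prob_space_normalized_density[OF m nz] fin s by (auto simp: normalized_density_def)
qed

lemma finite_edges: "finite_graph V E \<Longrightarrow> finite E \<and> finite (ext_edges V E)"
proof -
  assume g: "finite_graph V E"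
  then have "finite E" by (auto simp: finite_graph_def intro: finite_subset[of E "Pow V"])
  with g show ?thesis by (auto simp: finite_graph_def ext_edges_def)
qed

(* The sampling kernels are measurable, so that the monadic definition yields a genuine
   probability measure on the configuration space. *)
lemma double_cluster_swapping_in_prob_algebra:
  assumes g: "finite_graph V E" and J: "\<And>e. e \<in> E \<Longrightarrow> 0 \<le> J e" and \<beta>: "0 \<le> \<beta>" and h: "0 \<le> h"
    and r: "reference_measure \<rho>"
  shows "double_cluster_swapping V E J \<beta> h \<rho> \<in> space (prob_algebra (config_space V E))"
proof -
  have fE: "finite E" "finite (ext_edges V E)" using finite_edges[OF g] by auto
  have Vc: "x \<in> V" if "e \<in> E" "x \<in> e" for e x using g that by (auto simp: finite_graph_def)
  have Kr: "ext_coupling J \<beta> h e \<ge> 0" if "e \<in> ext_edges V E" for e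
    using that J \<beta> h by (auto simp: ext_edges_def ext_coupling_def inj_vimage_image_eq)
  have comp: "(\<lambda>\<phi>. \<phi> x) \<in> borel_measurable (spin_space V)" if "x \<in> V" for x
    using that by (rule measurable_component_singleton)
  have mm: "(\<lambda>\<phi>. open_edges E (\<lambda>e. \<beta> * J e) \<phi>) \<in> spin_space V \<rightarrow>\<^sub>M prob_algebra (edge_space E)"
  proof (rule measurable_open_edges[OF fE(1)])
    fix e assume e: "e \<in> E"
    have [measurable]: "(\<lambda>\<phi>. \<phi> x) \<in> borel_measurable (spin_space V)" if "x \<in> e" for x
      using comp Vc e that by blast
    show "(\<lambda>\<phi>. edge_prob (\<lambda>e. \<beta> * J e) \<phi> e) \<in> borel_measurable (spin_space V)"
      unfolding edge_prob_def by measurable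
  qed (use J \<beta> in \<open>intro edge_prob_range, auto\<close>)
  have mp: "(\<lambda>\<phi>. open_edges (ext_edges V E) (ext_coupling J \<beta> h) (ext_spin \<phi>)) \<in> spin_space V \<rightarrow>\<^sub>M prob_algebra (edge_space (ext_edges V E))"
  proof (rule measurable_open_edges[OF fE(2)])
    fix e assume e: "e \<in> ext_edges V E"
    have [measurable]: "(\<lambda>\<phi>. ext_spin \<phi> x) \<in> borel_measurable (spin_space V)" if "x \<in> e" for x
      using comp Vc e that by (cases x) (auto simp: ext_spin_def ext_edges_def)
    show "(\<lambda>\<phi>. edge_prob (ext_coupling J \<beta> h) (ext_spin \<phi>) e) \<in> borel_measurable (spin_space V)"
      unfolding edge_prob_def by measurable
  qed (use Kr in \<open>intro edge_prob_range, auto\<close>)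
  note mm' = measurable_compose[OF _ mm] and mp' = measurable_compose[OF _ mp]
  note [measurable] = spin_model_in_prob_algebra[OF assms]
  have pp: "spin_model V E J \<beta> h \<rho> \<Otimes>\<^sub>M spin_model V E J \<beta> h \<rho> \<in> space (prob_algebra (spin_space V \<Otimes>\<^sub>M spin_space V))"
    using spin_model_in_prob_algebra[OF assms] by (auto simp: space_prob_algebra prob_space_pair intro!: sets_pair_measure_cong)
  have a: "(\<lambda>(\<phi>, \<phi>'). \<lambda>u\<in>V. (\<phi> u + \<phi>' u) / 2) \<in> spin_space V \<Otimes>\<^sub>M spin_space V \<rightarrow>\<^sub>M spin_space V"
   and b: "(\<lambda>(\<phi>, \<phi>'). \<lambda>u\<in>V. (\<phi> u - \<phi>' u) / 2) \<in> spin_space V \<Otimes>\<^sub>M spin_space V \<rightarrow>\<^sub>M spin_space V"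
    unfolding split_beta' by measurable
  define K where "K = (\<lambda>(\<phi>p, \<phi>m). open_edges (ext_edges V E) (ext_coupling J \<beta> h) (ext_spin \<phi>p) \<bind> (\<lambda>\<omega>p. 
      open_edges E (\<lambda>e. \<beta> * J e) \<phi>m \<bind> (\<lambda>\<omega>m. return (config_space V E) (\<phi>p, \<phi>m, \<omega>p, \<omega>m))))"
  have K: "K \<in> spin_space V \<Otimes>\<^sub>M spin_space V \<rightarrow>\<^sub>M prob_algebra (config_space V E)"
    unfolding K_def split_beta'
    by (rule measurable_bind_prob_space2[OF mp'[OF measurable_fst]], unfold split_beta',
        rule measurable_bind_prob_space2[OF mm'[OF measurable_compose[OF measurable_fst measurable_snd]]], unfold split_beta',
        rule measurable_compose[OF _ measurable_return_prob_space]) measurable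
  have c: "(\<lambda>x. ((\<lambda>u\<in>V. (fst x u + snd x u) / 2), (\<lambda>u\<in>V. (fst x u - snd x u) / 2))) \<in> spin_space V \<Otimes>\<^sub>M spin_space V \<rightarrow>\<^sub>M spin_space V \<Otimes>\<^sub>M spin_space V"
    using a b unfolding split_beta' by (intro measurable_Pair)
  have eq: "double_cluster_swapping V E J \<beta> h \<rho> = (spin_model V E J \<beta> h \<rho> \<Otimes>\<^sub>M spin_model V E J \<beta> h \<rho>) \<bind>
     (\<lambda>x. K ((\<lambda>u\<in>V. (fst x u + snd x u) / 2), (\<lambda>u\<in>V. (fst x u - snd x u) / 2)))"
    unfolding double_cluster_swapping_def K_def by (simp add: split_beta' Let_def)
  show ?thesis unfolding eq space_prob_algebra
    using prob_space_bind'[OF pp measurable_compose[OF c K]] sets_bind'[OF pp measurable_compose[OF c K]] by auto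
qed

end

theory Submission
  imports Defs
begin

text \<open>In the rotated coordinates \<open>\<phi>\<^sub>p, \<phi>\<^sub>m\<close> the pair of spin models has weight
  \<open>exp (2\<beta> \<Sum> J (\<phi>\<^sub>p \<phi>\<^sub>p + \<phi>\<^sub>m \<phi>\<^sub>m) + 2h \<Sum> \<phi>\<^sub>p)\<close>, and the single-site measure is invariant under both sign
  changes. Given the absolute values \<open>(\<xi>\<^sub>p, \<xi>\<^sub>m)\<close> the signs are therefore two independent Ising models, and
  \<open>\<omega>\<^sub>p, \<omega>\<^sub>m\<close> are their random cluster representations. Averaging over the signs leaves the density
  \<open>Z\<^sub>p(\<xi>\<^sub>p) Z\<^sub>m(\<xi>\<^sub>m)\<close> with respect to a product of single-site laws of \<open>(\<xi>\<^sub>p, \<xi>\<^sub>m)\<close>.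

  The joint density of \<open>(\<xi>, \<omega>)\<close> is not log-supermodular, so the lattice condition is used in two stages:
  for the edges given \<open>\<xi>\<close>, where Holley's criterion makes the conditional expectation of an increasing
  function increasing in \<open>(\<xi>\<^sub>p, -\<xi>\<^sub>m)\<close>, and for \<open>\<xi>\<close> itself. Both the log-supermodularity of \<open>Z\<close> and Holley's
  criterion follow from Ginibre's duplication of the signs.

  The single-site law of \<open>(\<xi>\<^sub>p, -\<xi>\<^sub>m)\<close> satisfies the four functions theorem: for a potential \<open>P\<close> its density
  is \<open>exp (- P(x + y) - P(x - y))\<close>, which has the required sign of the mixed derivative because \<open>P'\<close> is
  convex on the positive half-line. For bounded functions the property survives weak limits, since it may be tested on continuous
  functions.\<close>

section \<open>Sums over sign configurations\<close>

text \<open>With all edges closed, the weight of \<open>(\<xi>, \<omega>)\<close> is, up to a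
  constant factor, the exponential of minus a sum of products of absolute values over the edges.
  This is log-submodular in \<open>\<xi>\<close>, the wrong direction, and it is the obstacle to
  treating edges and absolute values together. Comparing edge weights at two ordered configurations
  of absolute values is harmless, because the same exponential prefactors then occur on both sides.
  Hence the edges are summed out before the lattice argument for \<open>\<xi>\<close> begins: only
  \<open>cluster_sum\<close> enters it, through \<open>cluster_sum_four_functions\<close>.

  A reference measure obtained as a weak limit may have no density, so there is no pointwise lattice
  condition to impose on it. Its consequence, the four functions inequality, is therefore made a
  property of the measure itself, inherited by finite products. The price is a restriction to
  bounded functions, which is removed at the end by capping the test functions and cutting the sites
  to a box; a box is a sublattice, so the cut does not disturb the inequality.\<close>

definition signs :: "'v set \<Rightarrow> ('v \<Rightarrow> real) set" where
  "signs V = (\<Pi>\<^sub>E v\<in>V. {-1, 1})"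

lemma finite_signs: "finite V \<Longrightarrow> finite (signs V)"
  unfolding signs_def by (intro finite_PiE) auto

lemma signs_values: "\<sigma> \<in> signs V \<Longrightarrow> x \<in> V \<Longrightarrow> \<sigma> x = 1 \<or> \<sigma> x = -1"
  by (auto simp: signs_def PiE_iff)

lemma prod_signs_values:
  assumes "\<sigma> \<in> signs V" "a \<subseteq> V"
  shows "(\<Prod>x\<in>a. \<sigma> x) = 1 \<or> (\<Prod>x\<in>a. \<sigma> x) = -1"
proof -
  have "\<bar>\<Prod>x\<in>a. \<sigma> x\<bar> = (\<Prod>x\<in>a. 1)"
    unfolding abs_prod using signs_values[OF assms(1)] assms(2) by (intro prod.cong) fastforce+
  then show ?thesis by auto
qed

lemma bij_signs_mult:
  assumes "\<sigma> \<in> signs V"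
  shows "bij_betw (\<lambda>\<tau>. \<lambda>x\<in>V. \<sigma> x * \<tau> x) (signs V) (signs V)"
proof (rule bij_betwI[where g = "\<lambda>\<tau>. \<lambda>x\<in>V. \<sigma> x * \<tau> x"])
  have inv: "(\<lambda>x\<in>V. \<sigma> x * (\<lambda>x\<in>V. \<sigma> x * \<tau> x) x) = \<tau>" if "\<tau> \<in> signs V" for \<tau>
    using signs_values[OF assms] that by (fastforce simp: signs_def PiE_iff extensional_def fun_eq_iff)
  show maps: "(\<lambda>\<tau>. \<lambda>x\<in>V. \<sigma> x * \<tau> x) \<in> signs V \<rightarrow> signs V"
    using assms by (fastforce simp: signs_def PiE_iff)
  show "(\<lambda>\<tau>. \<lambda>x\<in>V. \<sigma> x * \<tau> x) \<in> signs V \<rightarrow> signs V" by (rule maps)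
  show "(\<lambda>x\<in>V. \<sigma> x * (\<lambda>x\<in>V. \<sigma> x * \<tau> x) x) = \<tau>" if "\<tau> \<in> signs V" for \<tau> using inv[OF that] .
  show "(\<lambda>x\<in>V. \<sigma> x * (\<lambda>x\<in>V. \<sigma> x * \<tau> x) x) = \<tau>" if "\<tau> \<in> signs V" for \<tau> using inv[OF that] .
qed

text \<open>Collecting factors vertex by vertex splits the sum into a product of one-site sums of
  \<open>s ^ n\<close> over \<open>s = -1, 1\<close>, each equal to 0 or 2 by the parity of
  \<open>n\<close>. This is the positivity behind Griffiths-type inequalities.\<close>

lemma sum_signs_prod_nonneg:
  assumes V: "finite V" and T: "finite T" and a: "\<And>e. e \<in> T \<Longrightarrow> a e \<subseteq> V"
  shows "0 \<le> (\<Sum>\<sigma>\<in>signs V. \<Prod>e\<in>T. \<Prod>x\<in>a e. \<sigma> x)"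
proof -
  have "(\<Prod>e\<in>T. \<Prod>x\<in>a e. \<sigma> x) = (\<Prod>x\<in>V. (\<sigma> x :: real) ^ card {e\<in>T. x \<in> a e})" for \<sigma>
  proof -
    have "(\<Prod>e\<in>T. \<Prod>x\<in>a e. \<sigma> x) = (\<Prod>e\<in>T. \<Prod>x\<in>V. if x \<in> a e then \<sigma> x else 1)"
    proof (rule prod.cong[OF refl])
      fix e assume "e \<in> T"
      then show "(\<Prod>x\<in>a e. \<sigma> x) = (\<Prod>x\<in>V. if x \<in> a e then \<sigma> x else 1)"
        using prod.inter_restrict[OF V, of \<sigma> "a e"] a by (simp add: Int_absorb1)
    qed
    also have "\<dots> = (\<Prod>x\<in>V. \<Prod>e\<in>T. if x \<in> a e then \<sigma> x else 1)" by (rule prod.swap)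
    also have "\<dots> = (\<Prod>x\<in>V. \<sigma> x ^ card {e\<in>T. x \<in> a e})"
      using T by (simp add: prod.If_cases Int_def)
    finally show ?thesis .
  qed
  then have "(\<Sum>\<sigma>\<in>signs V. \<Prod>e\<in>T. \<Prod>x\<in>a e. \<sigma> x) = (\<Prod>x\<in>V. \<Sum>s\<in>{-1, 1::real}. s ^ card {e\<in>T. x \<in> a e})"
    unfolding signs_def using V by (subst prod_sum_PiE) simp_all
  also have "\<dots> \<ge> 0" by (intro prod_nonneg) (auto simp: minus_one_power_iff)
  finally show ?thesis .
qed

text \<open>Writing \<open>c s = u + v * s\<close> on signs, the two inequalities say \<open>\<bar>u\<bar> \<le> u'\<close> and \<open>\<bar>v\<bar> \<le> v'\<close>.\<close>

definition sign_dominated :: "(real \<Rightarrow> real) \<Rightarrow> (real \<Rightarrow> real) \<Rightarrow> bool" where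
  "sign_dominated c d \<longleftrightarrow> \<bar>c 1 + c (-1)\<bar> \<le> d 1 + d (-1) \<and> \<bar>c 1 - c (-1)\<bar> \<le> d 1 - d (-1)"

text \<open>Every function on signs is affine, so each product expands into a sum over subsets
  \<open>T\<close> of \<open>I\<close>, with coefficients built from the even and odd parts.
  Domination compares the coefficients in absolute value, and the remaining sums over
  \<open>\<sigma>\<close> are nonnegative by \<open>sum_signs_prod_nonneg\<close>.\<close>

lemma sum_signs_mono:
  fixes a :: "'e \<Rightarrow> 'v set" and c d :: "'e \<Rightarrow> real \<Rightarrow> real"
  assumes V: "finite V" and I: "finite I" and a: "\<And>e. e \<in> I \<Longrightarrow> a e \<subseteq> V"
    and cd: "\<And>e. e \<in> I \<Longrightarrow> sign_dominated (c e) (d e)"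
  shows "(\<Sum>\<sigma>\<in>signs V. \<Prod>e\<in>I. c e (\<Prod>x\<in>a e. \<sigma> x)) \<le> (\<Sum>\<sigma>\<in>signs V. \<Prod>e\<in>I. d e (\<Prod>x\<in>a e. \<sigma> x))"
proof -
  define u where "u f e = (f e 1 + f e (-1)) / 2" for f :: "'e \<Rightarrow> real \<Rightarrow> real" and e
  define v where "v f e = (f e 1 - f e (-1)) / 2" for f :: "'e \<Rightarrow> real \<Rightarrow> real" and e
  have ex: "(\<Sum>\<sigma>\<in>signs V. \<Prod>e\<in>I. f e (\<Prod>x\<in>a e. \<sigma> x)) =
    (\<Sum>T\<in>Pow I. (\<Prod>e\<in>T. v f e) * (\<Prod>e\<in>I-T. u f e) * (\<Sum>\<sigma>\<in>signs V. \<Prod>e\<in>T. \<Prod>x\<in>a e. \<sigma> x))" for f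
  proof -
    have "(\<Prod>e\<in>I. f e (\<Prod>x\<in>a e. \<sigma> x)) = (\<Prod>e\<in>I. v f e * (\<Prod>x\<in>a e. \<sigma> x) + u f e)" if "\<sigma> \<in> signs V" for \<sigma>
    proof (intro prod.cong refl)
      fix e assume "e \<in> I"
      then show "f e (\<Prod>x\<in>a e. \<sigma> x) = v f e * (\<Prod>x\<in>a e. \<sigma> x) + u f e"
        using prod_signs_values[OF that a[OF \<open>e \<in> I\<close>]] by (auto simp: u_def v_def field_simps)
    qed
    then have "(\<Sum>\<sigma>\<in>signs V. \<Prod>e\<in>I. f e (\<Prod>x\<in>a e. \<sigma> x)) =
      (\<Sum>\<sigma>\<in>signs V. \<Sum>T\<in>Pow I. (\<Prod>e\<in>T. v f e) * (\<Prod>e\<in>I-T. u f e) * (\<Prod>e\<in>T. \<Prod>x\<in>a e. \<sigma> x))"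
      by (simp add: prod_add[OF I] prod.distrib mult_ac)
    also have "\<dots> = (\<Sum>T\<in>Pow I. \<Sum>\<sigma>\<in>signs V. (\<Prod>e\<in>T. v f e) * (\<Prod>e\<in>I-T. u f e) * (\<Prod>e\<in>T. \<Prod>x\<in>a e. \<sigma> x))"
      by (rule sum.swap)
    finally show ?thesis by (simp add: sum_distrib_left)
  qed
  have "\<bar>u c e\<bar> \<le> u d e" "\<bar>v c e\<bar> \<le> v d e" if "e \<in> I" for e
    using cd[OF that] by (simp_all add: sign_dominated_def u_def v_def abs_divide divide_right_mono)
  then have "\<bar>(\<Prod>e\<in>T. v c e) * (\<Prod>e\<in>I-T. u c e)\<bar> \<le> (\<Prod>e\<in>T. v d e) * (\<Prod>e\<in>I-T. u d e)"
    if "T \<subseteq> I" for T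
    unfolding abs_mult abs_prod using that
    by (intro mult_mono prod_mono prod_nonneg) (auto intro: order_trans[OF abs_ge_zero])
  then have "(\<Prod>e\<in>T. v c e) * (\<Prod>e\<in>I-T. u c e) \<le> (\<Prod>e\<in>T. v d e) * (\<Prod>e\<in>I-T. u d e)"
    if "T \<subseteq> I" for T
    using that abs_le_D1 by blast
  then show ?thesis unfolding ex using I
    by (intro sum_mono mult_right_mono sum_signs_prod_nonneg V) (auto intro: finite_subset dest: a)
qed

text \<open>Ginibre's duplication: substitute \<open>\<tau> = \<sigma> \<eta>\<close> in the double sum over \<open>(\<sigma>, \<tau>)\<close> and compare
  the sums over \<open>\<sigma>\<close> for each fixed \<open>\<eta>\<close>.\<close>

lemma sum_signs_duplicate:
  fixes a :: "'e \<Rightarrow> 'v set" and c c' :: "'e \<Rightarrow> real \<Rightarrow> real"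
  assumes a: "\<And>e. e \<in> I \<Longrightarrow> a e \<subseteq> V"
  shows "(\<Sum>\<sigma>\<in>signs V. \<Prod>e\<in>I. c e (\<Prod>x\<in>a e. \<sigma> x)) * (\<Sum>\<sigma>\<in>signs V. \<Prod>e\<in>I. c' e (\<Prod>x\<in>a e. \<sigma> x)) =
    (\<Sum>\<eta>\<in>signs V. \<Sum>\<sigma>\<in>signs V. \<Prod>e\<in>I. c e (\<Prod>x\<in>a e. \<sigma> x) * c' e ((\<Prod>x\<in>a e. \<sigma> x) * (\<Prod>x\<in>a e. \<eta> x)) :: real)"
proof -
  have "(\<Sum>\<tau>\<in>signs V. \<Prod>e\<in>I. c' e (\<Prod>x\<in>a e. \<tau> x)) =
      (\<Sum>\<eta>\<in>signs V. \<Prod>e\<in>I. c' e ((\<Prod>x\<in>a e. \<sigma> x) * (\<Prod>x\<in>a e. \<eta> x)))" if "\<sigma> \<in> signs V" for \<sigma>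
  proof -
    have "(\<Prod>x\<in>a e. (\<lambda>x\<in>V. \<sigma> x * \<eta> x) x) = (\<Prod>x\<in>a e. \<sigma> x) * (\<Prod>x\<in>a e. \<eta> x)" if "e \<in> I" for e \<eta>
      using a[OF that] unfolding prod.distrib[symmetric] by (intro prod.cong) auto
    then show ?thesis
      by (subst sum.reindex_bij_betw[OF bij_signs_mult[OF that], symmetric]) simp
  qed
  then have "(\<Sum>\<sigma>\<in>signs V. (\<Prod>e\<in>I. c e (\<Prod>x\<in>a e. \<sigma> x)) * (\<Sum>\<sigma>\<in>signs V. \<Prod>e\<in>I. c' e (\<Prod>x\<in>a e. \<sigma> x))) =
    (\<Sum>\<sigma>\<in>signs V. \<Sum>\<eta>\<in>signs V. \<Prod>e\<in>I. c e (\<Prod>x\<in>a e. \<sigma> x) * c' e ((\<Prod>x\<in>a e. \<sigma> x) * (\<Prod>x\<in>a e. \<eta> x)))"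
    by (simp add: prod.distrib sum_distrib_left)
  also have "\<dots> = (\<Sum>\<eta>\<in>signs V. \<Sum>\<sigma>\<in>signs V. \<Prod>e\<in>I. c e (\<Prod>x\<in>a e. \<sigma> x) * c' e ((\<Prod>x\<in>a e. \<sigma> x) * (\<Prod>x\<in>a e. \<eta> x)))"
    by (rule sum.swap)
  finally show ?thesis unfolding sum_distrib_right .
qed

text \<open>For fixed \<open>\<eta>\<close> the duplicated summand is again a product of functions
  of one sign per edge, with \<open>t\<close> standing for the sign of \<open>\<eta>\<close> on that
  edge. A product of two partition sums is thus compared edge by edge, for both values of
  \<open>t\<close>.\<close>

lemma sum_signs_mult_mono:
  fixes a :: "'e \<Rightarrow> 'v set" and c c' d d' :: "'e \<Rightarrow> real \<Rightarrow> real"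
  assumes V: "finite V" and I: "finite I" and a: "\<And>e. e \<in> I \<Longrightarrow> a e \<subseteq> V"
    and cd: "\<And>e t. e \<in> I \<Longrightarrow> t \<in> {-1, 1} \<Longrightarrow>
      sign_dominated (\<lambda>s. c e s * c' e (s * t)) (\<lambda>s. d e s * d' e (s * t))"
  shows "(\<Sum>\<sigma>\<in>signs V. \<Prod>e\<in>I. c e (\<Prod>x\<in>a e. \<sigma> x)) * (\<Sum>\<sigma>\<in>signs V. \<Prod>e\<in>I. c' e (\<Prod>x\<in>a e. \<sigma> x))
    \<le> (\<Sum>\<sigma>\<in>signs V. \<Prod>e\<in>I. d e (\<Prod>x\<in>a e. \<sigma> x)) * (\<Sum>\<sigma>\<in>signs V. \<Prod>e\<in>I. d' e (\<Prod>x\<in>a e. \<sigma> x))"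
proof (subst (1 2) sum_signs_duplicate; (rule a sum_mono)?)
  fix \<eta> assume \<eta>: "\<eta> \<in> signs V"
  have t: "(\<Prod>x\<in>a e. \<eta> x) \<in> {-1, 1}" if "e \<in> I" for e
    using prod_signs_values[OF \<eta> a[OF that]] by auto
  show "(\<Sum>\<sigma>\<in>signs V. \<Prod>e\<in>I. c e (\<Prod>x\<in>a e. \<sigma> x) * c' e ((\<Prod>x\<in>a e. \<sigma> x) * (\<Prod>x\<in>a e. \<eta> x)))
    \<le> (\<Sum>\<sigma>\<in>signs V. \<Prod>e\<in>I. d e (\<Prod>x\<in>a e. \<sigma> x) * d' e ((\<Prod>x\<in>a e. \<sigma> x) * (\<Prod>x\<in>a e. \<eta> x)))"
    using sum_signs_mono[OF V I a, where c = "\<lambda>e s. c e s * c' e (s * (\<Prod>x\<in>a e. \<eta> x))"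
        and d = "\<lambda>e s. d e s * d' e (s * (\<Prod>x\<in>a e. \<eta> x))"] cd t by simp
qed

section \<open>The random cluster representation of the Ising model\<close>

text \<open>From \<open>0 \<le> (c - a) * (c - b)\<close> follows
  \<open>c * (a + b) \<le> c * c + a * b \<le> c * (c + d)\<close>. This is the core of the four
  functions theorem on a two-point chain; its \<open>ennreal\<close> version serves for chains
  below.\<close>

lemma mult_le_imp_add_le:
  fixes a b c d :: real
  assumes "a \<le> c" "b \<le> c" "a * b \<le> c * d" "0 \<le> a" "0 \<le> b" "0 \<le> d"
  shows "a + b \<le> c + d"
proof (cases "c = 0")
  case False
  then have "0 < c" using assms by simp
  have "0 \<le> (c - a) * (c - b)" using assms by simp
  then have "c * (a + b) \<le> c * (c + d)" using assms(3) by (simp add: algebra_simps)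
  then show ?thesis using \<open>0 < c\<close> by simp
qed (use assms in auto)

text \<open>Since \<open>max s t * min s t = s * t\<close>, the two summands on either side have the
  same product, and the product of the maxima is the largest of the four.\<close>

lemma prod_max_min_supermodular:
  fixes x y :: "'v \<Rightarrow> real"
  assumes "\<And>v. v \<in> A \<Longrightarrow> 0 \<le> x v" "\<And>v. v \<in> A \<Longrightarrow> 0 \<le> y v"
  shows "(\<Prod>v\<in>A. x v) + (\<Prod>v\<in>A. y v) \<le> (\<Prod>v\<in>A. max (x v) (y v)) + (\<Prod>v\<in>A. min (x v) (y v))"
proof (rule mult_le_imp_add_le)
  show "(\<Prod>v\<in>A. x v) * (\<Prod>v\<in>A. y v) \<le> (\<Prod>v\<in>A. max (x v) (y v)) * (\<Prod>v\<in>A. min (x v) (y v))"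
    unfolding prod.distrib[symmetric] by (intro eq_refl prod.cong) (auto simp: max_def min_def)
qed (use assms in \<open>auto intro!: prod_mono prod_nonneg simp: min_def\<close>)

text \<open>The even and odd parts of \<open>exp (k * s)\<close> in the sign \<open>s\<close> are
  \<open>cosh k\<close> and \<open>sinh k * s\<close>; \<open>cosh\<close> is even and increasing on
  the positive half-line, \<open>sinh\<close> is odd and increasing.\<close>

lemma sign_dominated_exp:
  assumes "\<bar>k\<bar> \<le> l"
  shows "sign_dominated (\<lambda>s. exp (k * s)) (\<lambda>s. exp (l * s))"
proof -
  have "cosh \<bar>k\<bar> \<le> cosh l" using assms by (subst cosh_real_nonneg_le_iff) auto
  moreover have "\<bar>sinh k\<bar> \<le> sinh l"
    using assms by (auto simp: abs_le_iff simp flip: sinh_minus)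
  ultimately have "exp k + exp (- k) \<le> exp l + exp (- l)" "\<bar>exp k - exp (- k)\<bar> \<le> exp l - exp (- l)"
    unfolding cosh_real_abs by (simp_all add: cosh_def sinh_def)
  then show ?thesis by (simp add: sign_dominated_def)
qed

text \<open>The Ising coupling of the signs when the absolute values are \<open>\<xi>\<close>. The
  factor 2 comes from the rotation to half-sums and half-differences. The map \<open>a\<close> sends
  an edge to the spins it involves; a ghost edge involves only one.\<close>

definition edge_spin :: "('e \<Rightarrow> 'v set) \<Rightarrow> ('e \<Rightarrow> real) \<Rightarrow> ('v \<Rightarrow> real) \<Rightarrow> 'e \<Rightarrow> real" where
  "edge_spin a \<kappa> \<xi> e = 2 * \<kappa> e * (\<Prod>x\<in>a e. \<xi> x)"

definition ising_partition :: "'v set \<Rightarrow> 'e set \<Rightarrow> ('e \<Rightarrow> 'v set) \<Rightarrow> ('e \<Rightarrow> real) \<Rightarrow> ('v \<Rightarrow> real) \<Rightarrow> real" where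
  "ising_partition V I a \<kappa> \<xi> = (\<Sum>\<sigma>\<in>signs V. \<Prod>e\<in>I. exp (edge_spin a \<kappa> \<xi> e * (\<Prod>x\<in>a e. \<sigma> x)))"

text \<open>The Edwards-Sokal weight of an edge state together with the sign product
  \<open>s\<close>: an open edge forces \<open>s = 1\<close>, and the two states add up to the Ising
  factor \<open>exp (k * s)\<close>.\<close>

definition edge_weight :: "real \<Rightarrow> bool \<Rightarrow> real \<Rightarrow> real" where
  "edge_weight k b s = exp (- k) * (if b then (exp (2 * k) - 1) * of_bool (s = 1) else 1)"

text \<open>Up to explicit edge factors this counts the signs compatible with the open edges, on a
  graph with ghost a power of 2 whose exponent is the number of clusters not joined to the ghost.
  Kept as a sum over signs, the random cluster weight is open to duplication without any counting of
  clusters.\<close>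

definition cluster_weight ::
  "'v set \<Rightarrow> 'e set \<Rightarrow> ('e \<Rightarrow> 'v set) \<Rightarrow> ('e \<Rightarrow> real) \<Rightarrow> ('v \<Rightarrow> real) \<Rightarrow> ('e \<Rightarrow> bool) \<Rightarrow> real" where
  "cluster_weight V I a \<kappa> \<xi> \<omega> =
     (\<Sum>\<sigma>\<in>signs V. \<Prod>e\<in>I. edge_weight (edge_spin a \<kappa> \<xi> e) (\<omega> e) (\<Prod>x\<in>a e. \<sigma> x))"

locale ising =
  fixes V :: "'v set" and I :: "'e set" and a :: "'e \<Rightarrow> 'v set" and \<kappa> :: "'e \<Rightarrow> real"
  assumes finite_V: "finite V" and finite_I: "finite I"
    and a_subset: "\<And>e. e \<in> I \<Longrightarrow> a e \<subseteq> V" and \<kappa>_nonneg: "\<And>e. e \<in> I \<Longrightarrow> 0 \<le> \<kappa> e"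
begin

lemma edge_spin_nonneg:
  assumes "\<And>v. v \<in> V \<Longrightarrow> 0 \<le> \<xi> v" "e \<in> I"
  shows "0 \<le> edge_spin a \<kappa> \<xi> e"
  using assms a_subset[of e] \<kappa>_nonneg[of e]
  unfolding edge_spin_def by (intro mult_nonneg_nonneg prod_nonneg) auto

lemma edge_spin_mono:
  assumes "\<And>v. v \<in> V \<Longrightarrow> 0 \<le> \<xi> v" "\<And>v. v \<in> V \<Longrightarrow> \<xi> v \<le> \<xi>' v" "e \<in> I"
  shows "edge_spin a \<kappa> \<xi> e \<le> edge_spin a \<kappa> \<xi>' e"
  using assms a_subset[of e] \<kappa>_nonneg[of e] unfolding edge_spin_def
  by (intro mult_left_mono prod_mono) auto

lemma ising_partition_pos: "0 < ising_partition V I a \<kappa> \<xi>"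
proof -
  have "(\<lambda>v\<in>V. 1) \<in> signs V" by (auto simp: signs_def)
  then show ?thesis unfolding ising_partition_def
    by (intro sum_pos finite_signs finite_V prod_pos) auto
qed

text \<open>After duplication the coupling on an edge is \<open>K x + K y * t\<close>. For
  \<open>t = 1\<close> the required bound is the supermodularity of a product of absolute values;
  for \<open>t = -1\<close> it holds because the couplings at \<open>x\<close> and \<open>y\<close>
  lie between those at the minimum and at the maximum.\<close>

lemma ising_partition_log_supermodular:
  assumes x: "\<And>v. v \<in> V \<Longrightarrow> 0 \<le> x v" and y: "\<And>v. v \<in> V \<Longrightarrow> 0 \<le> y v"
  shows "ising_partition V I a \<kappa> x * ising_partition V I a \<kappa> y
    \<le> ising_partition V I a \<kappa> (\<lambda>v. max (x v) (y v)) * ising_partition V I a \<kappa> (\<lambda>v. min (x v) (y v))"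
  unfolding ising_partition_def
proof (rule sum_signs_mult_mono[OF finite_V finite_I a_subset])
  fix e and t :: real
  assume e: "e \<in> I" and t: "t \<in> {-1, 1}"
  let ?K = "\<lambda>\<xi>. edge_spin a \<kappa> \<xi> e"
  let ?M = "\<lambda>v. max (x v) (y v)" and ?m = "\<lambda>v. min (x v) (y v)"
  have "(\<Prod>v\<in>a e. x v) + (\<Prod>v\<in>a e. y v) \<le> (\<Prod>v\<in>a e. ?M v) + (\<Prod>v\<in>a e. ?m v)"
    using a_subset[OF e] x y by (intro prod_max_min_supermodular) auto
  then have "?K x + ?K y \<le> ?K ?M + ?K ?m"
    unfolding edge_spin_def using \<kappa>_nonneg[OF e] unfolding distrib_left[symmetric]
    by (intro mult_left_mono) auto
  moreover have "0 \<le> ?K x" "0 \<le> ?K y" "0 \<le> ?K ?m" "0 \<le> ?K ?M"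
    using x y e by (auto intro!: edge_spin_nonneg simp: le_max_iff_disj)
  moreover have "?K x \<le> ?K ?M" "?K y \<le> ?K ?M" "?K ?m \<le> ?K x" "?K ?m \<le> ?K y"
    using x y e by (auto intro!: edge_spin_mono simp: le_max_iff_disj)
  ultimately have "\<bar>?K x + ?K y * t\<bar> \<le> ?K ?M + ?K ?m * t"
    using t by auto
  from sign_dominated_exp[OF this]
  show "sign_dominated (\<lambda>s. exp (?K x * s) * exp (?K y * (s * t))) (\<lambda>s. exp (?K ?M * s) * exp (?K ?m * (s * t)))"
    by (simp add: exp_add[symmetric] algebra_simps)
qed

lemma cluster_weight_nonneg:
  assumes "\<And>v. v \<in> V \<Longrightarrow> 0 \<le> \<xi> v"
  shows "0 \<le> cluster_weight V I a \<kappa> \<xi> \<omega>"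
  unfolding cluster_weight_def edge_weight_def using edge_spin_nonneg[OF assms]
  by (intro sum_nonneg prod_nonneg) auto

text \<open>On both sides one factor is taken at \<open>x\<close> and one at \<open>y\<close>, so
  the prefactors \<open>exp (- k)\<close>, decreasing in the absolute values, cancel. Only the
  increasing factors \<open>exp (2 * k) - 1\<close> of the open edges remain to be compared.\<close>

lemma cluster_weight_holley:
  assumes x: "\<And>v. v \<in> V \<Longrightarrow> 0 \<le> x v" and xy: "\<And>v. v \<in> V \<Longrightarrow> x v \<le> y v"
  shows "cluster_weight V I a \<kappa> x \<omega> * cluster_weight V I a \<kappa> y \<omega>'
    \<le> cluster_weight V I a \<kappa> y (\<lambda>e\<in>I. \<omega> e \<or> \<omega>' e) * cluster_weight V I a \<kappa> x (\<lambda>e\<in>I. \<omega> e \<and> \<omega>' e)"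
  unfolding cluster_weight_def
proof (rule sum_signs_mult_mono[OF finite_V finite_I a_subset])
  fix e and t :: real
  assume e: "e \<in> I" and t: "t \<in> {-1, 1}"
  let ?q = "\<lambda>k::real. exp (2 * k) - 1"
  define kx ky where k: "kx = edge_spin a \<kappa> x e" "ky = edge_spin a \<kappa> y e"
  have q: "0 \<le> ?q kx" "?q kx \<le> ?q ky"
    using edge_spin_mono[OF x xy e] edge_spin_nonneg[OF x e] by (auto simp: k)
  define c c' d d' where "c = (\<lambda>s. if \<omega> e then ?q kx * of_bool (s = (1::real)) else (1::real))"
    and "c' = (\<lambda>s. if \<omega>' e then ?q ky * of_bool (s = (1::real)) else (1::real))"
    and "d = (\<lambda>s. if \<omega> e \<or> \<omega>' e then ?q ky * of_bool (s = (1::real)) else (1::real))"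
    and "d' = (\<lambda>s. if \<omega> e \<and> \<omega>' e then ?q kx * of_bool (s = (1::real)) else (1::real))"
  \<comment> \<open>An edge open only in \<open>\<omega>\<close> uses
    \<open>?q kx \<le> ?q ky\<close>. An edge open only in \<open>\<omega>'\<close> with
    \<open>t = -1\<close> has its indicator at \<open>s = -1\<close> on the left, which merely flips
    the sign of the odd part; this is why \<open>sign_dominated\<close> has absolute values. In the
    other cases the two functions agree.\<close>
  have "sign_dominated (\<lambda>s. c s * c' (s * t)) (\<lambda>s. d s * d' (s * t))"
    using q t by (auto simp: sign_dominated_def c_def c'_def d_def d'_def mult.commute abs_mult simp del: exp_le_cancel_iff)
  then have "sign_dominated (\<lambda>s. exp (-kx) * exp (-ky) * (c s * c' (s * t))) (\<lambda>s. exp (-kx) * exp (-ky) * (d s * d' (s * t)))"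
    unfolding sign_dominated_def
    by (simp only: distrib_left[symmetric] right_diff_distrib[symmetric] abs_mult abs_exp_cancel) 
      (simp del: exp_le_cancel_iff)
  then show "sign_dominated (\<lambda>s. edge_weight (edge_spin a \<kappa> x e) (\<omega> e) s * edge_weight (edge_spin a \<kappa> y e) (\<omega>' e) (s * t))
      (\<lambda>s. edge_weight (edge_spin a \<kappa> y e) ((\<lambda>e\<in>I. \<omega> e \<or> \<omega>' e) e) s * edge_weight (edge_spin a \<kappa> x e) ((\<lambda>e\<in>I. \<omega> e \<and> \<omega>' e) e) (s * t))"
    using e unfolding edge_weight_def k[symmetric] c_def c'_def d_def d'_def restrict_apply'[OF e]
    by (simp only: mult_ac)
qed

lemma sum_cluster_weight: "(\<Sum>\<omega>\<in>(\<Pi>\<^sub>E e\<in>I. UNIV). cluster_weight V I a \<kappa> \<xi> \<omega>) = ising_partition V I a \<kappa> \<xi>"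
proof -
  have "(\<Sum>b\<in>UNIV. edge_weight k b s) = exp (k * s)" if "s = 1 \<or> s = -1" for k s
    using that by (auto simp: edge_weight_def UNIV_bool algebra_simps exp_add[symmetric])
  then have "(\<Sum>\<omega>\<in>(\<Pi>\<^sub>E e\<in>I. UNIV). \<Prod>e\<in>I. edge_weight (edge_spin a \<kappa> \<xi> e) (\<omega> e) (\<Prod>x\<in>a e. \<sigma> x)) =
    (\<Prod>e\<in>I. exp (edge_spin a \<kappa> \<xi> e * (\<Prod>x\<in>a e. \<sigma> x)))" if "\<sigma> \<in> signs V" for \<sigma>
    using prod_signs_values[OF that a_subset] finite_I by (subst prod_sum_PiE[symmetric]) simp_all
  then show ?thesis unfolding cluster_weight_def ising_partition_def by (subst sum.swap) simp
qed

end

section \<open>The four functions property of a measure\<close>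

text \<open>The conclusion of the Ahlswede--Daykin theorem, for operations \<open>j\<close> (join) and \<open>m\<close> (meet).
  Only the cases \<open>c = \<infinity>\<close> (no bound) and \<open>c = 1\<close> (bounded functions) are of interest; the latter
  is what survives weak limits.\<close>

definition four_functions :: "ennreal \<Rightarrow> 'a measure \<Rightarrow> ('a \<Rightarrow> 'a \<Rightarrow> 'a) \<Rightarrow> ('a \<Rightarrow> 'a \<Rightarrow> 'a) \<Rightarrow> bool" where
  "four_functions c M j m \<longleftrightarrow>
     (\<forall>f1 \<in> borel_measurable M. \<forall>f2 \<in> borel_measurable M. \<forall>f3 \<in> borel_measurable M. \<forall>f4 \<in> borel_measurable M.
        (\<forall>x\<in>space M. f1 x \<le> c \<and> f2 x \<le> c \<and> f3 x \<le> c \<and> f4 x \<le> c) \<longrightarrow>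
        (\<forall>x\<in>space M. \<forall>y\<in>space M. f1 x * f2 y \<le> f3 (j x y) * f4 (m x y)) \<longrightarrow>
        (\<integral>\<^sup>+x. f1 x \<partial>M) * (\<integral>\<^sup>+x. f2 x \<partial>M) \<le> (\<integral>\<^sup>+x. f3 x \<partial>M) * (\<integral>\<^sup>+x. f4 x \<partial>M))"

lemma four_functionsI:
  assumes "\<And>f1 f2 f3 f4. f1 \<in> borel_measurable M \<Longrightarrow> f2 \<in> borel_measurable M \<Longrightarrow> f3 \<in> borel_measurable M \<Longrightarrow>
    f4 \<in> borel_measurable M \<Longrightarrow> (\<And>x. x \<in> space M \<Longrightarrow> f1 x \<le> c) \<Longrightarrow> (\<And>x. x \<in> space M \<Longrightarrow> f2 x \<le> c) \<Longrightarrow>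
    (\<And>x. x \<in> space M \<Longrightarrow> f3 x \<le> c) \<Longrightarrow> (\<And>x. x \<in> space M \<Longrightarrow> f4 x \<le> c) \<Longrightarrow>
    (\<And>x y. x \<in> space M \<Longrightarrow> y \<in> space M \<Longrightarrow> f1 x * f2 y \<le> f3 (j x y) * f4 (m x y)) \<Longrightarrow>
    (\<integral>\<^sup>+x. f1 x \<partial>M) * (\<integral>\<^sup>+x. f2 x \<partial>M) \<le> (\<integral>\<^sup>+x. f3 x \<partial>M) * (\<integral>\<^sup>+x. f4 x \<partial>M)"
  shows "four_functions c M j m"
  unfolding four_functions_def by (intro ballI impI, rule assms) simp_all

lemma four_functionsD:
  assumes "four_functions c M j m"
    and "f1 \<in> borel_measurable M" "f2 \<in> borel_measurable M" "f3 \<in> borel_measurable M" "f4 \<in> borel_measurable M"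
    and "\<And>x. x \<in> space M \<Longrightarrow> f1 x \<le> c" "\<And>x. x \<in> space M \<Longrightarrow> f2 x \<le> c"
    and "\<And>x. x \<in> space M \<Longrightarrow> f3 x \<le> c" "\<And>x. x \<in> space M \<Longrightarrow> f4 x \<le> c"
    and "\<And>x y. x \<in> space M \<Longrightarrow> y \<in> space M \<Longrightarrow> f1 x * f2 y \<le> f3 (j x y) * f4 (m x y)"
  shows "(\<integral>\<^sup>+x. f1 x \<partial>M) * (\<integral>\<^sup>+x. f2 x \<partial>M) \<le> (\<integral>\<^sup>+x. f3 x \<partial>M) * (\<integral>\<^sup>+x. f4 x \<partial>M)"
  using assms(1)[unfolded four_functions_def, THEN bspec[of _ _ f1], THEN bspec[of _ _ f2],
    THEN bspec[of _ _ f3], THEN bspec[of _ _ f4]] assms(2-) by simp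

lemma four_functions_bound_mono:
  assumes "four_functions c M j m" "c' \<le> c"
  shows "four_functions c' M j m"
proof (rule four_functionsI, goal_cases)
  case (1 f1 f2 f3 f4)
  have "f x \<le> c" if "f x \<le> c'" for f :: "'a \<Rightarrow> ennreal" and x
    using that \<open>c' \<le> c\<close> by (rule order_trans)
  with 1 show ?case by (intro four_functionsD[OF assms(1)]) simp_all
qed

text \<open>Both sides are homogeneous of degree two, so all functions may be divided by
  \<open>C\<close>.\<close>

lemma four_functions_bounded:
  assumes ff: "four_functions 1 M j m" and C: "0 < C"
    and [measurable]: "f1 \<in> borel_measurable M" "f2 \<in> borel_measurable M" "f3 \<in> borel_measurable M" "f4 \<in> borel_measurable M"
    and b: "\<And>x. x \<in> space M \<Longrightarrow> f1 x \<le> ennreal C" "\<And>x. x \<in> space M \<Longrightarrow> f2 x \<le> ennreal C"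
      "\<And>x. x \<in> space M \<Longrightarrow> f3 x \<le> ennreal C" "\<And>x. x \<in> space M \<Longrightarrow> f4 x \<le> ennreal C"
    and le: "\<And>x y. x \<in> space M \<Longrightarrow> y \<in> space M \<Longrightarrow> f1 x * f2 y \<le> f3 (j x y) * f4 (m x y)"
  shows "(\<integral>\<^sup>+x. f1 x \<partial>M) * (\<integral>\<^sup>+x. f2 x \<partial>M) \<le> (\<integral>\<^sup>+x. f3 x \<partial>M) * (\<integral>\<^sup>+x. f4 x \<partial>M)"
proof -
  define D where "D = ennreal (inverse C)"
  have D: "D * ennreal C = 1" "D \<noteq> 0" "D \<noteq> \<top>"
    using C by (auto simp: D_def ennreal_mult[symmetric])
  have b': "D * x \<le> 1" if "x \<le> ennreal C" for x
    using mult_left_mono[OF that, of D] D by simp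
  have "(\<integral>\<^sup>+x. D * f1 x \<partial>M) * (\<integral>\<^sup>+x. D * f2 x \<partial>M) \<le> (\<integral>\<^sup>+x. D * f3 x \<partial>M) * (\<integral>\<^sup>+x. D * f4 x \<partial>M)"
  proof (rule four_functionsD[OF ff])
    show "D * f1 x * (D * f2 y) \<le> D * f3 (j x y) * (D * f4 (m x y))" if "x \<in> space M" "y \<in> space M" for x y
      using mult_left_mono[OF le[OF that], of "D * D"] by (simp add: mult_ac)
  qed (use b b' in auto)
  then have "(D * D) * ((\<integral>\<^sup>+x. f1 x \<partial>M) * (\<integral>\<^sup>+x. f2 x \<partial>M)) \<le> (D * D) * ((\<integral>\<^sup>+x. f3 x \<partial>M) * (\<integral>\<^sup>+x. f4 x \<partial>M))"
    by (simp add: nn_integral_cmult mult_ac)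
  then show ?thesis
    using D by (subst (asm) ennreal_mult_le_mult_iff) (auto simp: ennreal_mult_eq_top_iff)
qed

lemma four_functions_swap:
  assumes "four_functions c M j m"
  shows "four_functions c M m j"
proof (rule four_functionsI, goal_cases)
  case (1 f1 f2 f3 f4)
  have "(\<integral>\<^sup>+x. f1 x \<partial>M) * (\<integral>\<^sup>+x. f2 x \<partial>M) \<le> (\<integral>\<^sup>+x. f4 x \<partial>M) * (\<integral>\<^sup>+x. f3 x \<partial>M)"
  proof (rule four_functionsD[OF assms])
    show "f1 x * f2 y \<le> f4 (j x y) * f3 (m x y)" if "x \<in> space M" "y \<in> space M" for x y
      using 1(9)[OF that] by (simp only: mult.commute)
  qed (use 1 in simp_all)
  then show ?case by (simp only: mult.commute)
qed

lemma ennreal_mult_le_imp_add_le: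
  fixes a b c d :: ennreal
  assumes "a \<le> c" "b \<le> c" "a * b \<le> c * d"
  shows "a + b \<le> c + d"
proof (cases "c = \<top> \<or> d = \<top>")
  case False
  then obtain c' d' where c: "c = ennreal c'" "0 \<le> c'" and d: "d = ennreal d'" "0 \<le> d'"
    by (metis ennreal_cases)
  with assms False obtain a' b' where a: "a = ennreal a'" "0 \<le> a'" and b: "b = ennreal b'" "0 \<le> b'"
    by (metis ennreal_cases top.extremum_uniqueI)
  show ?thesis
    using assms c d a b mult_le_imp_add_le[of a' c' b' d']
    by (simp add: ennreal_mult[symmetric] ennreal_plus[symmetric] del: ennreal_plus)
qed auto

text \<open>Twice each product of integrals is an iterated integral of
  \<open>f x * g y + f y * g x\<close>, so comparing these symmetrised integrands suffices. With
  \<open>x\<close> the larger point, both summands on the left are at most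
  \<open>f3 x * f4 y\<close>, and the diagonal instances of the hypothesis bound their
  product.\<close>

lemma four_functions_chain:
  fixes k :: "'a \<Rightarrow> real"
  shows "four_functions c M (\<lambda>x y. if k y \<le> k x then x else y) (\<lambda>x y. if k y \<le> k x then y else x)"
proof (rule four_functionsI, goal_cases)
  case (1 f1 f2 f3 f4)
  note [measurable] = 1(1-4) and le = 1(9)
  have double: "(\<integral>\<^sup>+x. \<integral>\<^sup>+y. f x * g y + f y * g x \<partial>M \<partial>M) = 2 * ((\<integral>\<^sup>+x. f x \<partial>M) * (\<integral>\<^sup>+x. g x \<partial>M))"
    if [measurable]: "f \<in> borel_measurable M" "g \<in> borel_measurable M" for f g :: "'a \<Rightarrow> ennreal"
    by (simp add: nn_integral_add nn_integral_cmult nn_integral_multc mult_2)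
  have sym: "f1 x * f2 y + f1 y * f2 x \<le> f3 x * f4 y + f3 y * f4 x"
    if xy: "x \<in> space M" "y \<in> space M" "k y \<le> k x" for x y
  proof (cases "k y = k x")
    case True
    then show ?thesis using le[of x y] le[of y x] xy by (intro add_mono) auto
  next
    case False
    show ?thesis
    proof (rule ennreal_mult_le_imp_add_le)
      show "f1 x * f2 y \<le> f3 x * f4 y" using le[of x y] xy by simp
      show "f1 y * f2 x \<le> f3 x * f4 y" using le[of y x] False xy by simp
      have "(f1 x * f2 x) * (f1 y * f2 y) \<le> (f3 x * f4 x) * (f3 y * f4 y)"
        using xy by (intro mult_mono[of "f1 x * f2 x"]) (simp_all add: le[of x x, simplified] le[of y y, simplified])
      then show "f1 x * f2 y * (f1 y * f2 x) \<le> f3 x * f4 y * (f3 y * f4 x)" by (simp add: mult_ac)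
    qed
  qed
  have "2 * ((\<integral>\<^sup>+x. f1 x \<partial>M) * (\<integral>\<^sup>+x. f2 x \<partial>M)) \<le> 2 * ((\<integral>\<^sup>+x. f3 x \<partial>M) * (\<integral>\<^sup>+x. f4 x \<partial>M))"
    unfolding double[symmetric, OF 1(1,2)] double[symmetric, OF 1(3,4)]
  proof (intro nn_integral_mono)
    fix x y assume "x \<in> space M" "y \<in> space M"
    then show "f1 x * f2 y + f1 y * f2 x \<le> f3 x * f4 y + f3 y * f4 x"
      using sym[of x y] sym[of y x] by (cases "k y \<le> k x") (auto simp: add.commute)
  qed
  then show ?case by (subst (asm) ennreal_mult_le_mult_iff) auto
qed

text \<open>The fibre integrals over \<open>N\<close> satisfy the hypothesis for \<open>M\<close>:
  the property of \<open>N\<close> is applied on the fibres over \<open>x\<close>,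
  \<open>x'\<close>, their join and their meet. A finite bound \<open>c\<close> survives the fibre
  integration because \<open>N\<close> then has total mass 1.\<close>

lemma four_functions_pair:
  assumes M: "four_functions c M j m" and N: "four_functions c N j' m'"
    and sf: "sigma_finite_measure N" and c: "c = \<top> \<or> prob_space N"
    and closed: "\<And>x y. x \<in> space M \<Longrightarrow> y \<in> space M \<Longrightarrow> j x y \<in> space M \<and> m x y \<in> space M"
  shows "four_functions c (M \<Otimes>\<^sub>M N) (\<lambda>x y. (j (fst x) (fst y), j' (snd x) (snd y))) (\<lambda>x y. (m (fst x) (fst y), m' (snd x) (snd y)))"
proof (rule four_functionsI, goal_cases)
  case (1 f1 f2 f3 f4)
  interpret N: sigma_finite_measure N by fact
  note [measurable] = 1(1-4)
  have b: "(\<integral>\<^sup>+y. f (x, y) \<partial>N) \<le> c" if "x \<in> space M" "\<And>z. z \<in> space (M \<Otimes>\<^sub>M N) \<Longrightarrow> f z \<le> c" for f x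
  proof (cases "c = \<top>")
    case False
    then interpret prob_space N using c by simp
    have "(\<integral>\<^sup>+y. f (x, y) \<partial>N) \<le> (\<integral>\<^sup>+y. c \<partial>N)"
      using that by (intro nn_integral_mono) (auto simp: space_pair_measure)
    then show ?thesis by (simp add: emeasure_space_1)
  qed simp
  show ?case
    unfolding N.nn_integral_fst[OF 1(1), symmetric] N.nn_integral_fst[OF 1(2), symmetric]
      N.nn_integral_fst[OF 1(3), symmetric] N.nn_integral_fst[OF 1(4), symmetric]
  proof (rule four_functionsD[OF M])
    fix x x' assume x: "x \<in> space M" "x' \<in> space M"
    note cl = closed[OF x]
    show "(\<integral>\<^sup>+y. f1 (x, y) \<partial>N) * (\<integral>\<^sup>+y. f2 (x', y) \<partial>N) \<le> (\<integral>\<^sup>+y. f3 (j x x', y) \<partial>N) * (\<integral>\<^sup>+y. f4 (m x x', y) \<partial>N)"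
    proof (rule four_functionsD[OF N])
      show "f1 (x, y) * f2 (x', y') \<le> f3 (j x x', j' y y') * f4 (m x x', m' y y')"
        if "y \<in> space N" "y' \<in> space N" for y y'
        using 1(9)[of "(x, y)" "(x', y')"] x that by (simp add: space_pair_measure)
    qed (use x cl 1(5-8) in \<open>auto simp: space_pair_measure\<close>)
  qed (use 1(5-8) in \<open>auto intro!: b\<close>)
qed

text \<open>Tensorisation, with the fibre argument for pairs applied to one new coordinate at a
  time. Over the empty index set the space is a single point, where the pointwise hypothesis is the
  claim.\<close>

lemma four_functions_PiM:
  fixes M :: "'a measure" and j m :: "'a \<Rightarrow> 'a \<Rightarrow> 'a"
  assumes I: "finite I" and M: "four_functions c M j m"
    and sf: "sigma_finite_measure M" and c: "c = \<top> \<or> prob_space M"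
    and closed: "\<And>x y. x \<in> space M \<Longrightarrow> y \<in> space M \<Longrightarrow> j x y \<in> space M \<and> m x y \<in> space M"
  shows "four_functions c (\<Pi>\<^sub>M i\<in>I. M) (\<lambda>x y. \<lambda>i\<in>I. j (x i) (y i)) (\<lambda>x y. \<lambda>i\<in>I. m (x i) (y i))"
  using I
proof (induction I rule: finite_induct)
  case empty
  interpret product_sigma_finite "\<lambda>_. M" using sf by (simp add: product_sigma_finite_def)
  show ?case
  proof (rule four_functionsI, goal_cases)
    case (1 f1 f2 f3 f4)
    show ?case using 1(9)[of "\<lambda>_. undefined" "\<lambda>_. undefined"] by (simp add: PiM_empty nn_integral_count_space_finite space_PiM restrict_def)
  qed
next
  case (insert i I)
  interpret product_sigma_finite "\<lambda>_. M" using sf by (simp add: product_sigma_finite_def)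
  interpret M: sigma_finite_measure M by fact
  have sp: "x(i := y) \<in> space (\<Pi>\<^sub>M i\<in>insert i I. M)" if "x \<in> space (\<Pi>\<^sub>M i\<in>I. M)" "y \<in> space M" for x y
    using that by (auto simp: space_PiM PiE_iff extensional_def)
  have upd: "(\<lambda>y. x(i := y)) \<in> M \<rightarrow>\<^sub>M (\<Pi>\<^sub>M i\<in>insert i I. M)" if "x \<in> space (\<Pi>\<^sub>M i\<in>I. M)" for x
    using that by (intro measurable_fun_upd[where J = I]) auto
  show ?case
  proof (rule four_functionsI, goal_cases)
    case (1 f1 f2 f3 f4)
    have b: "(\<integral>\<^sup>+y. f (x(i := y)) \<partial>M) \<le> c" if "x \<in> space (\<Pi>\<^sub>M i\<in>I. M)" "\<And>z. z \<in> space (\<Pi>\<^sub>M i\<in>insert i I. M) \<Longrightarrow> f z \<le> c" for f x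
    proof (cases "c = \<top>")
      case False
      then interpret prob_space M using c by simp
      have "(\<integral>\<^sup>+y. f (x(i := y)) \<partial>M) \<le> (\<integral>\<^sup>+y. c \<partial>M)"
        using that sp by (intro nn_integral_mono) auto
      then show ?thesis by (simp add: emeasure_space_1)
    qed simp
    have meas: "(\<lambda>x. \<integral>\<^sup>+y. f (x(i := y)) \<partial>M) \<in> borel_measurable (\<Pi>\<^sub>M i\<in>I. M)"
      if [measurable]: "f \<in> borel_measurable (\<Pi>\<^sub>M i\<in>insert i I. M)" for f :: "_ \<Rightarrow> ennreal"
      by measurable
    have J: "(\<lambda>k\<in>insert i I. g ((x(i := y)) k) ((x'(i := y')) k)) = (\<lambda>k\<in>I. g (x k) (x' k))(i := g y y')" for x x' y y' and g :: "'a \<Rightarrow> 'a \<Rightarrow> 'a"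
      using insert(2) by (auto simp: fun_eq_iff)
    show ?case
      unfolding product_nn_integral_insert[OF insert(1,2) 1(1)] product_nn_integral_insert[OF insert(1,2) 1(2)]
        product_nn_integral_insert[OF insert(1,2) 1(3)] product_nn_integral_insert[OF insert(1,2) 1(4)]
    proof (rule four_functionsD[OF insert(3)])
      fix x x' assume x: "x \<in> space (\<Pi>\<^sub>M i\<in>I. M)" "x' \<in> space (\<Pi>\<^sub>M i\<in>I. M)"
      have cl: "(\<lambda>k\<in>I. j (x k) (x' k)) \<in> space (\<Pi>\<^sub>M i\<in>I. M)" "(\<lambda>k\<in>I. m (x k) (x' k)) \<in> space (\<Pi>\<^sub>M i\<in>I. M)"
        using x closed by (auto simp: space_PiM PiE_iff)
      show "(\<integral>\<^sup>+y. f1 (x(i := y)) \<partial>M) * (\<integral>\<^sup>+y. f2 (x'(i := y)) \<partial>M)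
        \<le> (\<integral>\<^sup>+y. f3 ((\<lambda>k\<in>I. j (x k) (x' k))(i := y)) \<partial>M) * (\<integral>\<^sup>+y. f4 ((\<lambda>k\<in>I. m (x k) (x' k))(i := y)) \<partial>M)"
      proof (rule four_functionsD[OF M])
        show "f1 (x(i := y)) * f2 (x'(i := y')) \<le> f3 ((\<lambda>k\<in>I. j (x k) (x' k))(i := j y y')) * f4 ((\<lambda>k\<in>I. m (x k) (x' k))(i := m y y'))"
          if "y \<in> space M" "y' \<in> space M" for y y'
          using 1(9)[OF sp[OF x(1) that(1)] sp[OF x(2) that(2)]] unfolding J[where g = j] J[where g = m] .
      qed (use 1(1-8) x cl sp in \<open>auto intro: measurable_compose[OF upd]\<close>)
    qed (use 1(1-8) in \<open>auto intro!: b meas\<close>)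
  qed
qed

lemma nn_integral_PiM_bool:
  fixes M :: "'e \<Rightarrow> bool measure"
  assumes I: "finite I" and M: "\<And>e. e \<in> I \<Longrightarrow> prob_space (M e)" "\<And>e. e \<in> I \<Longrightarrow> sets (M e) = UNIV"
  shows "(\<integral>\<^sup>+\<omega>. f \<omega> \<partial>(\<Pi>\<^sub>M e\<in>I. M e)) = (\<Sum>\<omega>\<in>(\<Pi>\<^sub>E e\<in>I. UNIV). (\<Prod>e\<in>I. emeasure (M e) {\<omega> e}) * f \<omega>)"
proof -
  let ?P = "\<Pi>\<^sub>M e\<in>I. M e" and ?S = "\<Pi>\<^sub>E e\<in>I. (UNIV :: bool set)"
  have sM: "space (M e) = UNIV" if "e \<in> I" for e
    using sets.top[of "M e"] M(2)[OF that] sets_eq_imp_space_eq[of "M e" "count_space UNIV"] by simp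
  have fS: "finite ?S" using I by (intro finite_PiE) auto
  have sP: "space ?P = ?S" by (simp add: space_PiM sM cong: PiE_cong)
  have single: "{\<omega>} = (\<Pi>\<^sub>E e\<in>I. {\<omega> e})" if "\<omega> \<in> ?S" for \<omega>
    using that by (auto simp: PiE_iff extensional_def fun_eq_iff)
  have sets: "{\<omega>} \<in> sets ?P" if "\<omega> \<in> ?S" for \<omega>
    unfolding single[OF that] using I M by (intro sets_PiM_I_finite) auto
  have em: "emeasure ?P {\<omega>} = (\<Prod>e\<in>I. emeasure (M e) {\<omega> e})" if "\<omega> \<in> ?S" for \<omega>
  proof -
    have "emeasure ?P (prod_emb I M I (\<Pi>\<^sub>E e\<in>I. {\<omega> e})) = (\<Prod>e\<in>I. emeasure (M e) {\<omega> e})"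
      using I M by (intro emeasure_PiM_emb) auto
    then show ?thesis using M by (subst single[OF that]) (simp add: prod_emb_PiE_same_index sM)
  qed
  have "(\<integral>\<^sup>+\<omega>. f \<omega> \<partial>?P) = (\<integral>\<^sup>+\<omega>. (\<Sum>\<omega>'\<in>?S. f \<omega>' * indicator {\<omega>'} \<omega>) \<partial>?P)"
    using fS by (intro nn_integral_cong) (simp add: sP indicator_def sum.If_cases Int_absorb2)
  also have "\<dots> = (\<Sum>\<omega>'\<in>?S. f \<omega>' * emeasure ?P {\<omega>'})"
    using sets by (subst nn_integral_sum) (auto intro!: sum.cong nn_integral_cmult_indicator)
  finally show ?thesis using em by (simp add: mult.commute)
qed

section \<open>Weak limits\<close>

text \<open>Linear ramps in the distance from \<open>K\<close>, steepening with \<open>k\<close>; as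
  \<open>K\<close> is closed, they vanish eventually at each outside point. The set \<open>C\<close>
  is common to all \<open>k\<close>, as the later compactness argument requires.\<close>

lemma compact_indicator_approx:
  fixes K :: "'a::euclidean_space set"
  assumes K: "compact K"
  obtains h :: "nat \<Rightarrow> 'a \<Rightarrow> real" and C
  where "\<And>k. continuous_on UNIV (h k)" "\<And>k x. 0 \<le> h k x" "\<And>k x. h k x \<le> 1" "\<And>x. decseq (\<lambda>k. h k x)"
    "\<And>x. (\<lambda>k. h k x) \<longlonglongrightarrow> indicator K x" "compact C" "\<And>k x. x \<notin> C \<Longrightarrow> h k x = 0"
proof (cases "K = {}")
  case True
  show ?thesis
    by (rule that[of "\<lambda>_ _. 0" "{}"]) (auto simp: True decseq_def)
next
  case False
  \<comment> \<open>The slope \<open>k + 1\<close> is at least 1 already for \<open>k = 0\<close>,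
    so every ramp vanishes beyond distance 1.\<close>
  define h where "h k x = max 0 (1 - (real k + 1) * infdist x K)" for k x
  show ?thesis
  proof (rule that[of h "{x. infdist x K \<le> 1}"])
    show "continuous_on UNIV (h k)" for k unfolding h_def by (intro continuous_intros)
    show "0 \<le> h k x" "h k x \<le> 1" for k x by (simp_all add: h_def infdist_nonneg)
    show "decseq (\<lambda>k. h k x)" for x
      unfolding decseq_def h_def
      by (intro allI impI max.mono diff_left_mono mult_right_mono add_right_mono infdist_nonneg order_refl) simp
    show "compact {x. infdist x K \<le> 1}" by (intro compact_infdist_le False K) simp
    show "h k x = 0" if "x \<notin> {x. infdist x K \<le> 1}" for k x
    proof -
      have "1 * 1 \<le> (real k + 1) * infdist x K" using that by (intro mult_mono) auto
      then show ?thesis by (simp add: h_def)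
    qed
    show "(\<lambda>k. h k x) \<longlonglongrightarrow> indicator K x" for x
    proof (cases "x \<in> K")
      case True
      then show ?thesis by (simp add: h_def)
    next
      case False
      then have pos: "0 < infdist x K"
        using K \<open>K \<noteq> {}\<close> by (metis compact_imp_closed in_closed_iff_infdist_zero infdist_nonneg le_less)
      obtain n where n: "1 / infdist x K < real n" using reals_Archimedean2 by blast
      have "h k x = 0" if "n \<le> k" for k
      proof -
        have "1 / infdist x K \<le> real k + 1" using n that by simp
        then have "1 \<le> (real k + 1) * infdist x K" using pos by (simp add: field_simps)
        then show ?thesis by (simp add: h_def)
      qed
      then have "\<forall>\<^sub>F k in sequentially. h k x = 0" by (auto simp: eventually_sequentially)
      then show ?thesis using False by (simp add: tendsto_eventually)
    qed
  qed
qed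

text \<open>The continuous \<open>h k\<close> need not lie below \<open>f\<close>; only their limit
  \<open>g\<close> does. Decrease in \<open>k\<close> and the common support \<open>C\<close> permit
  a Dini-type argument in \<open>four_functions_continuous\<close>.\<close>

definition lower_approx ::
  "'a::euclidean_space measure \<Rightarrow> ('a \<Rightarrow> real) \<Rightarrow> real \<Rightarrow> (nat \<Rightarrow> 'a \<Rightarrow> real) \<Rightarrow> ('a \<Rightarrow> real) \<Rightarrow> 'a set \<Rightarrow> bool" where
  "lower_approx M f e h g C \<longleftrightarrow>
     (\<forall>k. continuous_on UNIV (h k)) \<and> (\<forall>k x. 0 \<le> h k x) \<and> (\<forall>k x. h k x \<le> 1) \<and> (\<forall>x. decseq (\<lambda>k. h k x)) \<and>
     (\<forall>x. (\<lambda>k. h k x) \<longlonglongrightarrow> g x) \<and> compact C \<and> (\<forall>k x. x \<notin> C \<longrightarrow> h k x = 0) \<and>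
     (\<forall>x. g x \<le> f x) \<and> g \<in> borel_measurable borel \<and> (\<integral>x. f x \<partial>M) \<le> (\<integral>x. g x \<partial>M) + e"

lemma lower_approxD:
  assumes "lower_approx M f e h g C"
  shows "\<And>k. continuous_on UNIV (h k)" "\<And>k x. 0 \<le> h k x" "\<And>k x. h k x \<le> 1" "\<And>x. decseq (\<lambda>k. h k x)"
    "\<And>x. (\<lambda>k. h k x) \<longlonglongrightarrow> g x" "compact C" "\<And>k x. x \<notin> C \<Longrightarrow> h k x = 0"
    "\<And>x. g x \<le> f x" "g \<in> borel_measurable borel" "(\<integral>x. f x \<partial>M) \<le> (\<integral>x. g x \<partial>M) + e"
  using assms unfolding lower_approx_def by auto

text \<open>A Vitali--Caratheodory approximation from below: the decreasing limit \<open>g\<close> is upper semicontinuous.\<close>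

lemma continuous_approx_below:
  fixes M :: "'a::euclidean_space measure" and f :: "'a \<Rightarrow> real"
  assumes "prob_space M" and sets: "sets M = sets borel"
    and f: "f \<in> borel_measurable borel" "\<And>x. 0 \<le> f x" "\<And>x. f x \<le> 1" and e: "0 < e"
  shows "\<exists>h g C. lower_approx M f e h g C"
proof -
  interpret prob_space M by fact
  note [measurable_cong] = sets
  note [measurable] = f(1)
  \<comment> \<open>Half of the error \<open>e\<close> pays for rounding \<open>f\<close> to
    multiples of \<open>1 / n\<close>, the other half for shrinking the level sets
    \<open>A i\<close> to compact sets.\<close>
  obtain n :: nat where n: "0 < n" "1 / real n < e / 2"
    using e by (meson half_gt_zero nat_approx_posE of_nat_0_less_iff zero_less_Suc)
  define A where "A i = {x. real i / real n \<le> f x}" for i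
  have A[measurable]: "A i \<in> sets borel" for i unfolding A_def by measurable
  have "\<exists>K. K \<subseteq> A i \<and> compact K \<and> measure M (A i) \<le> measure M K + e / 2" for i
  proof -
    have "ennreal (measure M (A i)) = (SUP K\<in>{K. K \<subseteq> A i \<and> compact K}. emeasure M K)"
      using inner_regular[OF sets _ A[of i]] by (simp add: emeasure_eq_measure)
    moreover have "ennreal (measure M (A i) - e / 2) < ennreal (measure M (A i))" if "measure M (A i) > e / 2"
      using that e by (intro ennreal_lessI) auto
    ultimately have "\<exists>K\<in>{K. K \<subseteq> A i \<and> compact K}. ennreal (measure M (A i) - e / 2) < emeasure M K"
      if "measure M (A i) > e / 2"
      using that by (simp add: less_SUP_iff)
    then show ?thesis
    proof (cases "measure M (A i) > e / 2")
      case True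
      then obtain K where "K \<subseteq> A i" "compact K" "ennreal (measure M (A i) - e / 2) < ennreal (measure M K)"
        using \<open>_ \<Longrightarrow> \<exists>K\<in>_. _\<close> by (auto simp: emeasure_eq_measure)
      then show ?thesis using True by (auto simp: ennreal_less_iff intro!: exI[of _ K])
    qed (auto intro!: exI[of _ "{}"])
  qed
  then obtain K where K: "\<And>i. K i \<subseteq> A i" "\<And>i. compact (K i)" "\<And>i. measure M (A i) \<le> measure M (K i) + e / 2"
    by metis
  have "\<exists>h C. (\<forall>k. continuous_on UNIV (h k)) \<and> (\<forall>k x. 0 \<le> h k x) \<and> (\<forall>k x. h k x \<le> 1) \<and> (\<forall>x. decseq (\<lambda>k. h k x)) \<and>
    (\<forall>x. (\<lambda>k. h k x) \<longlonglongrightarrow> (indicator (K i) x :: real)) \<and> compact C \<and> (\<forall>k x. x \<notin> C \<longrightarrow> h k x = 0)" for i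
    by (rule compact_indicator_approx[OF K(2)[of i]]) blast
  then obtain h C where h: "\<And>i k. continuous_on UNIV (h i k)" "\<And>i k x. 0 \<le> h i k x" "\<And>i k x. h i k x \<le> 1"
      "\<And>i x. decseq (\<lambda>k. h i k x)" "\<And>i x. (\<lambda>k. h i k x) \<longlonglongrightarrow> (indicator (K i) x :: real)"
      "\<And>i. compact (C i)" "\<And>i k x. x \<notin> C i \<Longrightarrow> h i k x = 0"
    by metis
  have Km[measurable]: "K i \<in> sets borel" for i using K(2) by (simp add: compact_imp_closed)
  \<comment> \<open>Layer-cake form of the rounding. The level \<open>A 0\<close> is the whole space
    and is left out; \<open>f x \<le> 1\<close> keeps the number of levels reached within
    \<open>n\<close>.\<close>
  have count: "(\<Sum>i\<in>{1..n}. indicator (A i) x :: real) = of_int \<lfloor>n * f x\<rfloor>" for x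
  proof -
    have fl: "0 \<le> \<lfloor>n * f x\<rfloor>" "nat \<lfloor>n * f x\<rfloor> \<le> n"
      using f(2,3)[of x] mult_left_mono[OF f(3)[of x], of n] by (auto simp: floor_le_iff nat_le_iff)
    have "x \<in> A i \<longleftrightarrow> i \<le> nat \<lfloor>n * f x\<rfloor>" for i
      using n fl(1) by (simp add: A_def field_simps le_nat_iff le_floor_iff)
    then obtain N where N: "\<And>i. x \<in> A i \<longleftrightarrow> i \<le> N" "N \<le> n" "real N = of_int \<lfloor>n * f x\<rfloor>"
      using fl by (intro that[of "nat \<lfloor>n * f x\<rfloor>"]) simp_all
    have "{i\<in>{1..n}. x \<in> A i} = {1..N}" using N(2) unfolding N(1) by auto
    then show ?thesis by (simp add: indicator_def sum.If_cases Int_def N(3)[symmetric])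
  qed
  define g where "g x = (\<Sum>i\<in>{1..n}. indicator (K i) x) / real n" for x
  have gm[measurable]: "g \<in> borel_measurable borel" unfolding g_def by measurable
  have "lower_approx M f e (\<lambda>k x. (\<Sum>i\<in>{1..n}. h i k x) / real n) g (\<Union>i\<in>{1..n}. C i)"
    unfolding lower_approx_def
  proof (intro conjI allI impI)
    show "continuous_on UNIV (\<lambda>x. (\<Sum>i\<in>{1..n}. h i k x) / real n)" for k
      using n by (intro continuous_intros h) simp
    show "0 \<le> (\<Sum>i\<in>{1..n}. h i k x) / real n" for k x by (intro divide_nonneg_nonneg sum_nonneg h) simp
    have "(\<Sum>i\<in>{1..n}. h i k x) \<le> (\<Sum>i\<in>{1..n}. 1)" for k x by (intro sum_mono h)
    then show "(\<Sum>i\<in>{1..n}. h i k x) / real n \<le> 1" for k x using n by (simp add: field_simps)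
    show "decseq (\<lambda>k. (\<Sum>i\<in>{1..n}. h i k x) / real n)" for x
      using h(4) by (auto simp: decseq_def intro!: divide_right_mono sum_mono)
    show "(\<lambda>k. (\<Sum>i\<in>{1..n}. h i k x) / real n) \<longlonglongrightarrow> g x" for x
      unfolding g_def using n by (intro tendsto_intros h) simp
    show "compact (\<Union>i\<in>{1..n}. C i)" by (intro compact_UN h) simp
    show "(\<Sum>i\<in>{1..n}. h i k x) / real n = 0" if "x \<notin> (\<Union>i\<in>{1..n}. C i)" for k x
      using that h(7) by (simp add: sum.neutral)
    show "g x \<le> f x" for x
    proof -
      have "g x \<le> (\<Sum>i\<in>{1..n}. indicator (A i) x) / real n"
        unfolding g_def using K(1) by (intro divide_right_mono sum_mono) (auto simp: indicator_def)
      also have "\<dots> \<le> n * f x / n" unfolding count by (intro divide_right_mono) auto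
      finally show ?thesis using n by simp
    qed
    show "g \<in> borel_measurable borel" by fact
    have "(\<integral>x. f x \<partial>M) \<le> (\<integral>x. 1 / n + (\<Sum>i\<in>{1..n}. indicator (A i) x) / n \<partial>M)"
    proof (intro integral_mono)
      show "integrable M f"
        using f by (intro integrable_const_bound[where B = 1]) auto
      show "f x \<le> 1 / n + (\<Sum>i\<in>{1..n}. indicator (A i) x) / n" for x
      proof -
        have "n * f x \<le> 1 + of_int \<lfloor>n * f x\<rfloor>" by linarith
        then show ?thesis unfolding count using n by (simp add: field_simps)
      qed
    qed (auto simp: emeasure_eq_measure)
    also have "\<dots> = 1 / n + (\<Sum>i\<in>{1..n}. measure M (A i)) / n"
      by (simp add: prob_space emeasure_eq_measure)
    also have "\<dots> \<le> e / 2 + (\<Sum>i\<in>{1..n}. measure M (K i) + e / 2) / n"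
      using n K(3) by (intro add_mono divide_right_mono sum_mono) auto
    also have "\<dots> = (\<Sum>i\<in>{1..n}. measure M (K i)) / n + e"
      using n by (simp add: sum.distrib add_divide_distrib)
    also have "(\<Sum>i\<in>{1..n}. measure M (K i)) / n = (\<integral>x. g x \<partial>M)"
      unfolding g_def by (simp add: emeasure_eq_measure)
    finally show "(\<integral>x. f x \<partial>M) \<le> (\<integral>x. g x \<partial>M) + e" .
  qed
  then show ?thesis by blast
qed

text \<open>\<open>f1\<close>, \<open>f2\<close> are approximated from below and \<open>f3\<close>,
  \<open>f4\<close> from above, through \<open>1 - f3\<close> and \<open>1 - f4\<close>. The
  pointwise hypothesis need not hold for the continuous approximants, so those of \<open>f3\<close>,
  \<open>f4\<close> are raised by \<open>e\<close>, and compactness yields one index at which it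
  holds everywhere. The bound 2 in \<open>cont\<close> leaves room for the raise.\<close>

lemma four_functions_continuous:
  fixes M :: "'a::euclidean_space measure" and j m :: "'a \<Rightarrow> 'a \<Rightarrow> 'a"
  assumes "prob_space M" and sets: "sets M = sets borel"
    and jm: "continuous_on UNIV (\<lambda>p. j (fst p) (snd p))" "continuous_on UNIV (\<lambda>p. m (fst p) (snd p))"
    and cont: "\<And>f1 f2 f3 f4 :: 'a \<Rightarrow> real.
      continuous_on UNIV f1 \<Longrightarrow> continuous_on UNIV f2 \<Longrightarrow> continuous_on UNIV f3 \<Longrightarrow> continuous_on UNIV f4 \<Longrightarrow>
      (\<And>x. 0 \<le> f1 x \<and> f1 x \<le> 2) \<Longrightarrow> (\<And>x. 0 \<le> f2 x \<and> f2 x \<le> 2) \<Longrightarrow>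
      (\<And>x. 0 \<le> f3 x \<and> f3 x \<le> 2) \<Longrightarrow> (\<And>x. 0 \<le> f4 x \<and> f4 x \<le> 2) \<Longrightarrow>
      (\<And>x y. f1 x * f2 y \<le> f3 (j x y) * f4 (m x y)) \<Longrightarrow>
      (\<integral>x. f1 x \<partial>M) * (\<integral>x. f2 x \<partial>M) \<le> (\<integral>x. f3 x \<partial>M) * (\<integral>x. f4 x \<partial>M)"
  shows "four_functions 1 M j m"
proof (rule four_functionsI, goal_cases)
  case (1 f1 f2 f3 f4)
  interpret prob_space M by fact
  note [measurable_cong] = sets
  have sp: "space M = UNIV" using sets_eq_imp_space_eq[OF sets] by simp
  let ?E = "\<lambda>f :: 'a \<Rightarrow> real. \<integral>x. f x \<partial>M"
  define r where "r f x = enn2real (f x)" for f :: "'a \<Rightarrow> ennreal" and x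
  have r: "r f \<in> borel_measurable borel" "0 \<le> r f x" "r f x \<le> 1" "f x = ennreal (r f x)"
    if f[measurable]: "f \<in> borel_measurable M" and le: "\<forall>x\<in>space M. f x \<le> 1" for f x
  proof -
    have [measurable]: "f \<in> borel_measurable borel" using f by (simp add: measurable_cong_sets[OF sets])
    show "r f \<in> borel_measurable borel" unfolding r_def by measurable
    have "f x < \<top>" using le by (auto simp: sp intro: le_less_trans[OF _ ennreal_one_less_top])
    then show "f x = ennreal (r f x)" by (simp add: r_def)
    then have "ennreal (r f x) \<le> 1" using le by (metis sp UNIV_I)
    then show "r f x \<le> 1" by simp
  qed (simp add: r_def)
  have b: "\<forall>x\<in>space M. f1 x \<le> 1" "\<forall>x\<in>space M. f2 x \<le> 1" "\<forall>x\<in>space M. f3 x \<le> 1" "\<forall>x\<in>space M. f4 x \<le> 1"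
    using 1(5-8) by auto
  note r1 = r[OF 1(1) b(1)] and r2 = r[OF 1(2) b(2)] and r3 = r[OF 1(3) b(3)] and r4 = r[OF 1(4) b(4)]
  have int: "integrable M h" if "h \<in> borel_measurable borel" "\<And>x. 0 \<le> h x" "\<And>x. h x \<le> 1" for h :: "'a \<Rightarrow> real"
    using that by (intro integrable_const_bound[where B = 1]) (auto simp: measurable_cong_sets[OF sets])
  have nn: "(\<integral>\<^sup>+x. f x \<partial>M) = ennreal (\<integral>x. r f x \<partial>M)"
    if f: "f \<in> borel_measurable M" and le: "\<forall>x\<in>space M. f x \<le> 1" for f
  proof -
    have "(\<integral>\<^sup>+x. f x \<partial>M) = (\<integral>\<^sup>+x. ennreal (r f x) \<partial>M)"
      by (rule nn_integral_cong) (rule r(4)[OF f le])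
    also have "\<dots> = ennreal (\<integral>x. r f x \<partial>M)"
      using r(1-3)[OF f le] by (intro nn_integral_eq_integral) (auto intro!: int)
    finally show ?thesis .
  qed
  have le: "r f1 x * r f2 y \<le> r f3 (j x y) * r f4 (m x y)" for x y
  proof -
    have "ennreal (r f1 x) * ennreal (r f2 y) \<le> ennreal (r f3 (j x y)) * ennreal (r f4 (m x y))"
      using 1(9)[of x y] by (simp add: r1(4)[symmetric] r2(4)[symmetric] r3(4)[symmetric] r4(4)[symmetric] sp)
    then show ?thesis
      using r1(2) r2(2) r3(2) r4(2) by (simp add: ennreal_mult[symmetric])
  qed
  \<comment> \<open>The 11 uses that the integrals are at most 1 and \<open>e < 1\<close>: it
    consists of 3 for the losses of \<open>f1\<close> and \<open>f2\<close> and of 8 for expanding a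
    product of two factors each enlarged by \<open>2 * e\<close>.\<close>
  have "?E (r f1) * ?E (r f2) \<le> ?E (r f3) * ?E (r f4) + 11 * e"
    if e: "0 < e" "e < 1" for e
  proof -
    obtain h1 g1 C1 where "lower_approx M (r f1) e h1 g1 C1"
      using continuous_approx_below[OF \<open>prob_space M\<close> sets r1(1-3) e(1)] by blast
    note A1 = lower_approxD[OF this]
    obtain h2 g2 C2 where "lower_approx M (r f2) e h2 g2 C2"
      using continuous_approx_below[OF \<open>prob_space M\<close> sets r2(1-3) e(1)] by blast
    note A2 = lower_approxD[OF this]
    have c3: "(\<lambda>x. 1 - r f3 x) \<in> borel_measurable borel" "\<And>x. 0 \<le> 1 - r f3 x" "\<And>x. 1 - r f3 x \<le> 1"
      using r3(1-3) by auto
    obtain h3 g3 C3 where "lower_approx M (\<lambda>x. 1 - r f3 x) e h3 g3 C3"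
      using continuous_approx_below[OF \<open>prob_space M\<close> sets c3 e(1)] by blast
    note A3 = lower_approxD[OF this]
    have c4: "(\<lambda>x. 1 - r f4 x) \<in> borel_measurable borel" "\<And>x. 0 \<le> 1 - r f4 x" "\<And>x. 1 - r f4 x \<le> 1"
      using r4(1-3) by auto
    obtain h4 g4 C4 where "lower_approx M (\<lambda>x. 1 - r f4 x) e h4 g4 C4"
      using continuous_approx_below[OF \<open>prob_space M\<close> sets c4 e(1)] by blast
    note A4 = lower_approxD[OF this]
    have g0: "0 \<le> g1 x" "0 \<le> g2 x" "0 \<le> g3 x" "0 \<le> g4 x" for x
      using LIMSEQ_le_const[OF A1(5), of 0 x] LIMSEQ_le_const[OF A2(5), of 0 x]
        LIMSEQ_le_const[OF A3(5), of 0 x] LIMSEQ_le_const[OF A4(5), of 0 x] A1(2) A2(2) A3(2) A4(2) by simp_all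
    have gh: "g1 x \<le> h1 k x" "g2 x \<le> h2 k x" "g3 x \<le> h3 k x" "g4 x \<le> h4 k x" for k x
      using decseq_ge[OF A1(4,5)] decseq_ge[OF A2(4,5)] decseq_ge[OF A3(4,5)] decseq_ge[OF A4(4,5)] by auto
    define H where "H k x y = (1 - h3 k (j x y) + e) * (1 - h4 k (m x y) + e)" for k x y
    \<comment> \<open>Otherwise each \<open>k\<close> has a bad pair. As \<open>H\<close> is
      nonnegative, \<open>h1 k\<close> and \<open>h2 k\<close> do not vanish there, so the pairs lie
      in the compact \<open>C1 \<times> C2\<close> and accumulate at some \<open>l\<close>.\<close>
    have "\<exists>k. \<forall>x y. h1 k x * h2 k y \<le> H k x y"
    proof (rule ccontr)
      assume "\<nexists>k. \<forall>x y. h1 k x * h2 k y \<le> H k x y"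
      then have "\<forall>k. \<exists>x y. H k x y < h1 k x * h2 k y" by (simp add: not_le)
      then obtain x y where xy: "\<And>k. H k (x k) (y k) < h1 k (x k) * h2 k (y k)" by metis
      have H0: "0 \<le> H k u v" for k u v
        unfolding H_def using A3(3) A4(3) e by (intro mult_nonneg_nonneg) (auto simp: add_increasing2)
      have "x k \<in> C1" "y k \<in> C2" for k
        using xy[of k] H0[of k "x k" "y k"] A1(7)[of "x k" k] A2(7)[of "y k" k] by force+
      then have in_C: "\<forall>k. (x k, y k) \<in> C1 \<times> C2" by simp
      have "seq_compact (C1 \<times> C2)"
        using A1(6) A2(6) by (simp add: compact_Times compact_imp_seq_compact)
      then obtain l s where s: "strict_mono s" "((\<lambda>k. (x k, y k)) \<circ> s) \<longlonglongrightarrow> l"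
        using in_C by (rule seq_compactE)
      have lim: "(\<lambda>k. x (s k)) \<longlonglongrightarrow> fst l" "(\<lambda>k. y (s k)) \<longlonglongrightarrow> snd l"
        using tendsto_fst[OF s(2)] tendsto_snd[OF s(2)] by (simp_all add: o_def)
      have comp: "(\<lambda>k. h i (q (x (s k)) (y (s k)))) \<longlonglongrightarrow> h i (q (fst l) (snd l))"
        if "continuous_on UNIV (h i)" "continuous_on UNIV (\<lambda>p. q (fst p) (snd p))"
        for h :: "nat \<Rightarrow> 'a \<Rightarrow> real" and q :: "'a \<Rightarrow> 'a \<Rightarrow> 'a" and i
      proof -
        have "continuous_on UNIV (\<lambda>p. h i (q (fst p) (snd p)))"
          using continuous_on_compose2[OF that(1,2)] by simp
        then have "isCont (\<lambda>p. h i (q (fst p) (snd p))) l"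
          using continuous_on_eq_continuous_at[OF open_UNIV] by blast
        from isCont_tendsto_compose[OF this s(2)] show ?thesis by (simp add: o_def)
      qed
      define u v where "u = j (fst l) (snd l)" and "v = m (fst l) (snd l)"
      \<comment> \<open>The index \<open>i\<close> is frozen while the points converge: by
        monotonicity in the index, a pair that is bad at \<open>s k \<ge> i\<close> is bad at
        \<open>i\<close>, and continuity carries this to \<open>l\<close>. Only afterwards does
        \<open>i\<close> tend to infinity.\<close>
      have "H i (fst l) (snd l) \<le> h1 i (fst l) * h2 i (snd l)" for i
      proof (rule LIMSEQ_le)
        show "(\<lambda>k. H i (x (s k)) (y (s k))) \<longlonglongrightarrow> H i (fst l) (snd l)"
          unfolding H_def by (intro tendsto_intros comp A3 A4 jm)
        show "(\<lambda>k. h1 i (x (s k)) * h2 i (y (s k))) \<longlonglongrightarrow> h1 i (fst l) * h2 i (snd l)"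
          by (intro tendsto_intros comp[of h1 _ "\<lambda>u v. u"] comp[of h2 _ "\<lambda>u v. v"] A1 A2 continuous_intros)
        have "H i (x (s k)) (y (s k)) \<le> h1 i (x (s k)) * h2 i (y (s k))" if "i \<le> k" for k
        proof -
          have "i \<le> s k" using that seq_suble[OF s(1), of k] by simp
          then have d: "h1 (s k) u \<le> h1 i u" "h2 (s k) u \<le> h2 i u" "h3 (s k) u \<le> h3 i u" "h4 (s k) u \<le> h4 i u" for u
            using decseqD[OF A1(4)] decseqD[OF A2(4)] decseqD[OF A3(4)] decseqD[OF A4(4)] by blast+
          have "H i (x (s k)) (y (s k)) \<le> H (s k) (x (s k)) (y (s k))"
            unfolding H_def using d A3(3) A4(3) e
            by (intro mult_mono) (auto simp: add_increasing2)
          also have "\<dots> \<le> h1 (s k) (x (s k)) * h2 (s k) (y (s k))" using xy by (rule less_imp_le)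
          also have "\<dots> \<le> h1 i (x (s k)) * h2 i (y (s k))" using d A1(2) A2(2) by (intro mult_mono) auto
          finally show ?thesis .
        qed
        then show "\<exists>N. \<forall>k\<ge>N. H i (x (s k)) (y (s k)) \<le> h1 i (x (s k)) * h2 i (y (s k))" by blast
      qed
      moreover have "(\<lambda>i. H i (fst l) (snd l)) \<longlonglongrightarrow> (1 - g3 u + e) * (1 - g4 v + e)"
        unfolding H_def u_def v_def by (intro tendsto_intros A3 A4)
      moreover have "(\<lambda>i. h1 i (fst l) * h2 i (snd l)) \<longlonglongrightarrow> g1 (fst l) * g2 (snd l)"
        by (intro tendsto_intros A1 A2)
      ultimately have "(1 - g3 u + e) * (1 - g4 v + e) \<le> g1 (fst l) * g2 (snd l)"
        by (intro LIMSEQ_le) auto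
      moreover have "(r f3 u + e) * (r f4 v + e)
          \<le> (1 - g3 u + e) * (1 - g4 v + e)"
        using A3(8)[of u] A4(8)[of v]
          r3(2)[of u] r4(2)[of v] e
        by (intro mult_mono) linarith+
      moreover have "g1 (fst l) * g2 (snd l) \<le> r f1 (fst l) * r f2 (snd l)"
        using A1(8) A2(8) g0 r1(2) by (intro mult_mono) auto
      \<comment> \<open>The raise by \<open>e\<close> makes this strict, contradicting the
        hypothesis at \<open>l\<close>.\<close>
      moreover have "r f3 u * r f4 v <
          (r f3 u + e) * (r f4 v + e)"
        using r3(2)[of u] r4(2)[of v] e
        by (simp add: algebra_simps add_pos_nonneg)
      ultimately show False using le[of "fst l" "snd l", folded u_def v_def] by linarith
    qed
    then obtain k where k: "\<And>x y. h1 k x * h2 k y \<le> H k x y" by blast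
    have hm: "h1 k \<in> borel_measurable borel" "h2 k \<in> borel_measurable borel" "h3 k \<in> borel_measurable borel" "h4 k \<in> borel_measurable borel"
      using A1(1) A2(1) A3(1) A4(1) by (auto intro: borel_measurable_continuous_onI)
    have hh: "?E (h1 k) * ?E (h2 k) \<le> (\<integral>x. 1 - h3 k x + e \<partial>M) * (\<integral>x. 1 - h4 k x + e \<partial>M)"
    proof (rule cont)
      show "h1 k x * h2 k y \<le> (1 - h3 k (j x y) + e) * (1 - h4 k (m x y) + e)" for x y
        using k[of x y] by (simp add: H_def)
      show "0 \<le> h1 k x \<and> h1 k x \<le> 2" "0 \<le> h2 k x \<and> h2 k x \<le> 2"
        "0 \<le> 1 - h3 k x + e \<and> 1 - h3 k x + e \<le> 2" "0 \<le> 1 - h4 k x + e \<and> 1 - h4 k x + e \<le> 2" for x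
        using A1(2,3)[of k x] A2(2,3)[of k x] A3(2,3)[of k x] A4(2,3)[of k x] e by auto
    qed (intro continuous_intros A1 A2 A3 A4)+
    have gh12: "?E g1 \<le> ?E (h1 k)" "?E g2 \<le> ?E (h2 k)"
      using gh g0 hm A1(2,3,9) A2(2,3,9) order_trans[OF A1(8) r1(3)] order_trans[OF A2(8) r2(3)]
      by (auto intro!: integral_mono int)
    have gg: "?E g3 \<le> ?E (h3 k)" "?E g4 \<le> ?E (h4 k)"
      using gh g0 hm A3(2,3,9) A4(2,3,9) order_trans[OF A3(8) c3(3)] order_trans[OF A4(8) c4(3)]
      by (auto intro!: integral_mono int)
    have sub: "(\<integral>x. 1 - h3 k x + e \<partial>M) = 1 - ?E (h3 k) + e" "(\<integral>x. 1 - h4 k x + e \<partial>M) = 1 - ?E (h4 k) + e"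
      "(\<integral>x. 1 - r f3 x \<partial>M) = 1 - ?E (r f3)" "(\<integral>x. 1 - r f4 x \<partial>M) = 1 - ?E (r f4)"
      using int[OF hm(3) A3(2,3)] int[OF hm(4) A4(2,3)] int[OF r3(1-3)] int[OF r4(1-3)] by (simp_all add: prob_space)
    have pos: "0 \<le> ?E g1" "0 \<le> ?E g2" "0 \<le> ?E (r f3)" "0 \<le> ?E (r f4)"
       "0 \<le> ?E (r f1)" "0 \<le> ?E (r f2)"
      using g0 by (auto simp: r_def)
    have one: "?E (h3 k) \<le> 1" "?E (h4 k) \<le> 1" "?E (r f3) \<le> 1" "?E (r f4) \<le> 1"
        "?E g1 \<le> 1" "?E g2 \<le> 1"
      using A3(2,3) A4(2,3) int[OF hm(3)] int[OF hm(4)] int[OF r3(1-3)] int[OF r4(1-3)] r3(3) r4(3)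
        int[OF A1(9) g0(1) order_trans[OF A1(8) r1(3)]] int[OF A2(9) g0(2) order_trans[OF A2(8) r2(3)]] 
        order_trans[OF A1(8) r1(3)] order_trans[OF A2(8) r2(3)]
      by (auto intro!: integral_le_const)
    have "?E g1 * ?E g2 \<le> ?E (h1 k) * ?E (h2 k)"
      using gh12 pos by (intro mult_mono) auto
    also have "\<dots> \<le> (1 - ?E (h3 k) + e) * (1 - ?E (h4 k) + e)"
      using hh unfolding sub(1,2) .
    \<comment> \<open>One \<open>e\<close> is the raise, the other the approximation error.\<close>
    also have "\<dots> \<le> (?E (r f3) + 2 * e) * (?E (r f4) + 2 * e)"
      using A3(10) A4(10) gg one pos e unfolding sub(3,4) by (intro mult_mono) linarith+
    finally have main: "?E g1 * ?E g2 \<le> (?E (r f3) + 2 * e) * (?E (r f4) + 2 * e)" .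
    have "?E (r f1) * ?E (r f2) \<le> (?E g1 + e) * (?E g2 + e)"
      using A1(10) A2(10) pos e by (intro mult_mono) auto
    also have "\<dots> = ?E g1 * ?E g2 + e * ?E g1 + e * ?E g2 + e * e"
      by (simp add: algebra_simps)
    also have "\<dots> \<le> (?E (r f3) + 2 * e) * (?E (r f4) + 2 * e) + e * 1 + e * 1 + e * 1"
      using main one e by (intro add_mono mult_left_mono) auto
    also have "\<dots> = ?E (r f3) * ?E (r f4) + 2 * e * ?E (r f3) + 2 * e * ?E (r f4) + 4 * e * e + 3 * e"
      by (simp add: algebra_simps)
    also have "\<dots> \<le> ?E (r f3) * ?E (r f4) + 2 * e * 1 + 2 * e * 1 + 4 * e * 1 + 3 * e"
      using one e by (intro add_mono mult_left_mono order_refl) auto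
    finally show ?thesis by simp
  qed
  note * = this
  have "?E (r f1) * ?E (r f2) \<le> ?E (r f3) * ?E (r f4)"
  proof (rule field_le_epsilon)
    fix d :: real assume d: "0 < d"
    have "11 * min (d / 11) (1 / 2) \<le> d" "min (d / 11) (1 / 2) < 1" "0 < min (d / 11) (1 / 2)"
      using d by (auto simp: min_def)
    then show "?E (r f1) * ?E (r f2) \<le> ?E (r f3) * ?E (r f4) + d"
      using *[of "min (d / 11) (1 / 2)"] by linarith
  qed
  then show ?case
    unfolding nn[OF 1(1) b(1)] nn[OF 1(2) b(2)] nn[OF 1(3) b(3)] nn[OF 1(4) b(4)]
    using r1(2) r2(2) r3(2) r4(2) by (simp add: ennreal_mult[symmetric] ennreal_leI)
qed

text \<open>Skorohod's representation turns weak convergence into pointwise convergence on some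
  \<open>\<Omega>\<close>. Independent pairs live on the square of \<open>\<Omega>\<close>, where
  dominated convergence applies.\<close>

lemma weak_conv_pair_integral:
  fixes H :: "real \<times> real \<Rightarrow> real"
  assumes \<mu>: "\<And>n. real_distribution (\<mu> n)" and M: "real_distribution M" and conv: "weak_conv_m \<mu> M"
    and H: "continuous_on UNIV H" "\<And>z. \<bar>H z\<bar> \<le> B"
  shows "(\<lambda>n. \<integral>z. H z \<partial>(\<mu> n \<Otimes>\<^sub>M \<mu> n)) \<longlonglongrightarrow> (\<integral>z. H z \<partial>(M \<Otimes>\<^sub>M M))"
proof -
  obtain \<Omega> :: "real measure" and Y_seq Y where Y: "prob_space \<Omega>" "\<And>n. Y_seq n \<in> \<Omega> \<rightarrow>\<^sub>M borel"
      "\<And>n. distr \<Omega> borel (Y_seq n) = \<mu> n" "Y \<in> \<Omega> \<rightarrow>\<^sub>M lborel" "distr \<Omega> borel Y = M"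
      "\<And>x. x \<in> space \<Omega> \<Longrightarrow> (\<lambda>n. Y_seq n x) \<longlonglongrightarrow> Y x"
    using Skorohod[OF \<mu> M conv] by blast
  interpret \<Omega>: prob_space \<Omega> by fact
  interpret P: pair_prob_space \<Omega> \<Omega> ..
  have [measurable]: "Y \<in> borel_measurable \<Omega>" "Y_seq n \<in> borel_measurable \<Omega>" for n using Y(2,4) by auto
  have [measurable]: "H \<in> borel_measurable (borel \<Otimes>\<^sub>M borel)"
    using borel_measurable_continuous_onI[OF H(1)] by (simp add: borel_prod)
  have eq: "(\<integral>z. H z \<partial>(distr \<Omega> borel Z \<Otimes>\<^sub>M distr \<Omega> borel Z)) = (\<integral>\<omega>. H (Z (fst \<omega>), Z (snd \<omega>)) \<partial>(\<Omega> \<Otimes>\<^sub>M \<Omega>))"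
    if [measurable]: "Z \<in> borel_measurable \<Omega>" for Z
  proof -
    interpret Z: prob_space "distr \<Omega> borel Z" by (rule \<Omega>.prob_space_distr) measurable
    have "distr \<Omega> borel Z \<Otimes>\<^sub>M distr \<Omega> borel Z = distr (\<Omega> \<Otimes>\<^sub>M \<Omega>) (borel \<Otimes>\<^sub>M borel) (\<lambda>(x, y). (Z x, Z y))"
      by (intro pair_measure_distr Z.sigma_finite_measure) measurable
    then show ?thesis by (simp add: integral_distr split_beta')
  qed
  have "(\<lambda>n. \<integral>\<omega>. H (Y_seq n (fst \<omega>), Y_seq n (snd \<omega>)) \<partial>(\<Omega> \<Otimes>\<^sub>M \<Omega>)) \<longlonglongrightarrow> (\<integral>\<omega>. H (Y (fst \<omega>), Y (snd \<omega>)) \<partial>(\<Omega> \<Otimes>\<^sub>M \<Omega>))"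
  proof (rule integral_dominated_convergence[where w = "\<lambda>_. B"])
    show "AE \<omega> in \<Omega> \<Otimes>\<^sub>M \<Omega>. (\<lambda>n. H (Y_seq n (fst \<omega>), Y_seq n (snd \<omega>))) \<longlonglongrightarrow> H (Y (fst \<omega>), Y (snd \<omega>))"
    proof (rule AE_I2)
      fix \<omega> assume "\<omega> \<in> space (\<Omega> \<Otimes>\<^sub>M \<Omega>)"
      then have "(\<lambda>n. (Y_seq n (fst \<omega>), Y_seq n (snd \<omega>))) \<longlonglongrightarrow> (Y (fst \<omega>), Y (snd \<omega>))"
        by (intro tendsto_Pair Y(6)) (auto simp: space_pair_measure)
      then show "(\<lambda>n. H (Y_seq n (fst \<omega>), Y_seq n (snd \<omega>))) \<longlonglongrightarrow> H (Y (fst \<omega>), Y (snd \<omega>))"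
        using H(1) by (intro isCont_tendsto_compose[where g = H]) (auto simp: continuous_on_eq_continuous_at)
    qed
  qed (use H(2) in auto)
  then show ?thesis using eq[of Y] eq[of "Y_seq _"] by (simp add: Y(3,5))
qed

section \<open>The single-site measure\<close>

text \<open>The points \<open>a + d\<close> and \<open>c\<close> lie on the segment from
  \<open>a\<close> to \<open>c + d\<close>, and their weights at the far end add up to 1, so the two
  chord inequalities add up to the claim.\<close>

lemma convex_on_increment_mono:
  fixes g :: "real \<Rightarrow> real"
  assumes g: "convex_on S g" and S: "a \<in> S" "c + d \<in> S" and le: "a \<le> c" "0 \<le> d"
  shows "g (a + d) - g a \<le> g (c + d) - g c"
proof (cases "c + d = a")
  case False
  define L where "L = c + d - a"
  have L: "0 < L" using le False by (simp add: L_def)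
  have *: "g ((1 - t) * a + t * (c + d)) \<le> (1 - t) * g a + t * g (c + d)" if "0 \<le> t" "t \<le> 1" for t
    using convex_onD[OF g that S] by simp
  have point: "(1 - p) * a + p * (c + d) = a + p * L" for p by (simp add: L_def algebra_simps)
  have "d \<le> L" "c - a \<le> L" using le by (simp_all add: L_def)
  then have "g (a + d) \<le> (1 - d / L) * g a + (d / L) * g (c + d)"
    "g c \<le> (1 - (c - a) / L) * g a + ((c - a) / L) * g (c + d)"
    using *[of "d / L"] *[of "(c - a) / L"] L le unfolding point by simp_all
  moreover have "d / L + (c - a) / L = 1" using L by (simp add: L_def add_divide_distrib[symmetric])
  then have "(c - a) / L = 1 - d / L" by simp
  ultimately show ?thesis by (simp add: algebra_simps)
qed (use le in auto)

text \<open>A convex function may jump at the ends of a closed interval, so continuity is used on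
  the open interval only, together with a two-sided bound.\<close>

lemma convex_on_integrable:
  fixes g :: "real \<Rightarrow> real"
  assumes g: "convex_on {a..b} g"
  shows "g integrable_on {a..b}"
proof -
  define B where "B = max \<bar>g a\<bar> \<bar>g b\<bar>"
  have upper: "g t \<le> B" if "t \<in> {a..b}" for t
  proof (cases "a = b")
    case False
    then have ab: "a < b" using that by auto
    define u where "u = (t - a) / (b - a)"
    have "(1 - u) * a + u * b = a + u * (b - a)" by (simp add: algebra_simps)
    then have u: "0 \<le> u" "u \<le> 1" "(1 - u) * a + u * b = t" using that ab by (auto simp: u_def)
    have "g t \<le> (1 - u) * g a + u * g b"
      using convex_onD[OF g u(1,2), of a b] ab u(3) by simp
    also have "\<dots> \<le> (1 - u) * B + u * B"
      using u by (intro add_mono mult_left_mono) (auto simp: B_def)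
    finally show ?thesis by (simp add: algebra_simps)
  qed (use that in \<open>auto simp: B_def\<close>)
  \<comment> \<open>Midpoint convexity for \<open>t\<close> and its mirror image
    \<open>a + b - t\<close> turns the upper bound at the mirror image into a lower bound at
    \<open>t\<close>.\<close>
  have lower: "2 * g ((a + b) / 2) - B \<le> g t" if t: "t \<in> {a..b}" for t
  proof -
    have mid: "(1 - 1/2) *\<^sub>R t + (1/2) *\<^sub>R (a + b - t) = (a + b) / 2" by (simp add: field_simps)
    have "g ((1 - 1/2) *\<^sub>R t + (1/2) *\<^sub>R (a + b - t)) \<le> (1 - 1/2) * g t + 1/2 * g (a + b - t)"
      using t by (intro convex_onD[OF g]) auto
    then show ?thesis unfolding mid using upper[of "a + b - t"] t by simp
  qed
  have "g integrable_on {a<..<b}"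
  proof (rule measurable_bounded_by_integrable_imp_integrable_real)
    have "convex_on {a<..<b} g" using g by (rule convex_on_subset) (auto simp: convex_real_interval)
    then have "continuous_on {a<..<b} g" by (intro convex_on_continuous) auto
    then show "g \<in> borel_measurable (lebesgue_on {a<..<b})"
      by (intro continuous_imp_measurable_on_sets_lebesgue) auto
    show "(\<lambda>_. B + \<bar>2 * g ((a + b) / 2) - B\<bar>) integrable_on {a<..<b}"
      using integrable_on_open_interval[of "\<lambda>_. B + \<bar>2 * g ((a + b) / 2) - B\<bar>" a b] by (simp add: integrable_const_ivl)
    show "\<bar>g x\<bar> \<le> B + \<bar>2 * g ((a + b) / 2) - B\<bar>" if "x \<in> {a<..<b}" for x
    proof -
      have "x \<in> {a..b}" "0 \<le> B" using that by (auto simp: B_def)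
      then show ?thesis using upper[of x] lower[of x] by linarith
    qed
  qed simp
  then show ?thesis using integrable_on_open_interval[of g a b] by simp
qed

text \<open>The odd extension of the force; \<open>P(x + y) + P(x - y)\<close> is supermodular because
  \<open>g(x + s) - g(x - s)\<close> is increasing in \<open>x\<close>.\<close>

lemma odd_extension_increment_mono:
  fixes g :: "real \<Rightarrow> real"
  assumes g: "convex_on S g" and S: "0 \<in> S" "x' + s \<in> S" "{0..x' + s} \<subseteq> S" and g0: "g 0 = 0"
    and le: "0 \<le> x" "x \<le> x'" "0 \<le> s"
  defines "f \<equiv> \<lambda>t. if 0 \<le> t then g t else - g (- t)"
  shows "f (x' - s) - f (x - s) \<le> f (x' + s) - f (x + s)"
proof -
  have inc: "g (a + d) - g a \<le> g (c + d) - g c" if "0 \<le> a" "a \<le> c" "0 \<le> d" "c + d \<le> x' + s" for a c d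
    using that S by (intro convex_on_increment_mono[OF g]) auto
  \<comment> \<open>The cases follow the signs of \<open>x - s\<close> and \<open>x' - s\<close>. If
    these are opposite, the left side is \<open>g (x' - s) + g (s - x)\<close>, at most
    \<open>g (x' - x)\<close> by superadditivity, which in turn is at most the increment on the
    right.\<close>
  consider "s \<le> x" | "x' \<le> s" "x < s" | "x < s" "s < x'" by linarith
  then show ?thesis
  proof cases
    case 1
    then show ?thesis using inc[of "x - s" "x + s" "x' - x"] le by (simp add: f_def add.commute)
  next
    case 2
    then show ?thesis using inc[of "s - x'" "x + s" "x' - x"] le g0 by (auto simp: f_def add.commute)
  next
    case 3
    then show ?thesis using inc[of 0 "s - x" "x' - s"] inc[of 0 "x + s" "x' - x"] le g0 by (simp add: f_def add.commute)
  qed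
qed

text \<open>\<open>Q\<close> is a primitive of the odd extension \<open>f\<close>, also at the
  negative values that differences such as \<open>x - y'\<close> may take. Differences of
  \<open>Q\<close> in the second variable are integrals of \<open>f (z + s)\<close> and
  \<open>f (z - s)\<close> over \<open>s\<close> from \<open>y\<close> to \<open>y'\<close>, so the
  claim is \<open>odd_extension_increment_mono\<close> integrated over \<open>s\<close>.\<close>

lemma convex_force_supermodular:
  fixes g :: "real \<Rightarrow> real"
  assumes g: "convex_on {0..T} g" and g0: "g 0 = 0"
    and le: "0 \<le> x" "x \<le> x'" "0 \<le> y" "y \<le> y'" "x' + y' \<le> T"
  defines "Q \<equiv> \<lambda>t. integral {0..\<bar>t\<bar>} g"
  shows "Q (x + y') + Q (x - y') + (Q (x' + y) + Q (x' - y)) \<le> Q (x + y) + Q (x - y) + (Q (x' + y') + Q (x' - y'))"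
proof -
  define f where "f t = (if 0 \<le> t then g t else - g (- t))" for t
  have T: "0 \<le> T" using le by linarith
  have gi: "g integrable_on {0..t}" if "t \<le> T" for t
    using convex_on_integrable[OF g] by (rule integrable_subinterval_real) (use that in auto)
  have pos: "(f has_integral Q t) {0..t}" if "0 \<le> t" "t \<le> T" for t
  proof -
    have "(g has_integral Q t) {0..t}" using gi[OF that(2)] that by (simp add: Q_def integrable_integral)
    then show ?thesis by (rule has_integral_eq_rhs[OF has_integral_eq[rotated]]) (auto simp: f_def)
  qed
  have neg: "(f has_integral - Q t) {t..0}" if "t \<le> 0" "- T \<le> t" for t
  proof -
    have "((\<lambda>s. - f s) has_integral - Q (- t)) {0..-t}"
      using pos[of "- t"] that by (intro has_integral_neg) auto
    then have "((\<lambda>s. - f (- s)) has_integral - Q (- t)) {t..0}"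
      using has_integral_reflect_real[of "\<lambda>s. - f s" "- Q (- t)" "- t" 0] by simp
    then have "(f has_integral - Q (- t)) {t..0}"
      by (rule has_integral_eq[rotated]) (use g0 in \<open>auto simp: f_def\<close>)
    then show ?thesis by (simp add: Q_def)
  qed
  have fi: "f integrable_on {-T..T}"
    using has_integral_combine[OF _ _ neg[of "-T"] pos[of T]] T by (auto simp: integrable_on_def)
  have from_left: "integral {-T..t} f = Q t - Q (-T)" if "- T \<le> t" "t \<le> T" for t
  proof (cases "0 \<le> t")
    case True
    then show ?thesis
      using has_integral_combine[OF _ _ neg[of "-T"] pos[of t]] T that by (auto simp: integral_unique)
  next
    case False
    have "integral {-T..t} f + integral {t..0} f = integral {-T..0} f"
      using that False T by (intro Henstock_Kurzweil_Integration.integral_combine integrable_subinterval_real[OF fi]) auto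
    then show ?thesis using neg[of t] neg[of "-T"] False that T by (auto dest!: integral_unique)
  qed
  have hi: "(f has_integral Q b - Q a) {a..b}" if "- T \<le> a" "a \<le> b" "b \<le> T" for a b
  proof -
    have "integral {-T..a} f + integral {a..b} f = integral {-T..b} f"
      using that by (intro Henstock_Kurzweil_Integration.integral_combine integrable_subinterval_real[OF fi]) auto
    then have "integral {a..b} f = Q b - Q a" using that from_left[of a] from_left[of b] by simp
    moreover have "f integrable_on {a..b}" by (rule integrable_subinterval_real[OF fi]) (use that in auto)
    ultimately show ?thesis by (metis integrable_integral)
  qed
  have shift: "((\<lambda>s. h (z + s)) has_integral i) {a - z..b - z}" if "(h has_integral i) {a..b}" for h :: "real \<Rightarrow> real" and i a b z
    using has_integral_affinity'[of h i a b 1 z] that by (simp add: add.commute)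
  have plus: "((\<lambda>s. f (z + s)) has_integral Q (z + y') - Q (z + y)) {y..y'}" if "0 \<le> z" "z \<le> x'" for z
    using shift[OF hi[of "z + y" "z + y'"], of z] that le by simp
  have minus: "((\<lambda>s. f (z - s)) has_integral Q (z - y) - Q (z - y')) {y..y'}" if "0 \<le> z" "z \<le> x'" for z
    using shift[OF hi[of "z - y'" "z - y"], of z] that le
      has_integral_reflect_real[of "\<lambda>s. f (z + s)" "Q (z - y) - Q (z - y')" "- y" "- y'"] by simp
  have "(Q (x' - y) - Q (x' - y')) - (Q (x - y) - Q (x - y')) \<le> (Q (x' + y') - Q (x' + y)) - (Q (x + y') - Q (x + y))"
  proof (rule has_integral_le)
    show "((\<lambda>s. f (x' - s) - f (x - s)) has_integral (Q (x' - y) - Q (x' - y')) - (Q (x - y) - Q (x - y'))) {y..y'}"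
      using le by (intro has_integral_diff minus) auto
    show "((\<lambda>s. f (x' + s) - f (x + s)) has_integral (Q (x' + y') - Q (x' + y)) - (Q (x + y') - Q (x + y))) {y..y'}"
      using le by (intro has_integral_diff plus) auto
    show "f (x' - s) - f (x - s) \<le> f (x' + s) - f (x + s)" if "s \<in> {y..y'}" for s
      unfolding f_def using that le g0 by (intro odd_extension_increment_mono[OF g]) auto
  qed
  then show ?thesis by linarith
qed

section \<open>Boltzmann factors of potentials with convex force\<close>

context
  fixes P :: "real \<Rightarrow> ereal"
  assumes P: "convex_force_potential P"
begin

lemma boltzmann_potential_cases:
  obtains A :: ereal and C and g where "0 < A" "0 < C" "convex_on {t. 0 \<le> t \<and> ereal t \<le> A} g" "g 0 = 0"
    "\<And>x. boltzmann_factor (P x) = (if ereal \<bar>x\<bar> \<le> A then exp (- (C * integral {0..\<bar>x\<bar>} g)) else 0)"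
proof -
  obtain A :: ereal and C and g where "0 < A" "0 < C" "convex_on {t. 0 \<le> t \<and> ereal t \<le> A} g" "g 0 = 0"
    "\<And>x. P x = (if ereal \<bar>x\<bar> \<le> A then ereal (C * integral {0..\<bar>x\<bar>} g) else \<infinity>)"
    using P unfolding convex_force_potential_def by blast
  then show thesis by (intro that[of A C g]) (auto simp: boltzmann_factor_def)
qed

lemma boltzmann_potential_even: "boltzmann_factor (P (- x)) = boltzmann_factor (P x)"
  by (rule boltzmann_potential_cases) auto

lemma boltzmann_potential_nonneg: "0 \<le> boltzmann_factor (P x)"
  by (rule boltzmann_potential_cases) auto

text \<open>Of the eight arguments \<open>x' + y'\<close> is the largest in absolute value. If it
  lies within the wall at \<open>A\<close>, so do all, and the supermodularity of the potential is
  exponentiated; if not, the left side vanishes.\<close>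

lemma boltzmann_potential_log_submodular:
  assumes le: "0 \<le> x" "x \<le> x'" "0 \<le> y" "y \<le> y'"
  defines "b \<equiv> \<lambda>x. boltzmann_factor (P x)"
  shows "b (x + y) * b (x - y) * (b (x' + y') * b (x' - y')) \<le> b (x + y') * b (x - y') * (b (x' + y) * b (x' - y))"
proof -
  obtain A :: ereal and C and g where A: "0 < A" "0 < C" and g: "convex_on {t. 0 \<le> t \<and> ereal t \<le> A} g" "g 0 = 0"
    and b: "\<And>x. b x = (if ereal \<bar>x\<bar> \<le> A then exp (- (C * integral {0..\<bar>x\<bar>} g)) else 0)"
    unfolding b_def by (rule boltzmann_potential_cases) blast
  show ?thesis
  proof (cases "ereal (x' + y') \<le> A")
    case True
    have in_A: "ereal \<bar>z\<bar> \<le> A" if "\<bar>z\<bar> \<le> x' + y'" for z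
      using that True by (meson ereal_less_eq(3) order_trans)
    have "convex_on {0..x' + y'} g"
      by (rule convex_on_subset[OF g(1)]) (metis (no_types, lifting) in_A abs_of_nonneg atLeastAtMost_iff mem_Collect_eq subsetI, simp add: convex_real_interval)
    note Q = convex_force_supermodular[OF this g(2) le order_refl]
    define q where "q z = - (C * integral {0..\<bar>z\<bar>} g)" for z
    have bq: "b z = exp (q z)" if "\<bar>z\<bar> \<le> x' + y'" for z
      using in_A[OF that] by (simp add: b q_def)
    have "q (x + y) + q (x - y) + (q (x' + y') + q (x' - y')) \<le> q (x + y') + q (x - y') + (q (x' + y) + q (x' - y))"
      using mult_left_mono[OF Q, of C] A(2) by (simp add: distrib_left q_def)
    moreover have "b (x + y) = exp (q (x + y))" "b (x - y) = exp (q (x - y))" "b (x' + y') = exp (q (x' + y'))"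
      "b (x' - y') = exp (q (x' - y'))" "b (x + y') = exp (q (x + y'))" "b (x - y') = exp (q (x - y'))"
      "b (x' + y) = exp (q (x' + y))" "b (x' - y) = exp (q (x' - y))"
      using le by (auto intro!: bq)
    ultimately show ?thesis by (simp only: exp_add[symmetric] exp_le_cancel_iff)
  next
    case False
    then have "b (x' + y') = 0" using le by (simp add: b)
    then show ?thesis unfolding b_def using boltzmann_potential_nonneg by simp
  qed
qed

lemma boltzmann_potential_measurable [measurable]: "(\<lambda>x. boltzmann_factor (P x)) \<in> borel_measurable borel"
proof -
  obtain A :: ereal and C and g where A: "0 < A" and g: "convex_on {t. 0 \<le> t \<and> ereal t \<le> A} g"
    and b: "\<And>x. boltzmann_factor (P x) = (if ereal \<bar>x\<bar> \<le> A then exp (- (C * integral {0..\<bar>x\<bar>} g)) else 0)"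
    by (rule boltzmann_potential_cases) blast
  define T where "T n = (if ereal (real n) \<le> A then real n else real_of_ereal A)" for n
  have T: "ereal (T n) \<le> A" "0 \<le> T n" for n
    using A by (cases A; auto simp: T_def)+
  define f where "f n x = indicator {-T n..T n} x *\<^sub>R exp (- (C * integral {0..\<bar>x\<bar>} g))" for n x
  have f: "f n \<in> borel_measurable borel" for n
    unfolding f_def
  proof (intro borel_measurable_continuous_on_indicator)
    have "convex_on {0..T n} g"
      by (rule convex_on_subset[OF g]) (use T[of n] in \<open>auto intro: order_trans[of _ "ereal (T n)"]\<close>)
    then have "continuous_on {0..T n} (\<lambda>t. integral {0..t} g)"
      by (intro indefinite_integral_continuous_1 convex_on_integrable)
    then have "continuous_on {-T n..T n} (\<lambda>x. integral {0..\<bar>x\<bar>} g)"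
      by (rule continuous_on_compose2) (auto intro!: continuous_intros)
    then show "continuous_on {-T n..T n} (\<lambda>x. exp (- (C * integral {0..\<bar>x\<bar>} g)))"
      by (intro continuous_intros) auto
  qed simp
  show ?thesis
  proof (rule borel_measurable_LIMSEQ_real[OF _ f])
    fix x
    have "f n x = boltzmann_factor (P x)" if n: "\<bar>x\<bar> \<le> real n" for n
    proof (cases "ereal \<bar>x\<bar> \<le> A")
      case True
      then have "\<bar>x\<bar> \<le> T n" using n A by (cases A) (auto simp: T_def)
      then show ?thesis using True by (simp add: f_def b abs_le_iff)
    next
      case False
      then have "\<not> \<bar>x\<bar> \<le> T n" using T(1)[of n] by (meson ereal_less_eq(3) order_trans)
      then have "x \<notin> {-T n..T n}" by (simp add: abs_le_iff) linarith
      then show ?thesis using False by (simp add: f_def b)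
    qed
    moreover obtain N :: nat where "\<bar>x\<bar> \<le> real N" using real_arch_simple by blast
    ultimately have "\<forall>\<^sub>F n in sequentially. f n x = boltzmann_factor (P x)"
      unfolding eventually_sequentially by (intro exI[of _ N]) (auto intro: order_trans)
    then show "(\<lambda>n. f n x) \<longlonglongrightarrow> boltzmann_factor (P x)" by (rule tendsto_eventually)
  qed
qed

end

section \<open>The law of the two absolute values at one site\<close>

abbreviation site_space :: "'v set \<Rightarrow> ('v \<Rightarrow> real \<times> real) measure" where
  "site_space V \<equiv> \<Pi>\<^sub>M u\<in>V. borel"

definition site_measure :: "real measure \<Rightarrow> (real \<times> real) measure" where
  "site_measure \<rho> = distr (\<rho> \<Otimes>\<^sub>M \<rho>) borel (\<lambda>z. (\<bar>fst z + snd z\<bar> / 2, \<bar>fst z - snd z\<bar> / 2))"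

text \<open>The second coordinate is ordered in reverse, in accordance with the sign in
  \<open>(\<xi>\<^sub>p, -\<xi>\<^sub>m)\<close>.\<close>

definition site_join :: "real \<times> real \<Rightarrow> real \<times> real \<Rightarrow> real \<times> real" where
  "site_join p q = (max (fst p) (fst q), min (snd p) (snd q))"

definition site_meet :: "real \<times> real \<Rightarrow> real \<times> real \<Rightarrow> real \<times> real" where
  "site_meet p q = (min (fst p) (fst q), max (snd p) (snd q))"

lemma measurable_site_coords:
  assumes "sets \<rho> = sets borel"
  shows "(\<lambda>z. (\<bar>fst z + snd z\<bar> / 2, \<bar>fst z - snd z\<bar> / 2)) \<in> \<rho> \<Otimes>\<^sub>M \<rho> \<rightarrow>\<^sub>M (borel :: (real \<times> real) measure)"
proof -
  have [measurable_cong]: "sets \<rho> = sets borel" by fact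
  show ?thesis by measurable
qed

text \<open>Two affine substitutions on the line, \<open>b = a - 2 * y\<close> and then
  \<open>a = x + y\<close>, do the work of the planar change of variables; the first contributes the
  factor 2.\<close>

lemma nn_integral_rotate:
  fixes k :: "real \<Rightarrow> real \<Rightarrow> ennreal"
  assumes k[measurable]: "case_prod k \<in> borel_measurable (borel \<Otimes>\<^sub>M borel)"
  shows "(\<integral>\<^sup>+a. \<integral>\<^sup>+b. k a b \<partial>lborel \<partial>lborel) = 2 * (\<integral>\<^sup>+x. \<integral>\<^sup>+y. k (x + y) (x - y) \<partial>lborel \<partial>lborel)"
proof -
  have "(\<integral>\<^sup>+b. k a b \<partial>lborel) = 2 * (\<integral>\<^sup>+y. k a (a - 2 * y) \<partial>lborel)" for a
    by (subst nn_integral_real_affine[where c = "-2" and t = a]) simp_all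
  then have "(\<integral>\<^sup>+a. \<integral>\<^sup>+b. k a b \<partial>lborel \<partial>lborel) = 2 * (\<integral>\<^sup>+a. \<integral>\<^sup>+y. k a (a - 2 * y) \<partial>lborel \<partial>lborel)"
    by (simp add: nn_integral_cmult)
  also have "(\<integral>\<^sup>+a. \<integral>\<^sup>+y. k a (a - 2 * y) \<partial>lborel \<partial>lborel) = (\<integral>\<^sup>+y. \<integral>\<^sup>+a. k a (a - 2 * y) \<partial>lborel \<partial>lborel)"
    by (rule lborel_pair.Fubini') measurable
  also have "\<dots> = (\<integral>\<^sup>+y. \<integral>\<^sup>+x. k (x + y) (x - y) \<partial>lborel \<partial>lborel)"
  proof (rule nn_integral_cong)
    fix y :: real
    show "(\<integral>\<^sup>+a. k a (a - 2 * y) \<partial>lborel) = (\<integral>\<^sup>+x. k (x + y) (x - y) \<partial>lborel)"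
      by (subst nn_integral_real_affine[where c = 1 and t = y]) (simp_all add: algebra_simps)
  qed
  also have "\<dots> = (\<integral>\<^sup>+x. \<integral>\<^sup>+y. k (x + y) (x - y) \<partial>lborel \<partial>lborel)"
    by (rule lborel_pair.Fubini') measurable
  finally show ?thesis .
qed

lemma nn_integral_site_measure_density:
  fixes r :: "real \<Rightarrow> ennreal" and f :: "real \<times> real \<Rightarrow> ennreal"
  assumes r[measurable]: "r \<in> borel_measurable borel" and f[measurable]: "f \<in> borel_measurable borel"
    and p: "prob_space (density lborel r)"
  shows "(\<integral>\<^sup>+z. f z \<partial>site_measure (density lborel r)) =
    2 * (\<integral>\<^sup>+z. f (\<bar>fst z\<bar>, \<bar>snd z\<bar>) * (r (fst z + snd z) * r (fst z - snd z)) \<partial>(lborel \<Otimes>\<^sub>M lborel))"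
proof -
  interpret p: prob_space "density lborel r" by fact
  have "(\<integral>\<^sup>+z. f z \<partial>site_measure (density lborel r)) =
    (\<integral>\<^sup>+z. f (\<bar>fst z + snd z\<bar> / 2, \<bar>fst z - snd z\<bar> / 2) \<partial>(density lborel r \<Otimes>\<^sub>M density lborel r))"
    unfolding site_measure_def by (intro nn_integral_distr measurable_site_coords) simp_all
  also have "\<dots> = (\<integral>\<^sup>+a. \<integral>\<^sup>+b. f (\<bar>a + b\<bar> / 2, \<bar>a - b\<bar> / 2) \<partial>density lborel r \<partial>density lborel r)"
    by (subst p.nn_integral_fst[symmetric]) simp_all
  also have "\<dots> = (\<integral>\<^sup>+a. \<integral>\<^sup>+b. f (\<bar>a + b\<bar> / 2, \<bar>a - b\<bar> / 2) * (r a * r b) \<partial>lborel \<partial>lborel)"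
    by (simp add: nn_integral_density nn_integral_cmult[symmetric] mult_ac)
  also have "\<dots> = 2 * (\<integral>\<^sup>+x. \<integral>\<^sup>+y. f (\<bar>x + y + (x - y)\<bar> / 2, \<bar>x + y - (x - y)\<bar> / 2) * (r (x + y) * r (x - y)) \<partial>lborel \<partial>lborel)"
    by (rule nn_integral_rotate) measurable
  also have "\<dots> = 2 * (\<integral>\<^sup>+x. \<integral>\<^sup>+y. f (\<bar>x\<bar>, \<bar>y\<bar>) * (r (x + y) * r (x - y)) \<partial>lborel \<partial>lborel)"
    by (simp add: abs_mult flip: mult_2)
  finally show ?thesis
    by (subst lborel.nn_integral_fst[symmetric]) simp_all
qed

text \<open>The argument runs on the whole plane instead of the quadrant of absolute values. Each
  axis is a chain when ordered by modulus, so Lebesgue measure has the property; \<open>jx\<close>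
  and \<open>mx\<close> become maximum and minimum under the modulus. The density is even in both
  coordinates, so its inequality on the quadrant extends to the plane.\<close>

lemma four_functions_site_measure_potential:
  assumes P: "convex_force_potential P" and p: "prob_space (potential_measure P)"
  shows "four_functions \<top> (site_measure (potential_measure P)) site_join site_meet"
proof -
  note [measurable] = boltzmann_potential_measurable[OF P]
  define b where "b x = boltzmann_factor (P x)" for x
  have [measurable]: "b \<in> borel_measurable borel" unfolding b_def by measurable
  define Z where "Z = (\<integral>\<^sup>+y. ennreal (b y) \<partial>lborel)"
  define r where "r x = ennreal (b x) / Z" for x
  have [measurable]: "r \<in> borel_measurable borel" unfolding r_def by measurable
  have pot: "potential_measure P = density lborel r"
    by (simp add: potential_measure_def normalized_density_def Z_def b_def r_def[abs_def])
  interpret p: prob_space "density lborel r" using p by (simp add: pot)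
  have "(\<integral>\<^sup>+x. r x \<partial>lborel) = Z / Z"
    unfolding r_def by (subst nn_integral_divide) (simp_all add: Z_def)
  \<comment> \<open>In \<open>ennreal\<close> both \<open>0 / 0\<close> and
    \<open>\<top> / \<top>\<close> are 0, so total mass 1 excludes the degenerate values of
    \<open>Z\<close>.\<close>
  then have ZZ: "Z / Z = 1" using p.emeasure_space_1 by (simp add: emeasure_density)
  have "Z \<noteq> 0" "Z \<noteq> \<top>" using ZZ by (auto simp: divide_ennreal_def)
  then obtain z where z: "0 < z" "Z = ennreal z" by (metis ennreal_cases ennreal_0 less_eq_real_def)
  have rb: "r x = ennreal (b x / z)" for x
    using z boltzmann_potential_nonneg[OF P] by (simp add: r_def b_def divide_ennreal)
  have b0: "0 \<le> b x" and b_even: "b (- x) = b x" for x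
    unfolding b_def using boltzmann_potential_nonneg[OF P] boltzmann_potential_even[OF P] by auto
  define R where "R z = b (fst z + snd z) * b (fst z - snd z)" for z
  have R0: "0 \<le> R z" for z using b0 by (simp add: R_def)
  have R_abs: "R (\<bar>x\<bar>, \<bar>y\<bar>) = R (x, y)" for x y
    using b_even[of "x + y"] b_even[of "x - y"] by (auto simp: R_def abs_if mult.commute)
  have R_sub: "R (x, y) * R (x', y') \<le> R (x, y') * R (x', y)" if "0 \<le> x" "x \<le> x'" "0 \<le> y" "y \<le> y'" for x x' y y'
    using boltzmann_potential_log_submodular[OF P that] by (simp add: R_def b_def)
  have R_le: "R p * R q \<le> R (site_join p q) * R (site_meet p q)"
    if "0 \<le> fst p" "0 \<le> snd p" "0 \<le> fst q" "0 \<le> snd q" for p q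
  proof -
    \<comment> \<open>The content lies in the cases where both coordinates are ordered alike;
      otherwise join and meet are just \<open>p\<close> and \<open>q\<close> in some order.\<close>
    consider "fst p \<le> fst q" "snd p \<le> snd q" | "fst p \<le> fst q" "snd q \<le> snd p"
      | "fst q \<le> fst p" "snd p \<le> snd q" | "fst q \<le> fst p" "snd q \<le> snd p" by linarith
    then show ?thesis
    proof cases
      case 1
      then show ?thesis using R_sub[of "fst p" "fst q" "snd p" "snd q"] that
        by (simp add: site_join_def site_meet_def max_absorb2 min_absorb1 max_absorb1 min_absorb2 mult.commute)
    next
      case 4
      then show ?thesis using R_sub[of "fst q" "fst p" "snd q" "snd p"] that
        by (simp add: site_join_def site_meet_def max_absorb2 min_absorb1 max_absorb1 min_absorb2 mult.commute)
    qed (simp_all add: site_join_def site_meet_def max_absorb2 min_absorb1 max_absorb1 min_absorb2 mult.commute)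
  qed
  define jx mx :: "real \<Rightarrow> real \<Rightarrow> real" where "jx = (\<lambda>x y. if \<bar>y\<bar> \<le> \<bar>x\<bar> then x else y)" and "mx = (\<lambda>x y. if \<bar>y\<bar> \<le> \<bar>x\<bar> then y else x)"
  have jx: "\<bar>jx x y\<bar> = max \<bar>x\<bar> \<bar>y\<bar>" "\<bar>mx x y\<bar> = min \<bar>x\<bar> \<bar>y\<bar>" for x y
    by (auto simp: jx_def mx_def)
  have chain: "four_functions \<top> lborel jx mx"
    unfolding jx_def mx_def by (rule four_functions_chain)
  have ff: "four_functions \<top> (lborel \<Otimes>\<^sub>M lborel) (\<lambda>x y. (jx (fst x) (fst y), mx (snd x) (snd y))) (\<lambda>x y. (mx (fst x) (fst y), jx (snd x) (snd y)))"
    by (intro four_functions_pair chain four_functions_swap[OF chain] lborel.sigma_finite_measure_axioms) simp_all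
  show ?thesis unfolding pot
  proof (rule four_functionsI, goal_cases)
    case (1 f1 f2 f3 f4)
    have [measurable]: "f1 \<in> borel_measurable borel" "f2 \<in> borel_measurable borel" "f3 \<in> borel_measurable borel" "f4 \<in> borel_measurable borel"
      using 1(1-4) by (simp_all add: site_measure_def)
    define F where "F f p = f (\<bar>fst p\<bar>, \<bar>snd p\<bar>) * (r (fst p + snd p) * r (fst p - snd p))" for f :: "real \<times> real \<Rightarrow> ennreal" and p
    have rR: "r (fst p + snd p) * r (fst p - snd p) = ennreal (R p / z\<^sup>2)" for p
      using z b0 by (simp add: rb R_def ennreal_mult[symmetric] power2_eq_square)
    have int: "(\<integral>\<^sup>+p. f p \<partial>site_measure (density lborel r)) = 2 * (\<integral>\<^sup>+p. F f p \<partial>(lborel \<Otimes>\<^sub>M lborel))"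
      if "f \<in> borel_measurable borel" for f
      unfolding F_def using that by (intro nn_integral_site_measure_density p.prob_space_axioms) measurable
    have "(\<integral>\<^sup>+p. F f1 p \<partial>(lborel \<Otimes>\<^sub>M lborel)) * (\<integral>\<^sup>+p. F f2 p \<partial>(lborel \<Otimes>\<^sub>M lborel))
      \<le> (\<integral>\<^sup>+p. F f3 p \<partial>(lborel \<Otimes>\<^sub>M lborel)) * (\<integral>\<^sup>+p. F f4 p \<partial>(lborel \<Otimes>\<^sub>M lborel))"
    proof (rule four_functionsD[OF ff])
      fix p q :: "real \<times> real"
      define p' q' where "p' = (\<bar>fst p\<bar>, \<bar>snd p\<bar>)" and "q' = (\<bar>fst q\<bar>, \<bar>snd q\<bar>)"
      let ?j = "(jx (fst p) (fst q), mx (snd p) (snd q))" and ?m = "(mx (fst p) (fst q), jx (snd p) (snd q))"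
      have jm: "site_join p' q' = (\<bar>fst ?j\<bar>, \<bar>snd ?j\<bar>)" "site_meet p' q' = (\<bar>fst ?m\<bar>, \<bar>snd ?m\<bar>)"
        by (simp_all add: site_join_def site_meet_def p'_def q'_def jx)
      have "R p' * R q' \<le> R (site_join p' q') * R (site_meet p' q')"
        by (rule R_le) (simp_all add: p'_def q'_def)
      moreover have "R p' = R p" "R q' = R q" by (simp_all add: p'_def q'_def R_abs)
      moreover have "R (site_join p' q') = R ?j" "R (site_meet p' q') = R ?m" by (simp_all only: jm R_abs prod.collapse)
      ultimately have "R p * R q \<le> R ?j * R ?m" by simp
      then have "ennreal (R p / z\<^sup>2) * ennreal (R q / z\<^sup>2) \<le> ennreal (R ?j / z\<^sup>2) * ennreal (R ?m / z\<^sup>2)"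
        using R0 by (simp add: ennreal_mult[symmetric] divide_right_mono del: fst_conv snd_conv)
      moreover have "f1 p' * f2 q' \<le> f3 (site_join p' q') * f4 (site_meet p' q')"
        by (rule 1(9)) (simp_all add: site_measure_def)
      ultimately have "(f1 p' * f2 q') * (ennreal (R p / z\<^sup>2) * ennreal (R q / z\<^sup>2)) \<le>
         (f3 (site_join p' q') * f4 (site_meet p' q')) * (ennreal (R ?j / z\<^sup>2) * ennreal (R ?m / z\<^sup>2))"
        by (intro mult_mono[of "f1 p' * f2 q'"]) simp_all
      then show "F f1 p * F f2 q \<le> F f3 ?j * F f4 ?m"
        unfolding F_def rR jm p'_def[symmetric] q'_def[symmetric] by (simp only: mult_ac)
    qed (simp_all add: F_def)
    then have "(2 * 2) * ((\<integral>\<^sup>+p. F f1 p \<partial>(lborel \<Otimes>\<^sub>M lborel)) * (\<integral>\<^sup>+p. F f2 p \<partial>(lborel \<Otimes>\<^sub>M lborel)))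
      \<le> (2 * 2) * ((\<integral>\<^sup>+p. F f3 p \<partial>(lborel \<Otimes>\<^sub>M lborel)) * (\<integral>\<^sup>+p. F f4 p \<partial>(lborel \<Otimes>\<^sub>M lborel)))"
      by (rule mult_left_mono) simp
    then show ?case by (simp add: int mult_ac)
  qed
qed

text \<open>In the limit case, join, meet and the map from a pair of spins to its absolute values
  are continuous, so the inequality passes to the limit for bounded continuous functions, and
  \<open>four_functions_continuous\<close> extends it. For a genuine potential the bound is merely
  imposed.\<close>

lemma four_functions_site_measure:
  assumes \<rho>: "real_distribution \<rho>" and E: "class_E \<rho>"
  shows "four_functions 1 (site_measure \<rho>) site_join site_meet"
  using E unfolding class_E_def
proof (elim disjE exE conjE)
  fix P assume "convex_force_potential P" "\<rho> = potential_measure P"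
  then show ?thesis
    using four_functions_site_measure_potential[of P] \<rho>
    by (auto simp: real_distribution_def intro: four_functions_bound_mono)
next
  fix P assume P: "\<forall>n. convex_force_potential (P n) \<and> prob_space (potential_measure (P n))"
    and conv: "weak_conv_m (\<lambda>n. potential_measure (P n)) \<rho>"
  interpret \<rho>: real_distribution \<rho> by fact
  have rd: "real_distribution (potential_measure (P n))" for n
    using P by (auto simp: real_distribution_def real_distribution_axioms_def potential_measure_def normalized_density_def)
  have site_prob: "prob_space (site_measure \<mu>)" and site_sets: "sets (site_measure \<mu>) = sets borel" if "real_distribution \<mu>" for \<mu>
  proof -
    interpret \<mu>: real_distribution \<mu> by fact
    interpret pair_prob_space \<mu> \<mu> ..
    show "prob_space (site_measure \<mu>)"
      unfolding site_measure_def by (intro P.prob_space_distr measurable_site_coords) simp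
  qed (simp add: site_measure_def)
  let ?c = "\<lambda>z. (\<bar>fst z + snd z\<bar> / 2, \<bar>fst z - snd z\<bar> / 2) :: real \<times> real"
  have site_int: "(\<integral>z. f z \<partial>site_measure \<mu>) = (\<integral>z. f (?c z) \<partial>(\<mu> \<Otimes>\<^sub>M \<mu>))"
    if "real_distribution \<mu>" "f \<in> borel_measurable borel" for \<mu> and f :: "real \<times> real \<Rightarrow> real"
  proof -
    interpret \<mu>: real_distribution \<mu> by fact
    show ?thesis unfolding site_measure_def using that by (intro integral_distr measurable_site_coords) simp_all
  qed
  show ?thesis
  proof (rule four_functions_continuous)
    show "prob_space (site_measure \<rho>)" "sets (site_measure \<rho>) = sets borel"
      using site_prob site_sets \<rho> by auto
    show "continuous_on UNIV (\<lambda>p. site_join (fst p) (snd p))" "continuous_on UNIV (\<lambda>p. site_meet (fst p) (snd p))"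
      unfolding site_join_def site_meet_def by (intro continuous_intros)+
    fix f1 f2 f3 f4 :: "real \<times> real \<Rightarrow> real"
    assume c: "continuous_on UNIV f1" "continuous_on UNIV f2" "continuous_on UNIV f3" "continuous_on UNIV f4"
      and b: "\<And>x. 0 \<le> f1 x \<and> f1 x \<le> 2" "\<And>x. 0 \<le> f2 x \<and> f2 x \<le> 2" "\<And>x. 0 \<le> f3 x \<and> f3 x \<le> 2" "\<And>x. 0 \<le> f4 x \<and> f4 x \<le> 2"
      and le: "\<And>x y. f1 x * f2 y \<le> f3 (site_join x y) * f4 (site_meet x y)"
    note m[measurable] = c[THEN borel_measurable_continuous_onI]
    have lim: "(\<lambda>n. \<integral>z. f z \<partial>site_measure (potential_measure (P n))) \<longlonglongrightarrow> (\<integral>z. f z \<partial>site_measure \<rho>)"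
      if f: "continuous_on UNIV f" and b: "\<And>x. 0 \<le> f x \<and> f x \<le> 2" for f :: "real \<times> real \<Rightarrow> real"
    proof -
      have "continuous_on UNIV (\<lambda>z. f (?c z))"
        by (rule continuous_on_compose2[OF f]) (auto intro!: continuous_intros)
      then have "(\<lambda>n. \<integral>z. f (?c z) \<partial>(potential_measure (P n) \<Otimes>\<^sub>M potential_measure (P n))) \<longlonglongrightarrow> (\<integral>z. f (?c z) \<partial>(\<rho> \<Otimes>\<^sub>M \<rho>))"
        using b by (intro weak_conv_pair_integral[OF rd \<rho> conv, where B = 2]) auto
      then show ?thesis
        using f by (simp add: site_int[OF rd] site_int[OF \<rho>] borel_measurable_continuous_onI)
    qed
    have nn: "(\<integral>\<^sup>+z. ennreal (f z) \<partial>site_measure (potential_measure (P n))) = ennreal (\<integral>z. f z \<partial>site_measure (potential_measure (P n)))"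
      if [measurable]: "f \<in> borel_measurable borel" and b: "\<And>x. 0 \<le> f x \<and> f x \<le> 2" for f n
    proof -
      interpret prob_space "site_measure (potential_measure (P n))" by (rule site_prob[OF rd])
      have [measurable]: "f \<in> borel_measurable (site_measure (potential_measure (P n)))"
        using that by (simp add: measurable_cong_sets[OF site_sets[OF rd]])
      have "integrable (site_measure (potential_measure (P n))) f"
        using b by (intro integrable_const_bound[where B = 2]) auto
      then show ?thesis using b by (intro nn_integral_eq_integral) auto
    qed
    have ineq: "(\<integral>z. f1 z \<partial>site_measure (potential_measure (P n))) * (\<integral>z. f2 z \<partial>site_measure (potential_measure (P n)))
      \<le> (\<integral>z. f3 z \<partial>site_measure (potential_measure (P n))) * (\<integral>z. f4 z \<partial>site_measure (potential_measure (P n)))" for n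
    proof -
      let ?M = "site_measure (potential_measure (P n))"
      have "(\<integral>\<^sup>+z. ennreal (f1 z) \<partial>?M) * (\<integral>\<^sup>+z. ennreal (f2 z) \<partial>?M) \<le> (\<integral>\<^sup>+z. ennreal (f3 z) \<partial>?M) * (\<integral>\<^sup>+z. ennreal (f4 z) \<partial>?M)"
      proof (rule four_functionsD[OF four_functions_site_measure_potential])
        show "ennreal (f1 x) * ennreal (f2 y) \<le> ennreal (f3 (site_join x y)) * ennreal (f4 (site_meet x y))" for x y
          using b le[of x y] by (simp add: ennreal_mult[symmetric] ennreal_leI)
      qed (use P m in \<open>auto simp: measurable_cong_sets[OF site_sets[OF rd]]\<close>)
      then show ?thesis
        unfolding nn[OF m(1) b(1)] nn[OF m(2) b(2)] nn[OF m(3) b(3)] nn[OF m(4) b(4)]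
        using b by (simp add: ennreal_mult[symmetric])
    qed
    show "(\<integral>x. f1 x \<partial>site_measure \<rho>) * (\<integral>x. f2 x \<partial>site_measure \<rho>) \<le> (\<integral>x. f3 x \<partial>site_measure \<rho>) * (\<integral>x. f4 x \<partial>site_measure \<rho>)"
      by (rule LIMSEQ_le[OF tendsto_mult[OF lim lim] tendsto_mult[OF lim lim]]) (use c b ineq in auto)
  qed
qed

section \<open>Sign averaging in the duplicated model\<close>

lemma measurable_sitewise:
  assumes "\<And>u. u \<in> V \<Longrightarrow> q u \<in> M \<rightarrow>\<^sub>M N"
  shows "(\<lambda>z. \<lambda>u\<in>V. q u (z u)) \<in> (\<Pi>\<^sub>M u\<in>V. M) \<rightarrow>\<^sub>M (\<Pi>\<^sub>M u\<in>V. N)"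
  using assms by (intro measurable_restrict measurable_compose[OF measurable_component_singleton])

lemma distr_PiM_sitewise:
  assumes V: "finite V" and M: "prob_space M" and q[measurable]: "\<And>u. q u \<in> M \<rightarrow>\<^sub>M N"
  shows "distr (\<Pi>\<^sub>M u\<in>V. M) (\<Pi>\<^sub>M u\<in>V. N) (\<lambda>z. \<lambda>u\<in>V. q u (z u)) = (\<Pi>\<^sub>M u\<in>V. distr M N (q u))"
proof -
  interpret M: prob_space M by fact
  interpret M: product_sigma_finite "\<lambda>_. M" by (simp add: product_sigma_finite_def M.sigma_finite_measure_axioms)
  have "prob_space (distr M N (q u))" for u by (rule M.prob_space_distr) measurable
  then interpret D: product_sigma_finite "\<lambda>u. distr M N (q u)"
    by (simp add: product_sigma_finite_def prob_space_imp_sigma_finite)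
  have [measurable]: "(\<lambda>z. \<lambda>u\<in>V. q u (z u)) \<in> (\<Pi>\<^sub>M u\<in>V. M) \<rightarrow>\<^sub>M (\<Pi>\<^sub>M u\<in>V. N)" by measurable
  show ?thesis
  proof (rule D.PiM_eqI[OF V])
    show "sets (distr (\<Pi>\<^sub>M u\<in>V. M) (\<Pi>\<^sub>M u\<in>V. N) (\<lambda>z. \<lambda>u\<in>V. q u (z u))) = sets (\<Pi>\<^sub>M u\<in>V. distr M N (q u))"
      by (simp cong: sets_PiM_cong)
    fix A assume "\<And>u. u \<in> V \<Longrightarrow> A u \<in> sets (distr M N (q u))"
    then have A: "\<And>u. u \<in> V \<Longrightarrow> A u \<in> sets N" by simp
    have "emeasure (distr (\<Pi>\<^sub>M u\<in>V. M) (\<Pi>\<^sub>M u\<in>V. N) (\<lambda>z. \<lambda>u\<in>V. q u (z u))) (Pi\<^sub>E V A) =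
      emeasure (\<Pi>\<^sub>M u\<in>V. M) ((\<lambda>z. \<lambda>u\<in>V. q u (z u)) -` Pi\<^sub>E V A \<inter> space (\<Pi>\<^sub>M u\<in>V. M))"
      using A V by (intro emeasure_distr sets_PiM_I_finite) measurable
    also have "(\<lambda>z. \<lambda>u\<in>V. q u (z u)) -` Pi\<^sub>E V A \<inter> space (\<Pi>\<^sub>M u\<in>V. M) = (\<Pi>\<^sub>E u\<in>V. q u -` A u \<inter> space M)"
      by (auto simp: space_PiM PiE_iff)
    also have "emeasure (\<Pi>\<^sub>M u\<in>V. M) \<dots> = (\<Prod>u\<in>V. emeasure M (q u -` A u \<inter> space M))"
      using A V by (intro M.emeasure_PiM) (auto intro: measurable_sets[OF q])
    also have "\<dots> = (\<Prod>u\<in>V. emeasure (distr M N (q u)) (A u))"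
      using A by (intro prod.cong) (simp_all add: emeasure_distr)
    finally show "emeasure (distr (\<Pi>\<^sub>M u\<in>V. M) (\<Pi>\<^sub>M u\<in>V. N) (\<lambda>z. \<lambda>u\<in>V. q u (z u))) (Pi\<^sub>E V A) =
      (\<Prod>u\<in>V. emeasure (distr M N (q u)) (A u))" .
  qed
qed

text \<open>A pair of configurations becomes a configuration of pairs. The indicator of a box is a
  product over sites, and integrating out the two configurations in turn factorises it.\<close>

lemma distr_pair_PiM_sitewise:
  assumes V: "finite V" and M: "prob_space M" and q[measurable]: "q \<in> M \<Otimes>\<^sub>M M \<rightarrow>\<^sub>M N"
  shows "distr ((\<Pi>\<^sub>M u\<in>V. M) \<Otimes>\<^sub>M (\<Pi>\<^sub>M u\<in>V. M)) (\<Pi>\<^sub>M u\<in>V. N) (\<lambda>z. \<lambda>u\<in>V. q (fst z u, snd z u)) =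
    (\<Pi>\<^sub>M u\<in>V. distr (M \<Otimes>\<^sub>M M) N q)" (is "distr ?P ?N ?T = ?R")
proof -
  interpret M: prob_space M by fact
  interpret MM: pair_prob_space M M ..
  interpret M: product_sigma_finite "\<lambda>_. M" by (simp add: product_sigma_finite_def M.sigma_finite_measure_axioms)
  interpret V: prob_space "\<Pi>\<^sub>M u\<in>V. M" by (intro prob_space_PiM M)
  interpret D: prob_space "distr (M \<Otimes>\<^sub>M M) N q" by (rule MM.P.prob_space_distr) fact
  interpret D: product_sigma_finite "\<lambda>u. distr (M \<Otimes>\<^sub>M M) N q"
    by (simp add: product_sigma_finite_def D.sigma_finite_measure_axioms)
  have T[measurable]: "?T \<in> ?P \<rightarrow>\<^sub>M ?N" by measurable
  show ?thesis
  proof (rule D.PiM_eqI[OF V])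
    show "sets (distr ?P ?N ?T) = sets ?R" by (simp cong: sets_PiM_cong)
    fix A assume "\<And>u. u \<in> V \<Longrightarrow> A u \<in> sets (distr (M \<Otimes>\<^sub>M M) N q)"
    then have A[measurable]: "\<And>u. u \<in> V \<Longrightarrow> A u \<in> sets N" by simp
    have [measurable]: "(\<lambda>p. indicator (A u) (q p) :: ennreal) \<in> borel_measurable (M \<Otimes>\<^sub>M M)" if "u \<in> V" for u
      using A[OF that] by measurable
    have [measurable]: "Pi\<^sub>E V A \<in> sets ?N" using A V by (intro sets_PiM_I_finite) auto
    have "emeasure (distr ?P ?N ?T) (Pi\<^sub>E V A) = (\<integral>\<^sup>+z. indicator (Pi\<^sub>E V A) z \<partial>distr ?P ?N ?T)" by simp
    also have "\<dots> = (\<integral>\<^sup>+z. indicator (Pi\<^sub>E V A) (?T z) \<partial>?P)" by (intro nn_integral_distr) measurable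
    finally have "emeasure (distr ?P ?N ?T) (Pi\<^sub>E V A) = (\<integral>\<^sup>+z. indicator (Pi\<^sub>E V A) (?T z) \<partial>?P)" .
    also have "(\<integral>\<^sup>+z. indicator (Pi\<^sub>E V A) (?T z) \<partial>?P) = (\<integral>\<^sup>+z. (\<Prod>u\<in>V. indicator (A u) (q (fst z u, snd z u))) \<partial>?P)"
      using V by (intro nn_integral_cong) (auto simp: indicator_def PiE_iff prod_zero_iff)
    also have "\<dots> = (\<integral>\<^sup>+f. \<integral>\<^sup>+g. (\<Prod>u\<in>V. indicator (A u) (q (f u, g u))) \<partial>(\<Pi>\<^sub>M u\<in>V. M) \<partial>(\<Pi>\<^sub>M u\<in>V. M))"
      by (subst V.nn_integral_fst[symmetric]) (auto intro!: borel_measurable_prod)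
    also have "\<dots> = (\<integral>\<^sup>+f. (\<Prod>u\<in>V. \<integral>\<^sup>+y. indicator (A u) (q (f u, y)) \<partial>M) \<partial>(\<Pi>\<^sub>M u\<in>V. M))"
    proof (intro nn_integral_cong M.product_nn_integral_prod V)
      fix f u assume f: "f \<in> space (\<Pi>\<^sub>M u\<in>V. M)" "u \<in> V"
      then have "f u \<in> space M" by (auto simp: space_PiM)
      then show "(\<lambda>y. indicator (A u) (q (f u, y)) :: ennreal) \<in> borel_measurable M"
        using f by measurable
    qed
    also have "\<dots> = (\<Prod>u\<in>V. \<integral>\<^sup>+x. \<integral>\<^sup>+y. indicator (A u) (q (x, y)) \<partial>M \<partial>M)"
      by (intro M.product_nn_integral_prod V) measurable
    also have "\<dots> = (\<Prod>u\<in>V. emeasure (distr (M \<Otimes>\<^sub>M M) N q) (A u))"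
    proof (intro prod.cong refl)
      fix u assume u: "u \<in> V"
      have "(\<integral>\<^sup>+x. \<integral>\<^sup>+y. indicator (A u) (q (x, y)) \<partial>M \<partial>M) = (\<integral>\<^sup>+p. indicator (A u) (q p) \<partial>(M \<Otimes>\<^sub>M M))"
        using u by (intro M.nn_integral_fst) measurable
      also have "\<dots> = (\<integral>\<^sup>+p. indicator (A u) p \<partial>distr (M \<Otimes>\<^sub>M M) N q)"
        using A[OF u] by (intro nn_integral_distr[symmetric, OF q]) simp
      finally show "(\<integral>\<^sup>+x. \<integral>\<^sup>+y. indicator (A u) (q (x, y)) \<partial>M \<partial>M) = emeasure (distr (M \<Otimes>\<^sub>M M) N q) (A u)"
        using A[OF u] by simp
    qed
    finally show "emeasure (distr ?P ?N ?T) (Pi\<^sub>E V A) = (\<Prod>u\<in>V. emeasure (distr (M \<Otimes>\<^sub>M M) N q) (A u))" .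
  qed
qed

lemma measurable_abs_pair: "(\<lambda>p. (\<bar>fst p\<bar>, \<bar>snd p\<bar>)) \<in> (borel :: (real \<times> real) measure) \<rightarrow>\<^sub>M (borel :: (real \<times> real) measure)"
  by (intro borel_measurable_continuous_onI continuous_intros)

lemma measurable_scale_pair: "(\<lambda>p. (s * fst p, t * snd p)) \<in> (borel :: (real \<times> real) measure) \<rightarrow>\<^sub>M (borel :: (real \<times> real) measure)"
  by (intro borel_measurable_continuous_onI continuous_intros)

definition rotated_measure :: "real measure \<Rightarrow> (real \<times> real) measure" where
  "rotated_measure \<rho> = distr (\<rho> \<Otimes>\<^sub>M \<rho>) borel (\<lambda>z. ((fst z + snd z) / 2, (fst z - snd z) / 2))"

context
  fixes \<rho> :: "real measure"
  assumes \<rho>: "real_distribution \<rho>"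
begin

interpretation real_distribution \<rho> by (rule \<rho>)

interpretation \<rho>\<rho>: pair_prob_space \<rho> \<rho> ..

lemma measurable_rotation [measurable]:
  "(\<lambda>z. ((fst z + snd z) / 2, (fst z - snd z) / 2)) \<in> \<rho> \<Otimes>\<^sub>M \<rho> \<rightarrow>\<^sub>M (borel :: (real \<times> real) measure)"
  by measurable

lemma sets_rotated_measure [simp, measurable_cong]: "sets (rotated_measure \<rho>) = sets borel"
  by (simp add: rotated_measure_def)

lemma prob_space_rotated_measure: "prob_space (rotated_measure \<rho>)"
  unfolding rotated_measure_def by (rule \<rho>\<rho>.P.prob_space_distr) measurable

lemma site_measure_eq_distr_rotated:
  "site_measure \<rho> = distr (rotated_measure \<rho>) borel (\<lambda>p. (\<bar>fst p\<bar>, \<bar>snd p\<bar>))"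
proof -
  have "distr (rotated_measure \<rho>) borel (\<lambda>p. (\<bar>fst p\<bar>, \<bar>snd p\<bar>)) =
    distr (\<rho> \<Otimes>\<^sub>M \<rho>) borel ((\<lambda>p. (\<bar>fst p\<bar>, \<bar>snd p\<bar>)) \<circ> (\<lambda>z. ((fst z + snd z) / 2, (fst z - snd z) / 2)))"
    unfolding rotated_measure_def by (intro distr_distr measurable_abs_pair measurable_rotation)
  then show ?thesis by (simp add: site_measure_def o_def abs_divide)
qed

text \<open>Negating \<open>\<phi> - \<phi>'\<close> amounts to exchanging \<open>\<phi>\<close> and \<open>\<phi>'\<close>, and negating \<open>\<phi> + \<phi>'\<close> amounts to
  replacing \<open>(\<phi>, \<phi>')\<close> by \<open>(-\<phi>', -\<phi>)\<close>.\<close>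

lemma distr_rotated_measure_signs:
  assumes sym: "distr \<rho> borel uminus = \<rho>" and st: "s \<in> {-1, 1}" "t \<in> {-1, 1}"
  shows "distr (rotated_measure \<rho>) borel (\<lambda>p. (s * fst p, t * snd p)) = rotated_measure \<rho>"
proof -
  let ?q = "\<lambda>z. ((fst z + snd z) / 2, (fst z - snd z) / 2) :: real \<times> real"
  let ?D = "\<rho> \<Otimes>\<^sub>M \<rho>"
  have swap: "distr ?D ?D (\<lambda>z. (snd z, fst z)) = ?D"
    using \<rho>\<rho>.distr_pair_swap by (simp add: split_beta')
  have "sigma_finite_measure (distr \<rho> borel uminus)" by (simp add: sym sigma_finite_measure_axioms)
  then have "distr \<rho> borel uminus \<Otimes>\<^sub>M distr \<rho> borel uminus = distr ?D (borel \<Otimes>\<^sub>M borel) (\<lambda>(x, y). (- x, - y))"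
    by (intro pair_measure_distr) measurable
  moreover have "distr ?D (borel \<Otimes>\<^sub>M borel) (\<lambda>(x, y). (- x, - y)) = distr ?D ?D (\<lambda>z. (- fst z, - snd z))"
    by (intro distr_cong) (auto intro!: sets_pair_measure_cong)
  ultimately have neg: "distr ?D ?D (\<lambda>z. (- fst z, - snd z)) = ?D" by (simp add: sym)
  \<comment> \<open>A map \<open>a\<close> preserves the rotated law as soon as the rotation
    intertwines it with a map \<open>r\<close> that preserves \<open>?D\<close>.\<close>
  have inv: "distr (rotated_measure \<rho>) borel a = rotated_measure \<rho>"
    if a[measurable]: "a \<in> borel_measurable borel" and r[measurable]: "r \<in> ?D \<rightarrow>\<^sub>M ?D" and D: "distr ?D ?D r = ?D"
      and eq: "\<And>z. a (?q z) = ?q (r z)" for a r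
  proof -
    have "distr (rotated_measure \<rho>) borel a = distr ?D borel (a \<circ> ?q)"
      unfolding rotated_measure_def by (intro distr_distr) measurable
    also have "a \<circ> ?q = ?q \<circ> r" using eq by (auto simp: fun_eq_iff)
    also have "distr ?D borel (?q \<circ> r) = distr (distr ?D ?D r) borel ?q"
      by (intro distr_distr[symmetric]) measurable
    finally show ?thesis by (simp add: D rotated_measure_def)
  qed
  have minus: "distr (rotated_measure \<rho>) borel (\<lambda>p. (1 * fst p, -1 * snd p)) = rotated_measure \<rho>"
    by (rule inv[OF measurable_scale_pair _ swap]) (simp_all add: field_simps)
  have both: "distr (rotated_measure \<rho>) borel (\<lambda>p. (-1 * fst p, -1 * snd p)) = rotated_measure \<rho>"
    by (rule inv[OF measurable_scale_pair _ neg]) (simp_all add: field_simps)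
  have "distr (distr (rotated_measure \<rho>) borel (\<lambda>p. (-1 * fst p, -1 * snd p))) borel (\<lambda>p. (1 * fst p, -1 * snd p)) =
    distr (rotated_measure \<rho>) borel ((\<lambda>p. (1 * fst p, -1 * snd p)) \<circ> (\<lambda>p. (-1 * fst p, -1 * snd p)))"
    by (intro distr_distr measurable_scale_pair) (subst measurable_cong_sets[OF sets_rotated_measure refl], rule measurable_scale_pair)
  then have plus: "distr (rotated_measure \<rho>) borel (\<lambda>p. (-1 * fst p, 1 * snd p)) = rotated_measure \<rho>"
    unfolding both minus by (simp add: o_def)
  have "distr (rotated_measure \<rho>) borel (\<lambda>p. p) = rotated_measure \<rho>"
    by (intro distr_id2) simp
  then show ?thesis using st minus both plus by fastforce
qed

text \<open>Every pair of sign patterns preserves the product measure, so all summands have the same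
  integral.\<close>

lemma nn_integral_rotated_sign_average:
  assumes V: "finite V" and sym: "distr \<rho> borel uminus = \<rho>"
    and f[measurable]: "f \<in> borel_measurable (site_space V)"
  shows "of_nat (card (signs V) * card (signs V)) * (\<integral>\<^sup>+z. f z \<partial>(\<Pi>\<^sub>M u\<in>V. rotated_measure \<rho>)) =
    (\<integral>\<^sup>+z. (\<Sum>\<sigma>\<in>signs V. \<Sum>\<tau>\<in>signs V. f (\<lambda>u\<in>V. (\<sigma> u * fst (z u), \<tau> u * snd (z u)))) \<partial>(\<Pi>\<^sub>M u\<in>V. rotated_measure \<rho>))"
proof -
  let ?N = "\<Pi>\<^sub>M u\<in>V. rotated_measure \<rho>"
  have [measurable_cong]: "sets ?N = sets (site_space V)"
    by (intro sets_PiM_cong) simp_all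
  have scale: "(\<lambda>p. (s * fst p, t * snd p)) \<in> rotated_measure \<rho> \<rightarrow>\<^sub>M (borel :: (real \<times> real) measure)" for s t
    using measurable_scale_pair by (simp add: measurable_cong_sets[OF sets_rotated_measure refl])
  have [measurable]: "(\<lambda>z. \<lambda>u\<in>V. (\<sigma> u * fst (z u), \<tau> u * snd (z u))) \<in> ?N \<rightarrow>\<^sub>M (site_space V)" for \<sigma> \<tau> :: "_ \<Rightarrow> real"
    by (rule measurable_sitewise[OF scale])
  have "(\<integral>\<^sup>+z. f (\<lambda>u\<in>V. (\<sigma> u * fst (z u), \<tau> u * snd (z u))) \<partial>?N) = (\<integral>\<^sup>+z. f z \<partial>?N)"
    if st: "\<sigma> \<in> signs V" "\<tau> \<in> signs V" for \<sigma> \<tau>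
  proof -
    have "distr ?N (site_space V) (\<lambda>z. \<lambda>u\<in>V. (\<sigma> u * fst (z u), \<tau> u * snd (z u))) =
      (\<Pi>\<^sub>M u\<in>V. distr (rotated_measure \<rho>) borel (\<lambda>p. (\<sigma> u * fst p, \<tau> u * snd p)))"
      by (intro distr_PiM_sitewise V prob_space_rotated_measure scale)
    also have "\<dots> = ?N"
    proof (intro PiM_cong refl distr_rotated_measure_signs[OF sym])
      fix u assume "u \<in> V"
      then show "\<sigma> u \<in> {-1, 1}" "\<tau> u \<in> {-1, 1}" using st signs_values by fastforce+
    qed
    finally show ?thesis
      using nn_integral_distr[of "\<lambda>z. \<lambda>u\<in>V. (\<sigma> u * fst (z u), \<tau> u * snd (z u))" ?N "site_space V" f]
      by simp
  qed
  then show ?thesis by (simp add: nn_integral_sum mult.assoc)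
qed

lemma nn_integral_site_measure_PiM:
  assumes V: "finite V" and f[measurable]: "f \<in> borel_measurable (site_space V)"
  shows "(\<integral>\<^sup>+z. f z \<partial>(\<Pi>\<^sub>M u\<in>V. site_measure \<rho>)) =
    (\<integral>\<^sup>+z. f (\<lambda>u\<in>V. (\<bar>fst (z u)\<bar>, \<bar>snd (z u)\<bar>)) \<partial>(\<Pi>\<^sub>M u\<in>V. rotated_measure \<rho>))"
proof -
  have abs: "(\<lambda>p. (\<bar>fst p\<bar>, \<bar>snd p\<bar>)) \<in> rotated_measure \<rho> \<rightarrow>\<^sub>M (borel :: (real \<times> real) measure)"
    using measurable_abs_pair by (simp add: measurable_cong_sets[OF sets_rotated_measure refl])
  have "(\<Pi>\<^sub>M u\<in>V. site_measure \<rho>) = distr (\<Pi>\<^sub>M u\<in>V. rotated_measure \<rho>) (\<Pi>\<^sub>M u\<in>V. borel) (\<lambda>z. \<lambda>u\<in>V. (\<bar>fst (z u)\<bar>, \<bar>snd (z u)\<bar>))"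
    unfolding site_measure_eq_distr_rotated
    by (intro distr_PiM_sitewise[symmetric] V prob_space_rotated_measure abs)
  then show ?thesis by (simp add: nn_integral_distr[OF measurable_sitewise[OF abs]])
qed

lemma nn_integral_pair_rotated:
  assumes V: "finite V" and f[measurable]: "f \<in> borel_measurable (site_space V)"
  shows "(\<integral>\<^sup>+z. f (\<lambda>u\<in>V. ((fst z u + snd z u) / 2, (fst z u - snd z u) / 2)) \<partial>((\<Pi>\<^sub>M u\<in>V. \<rho>) \<Otimes>\<^sub>M (\<Pi>\<^sub>M u\<in>V. \<rho>))) =
    (\<integral>\<^sup>+z. f z \<partial>(\<Pi>\<^sub>M u\<in>V. rotated_measure \<rho>))"
proof -
  have "(\<Pi>\<^sub>M u\<in>V. rotated_measure \<rho>) = distr ((\<Pi>\<^sub>M u\<in>V. \<rho>) \<Otimes>\<^sub>M (\<Pi>\<^sub>M u\<in>V. \<rho>)) (\<Pi>\<^sub>M u\<in>V. borel)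
     (\<lambda>z. \<lambda>u\<in>V. (\<lambda>p. ((fst p + snd p) / 2, (fst p - snd p) / 2)) (fst z u, snd z u))"
    unfolding rotated_measure_def
    by (intro distr_pair_PiM_sitewise[symmetric] V prob_space_axioms) measurable
  then show ?thesis by (simp add: nn_integral_distr)
qed

end

section \<open>The double cluster swapping representation\<close>

definition open_prob :: "real \<Rightarrow> real \<Rightarrow> real" where
  "open_prob k p = (if p \<le> 0 then 0 else 1 - exp (- 4 * k * p))"

definition state_prob :: "real \<Rightarrow> real \<Rightarrow> bool \<Rightarrow> real" where
  "state_prob k p b = (if b then open_prob k p else 1 - open_prob k p)"

lemma state_prob_nonneg: "0 \<le> k \<Longrightarrow> 0 \<le> state_prob k p b"
  by (simp add: state_prob_def open_prob_def)

lemma edge_prob_eq_open_prob: "edge_prob K \<phi> e = open_prob (K e) (\<Prod>x\<in>e. \<phi> x)"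
  by (auto simp: edge_prob_def open_prob_def abs_prod[symmetric])

lemma space_open_edges: "space (open_edges E K \<phi>) = space (edge_space E)"
  by (rule sets_eq_imp_space_eq[OF sets_open_edges])

lemma nn_integral_open_edges:
  assumes I: "finite I" and K: "\<And>e. e \<in> I \<Longrightarrow> 0 \<le> K e"
  shows "(\<integral>\<^sup>+\<omega>. f \<omega> \<partial>open_edges I K \<phi>) =
    (\<Sum>\<omega>\<in>(\<Pi>\<^sub>E e\<in>I. UNIV). ennreal (\<Prod>e\<in>I. state_prob (K e) (\<Prod>x\<in>e. \<phi> x) (\<omega> e)) * f \<omega>)"
proof -
  have "emeasure (measure_pmf (bernoulli_pmf (edge_prob K \<phi> e))) {b} = ennreal (state_prob (K e) (\<Prod>x\<in>e. \<phi> x) b)"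
    if "e \<in> I" for e b
    using edge_prob_range[of K e \<phi>] K[OF that]
    by (cases b) (simp_all add: emeasure_pmf_single state_prob_def edge_prob_eq_open_prob)
  then have "(\<Prod>e\<in>I. emeasure (measure_pmf (bernoulli_pmf (edge_prob K \<phi> e))) {\<omega> e}) =
      ennreal (\<Prod>e\<in>I. state_prob (K e) (\<Prod>x\<in>e. \<phi> x) (\<omega> e))" for \<omega>
    using K by (simp add: prod_ennreal state_prob_nonneg)
  then show ?thesis
    unfolding open_edges_def by (subst nn_integral_PiM_bool[OF I]) (simp_all add: measure_pmf.prob_space_axioms)
qed

text \<open>For \<open>s = 1\<close> and \<open>K = 2 * k * x\<close> this is
  \<open>exp K * (1 - exp (- 2 * K)) = exp (- K) * (exp (2 * K) - 1)\<close>: the 4 in the edge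
  probability makes the sampled edges the random cluster representation of the signs. At
  \<open>x = 0\<close> open edges have weight 0 on both sides.\<close>

lemma exp_state_prob_eq_edge_weight:
  assumes "0 \<le> k" "0 \<le> x" "s = 1 \<or> s = -1"
  shows "exp (2 * k * (s * x)) * state_prob k (s * x) b = edge_weight (2 * k * x) b s"
  using assms
  by (cases "x = 0") (auto simp: state_prob_def open_prob_def edge_weight_def exp_minus exp_add[symmetric] exp_diff[symmetric] field_simps)

definition spin_cluster_weight ::
  "'e set \<Rightarrow> ('e \<Rightarrow> 'v set) \<Rightarrow> ('e \<Rightarrow> real) \<Rightarrow> ('v \<Rightarrow> real) \<Rightarrow> ('e \<Rightarrow> bool) \<Rightarrow> real" where
  "spin_cluster_weight I a \<kappa> \<phi> \<omega> =
     (\<Prod>e\<in>I. exp (2 * \<kappa> e * (\<Prod>x\<in>a e. \<phi> x)) * state_prob (\<kappa> e) (\<Prod>x\<in>a e. \<phi> x) (\<omega> e))"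

context ising
begin

lemma spin_cluster_weight_nonneg: "0 \<le> spin_cluster_weight I a \<kappa> \<phi> \<omega>"
  unfolding spin_cluster_weight_def using \<kappa>_nonneg
  by (intro prod_nonneg) (auto intro!: mult_nonneg_nonneg state_prob_nonneg)

lemma spin_cluster_weight_cong:
  assumes "\<And>x. x \<in> V \<Longrightarrow> \<phi> x = \<psi> x"
  shows "spin_cluster_weight I a \<kappa> \<phi> \<omega> = spin_cluster_weight I a \<kappa> \<psi> \<omega>"
proof -
  have "(\<Prod>x\<in>a e. \<phi> x) = (\<Prod>x\<in>a e. \<psi> x)" if "e \<in> I" for e
    using a_subset[OF that] assms by (intro prod.cong) auto
  then show ?thesis by (simp add: spin_cluster_weight_def)
qed

lemma cluster_weight_cong:
  assumes "\<And>x. x \<in> V \<Longrightarrow> \<phi> x = \<psi> x"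
  shows "cluster_weight V I a \<kappa> \<phi> \<omega> = cluster_weight V I a \<kappa> \<psi> \<omega>"
proof -
  have "edge_spin a \<kappa> \<phi> e = edge_spin a \<kappa> \<psi> e" if "e \<in> I" for e
    using a_subset[OF that] assms unfolding edge_spin_def by (intro arg_cong[where f = "(*) _"] prod.cong) auto
  then show ?thesis by (simp add: cluster_weight_def)
qed

text \<open>Multiplication by the signs of \<open>\<phi>\<close> permutes the sign configurations,
  so \<open>\<phi>\<close> may be replaced by its absolute value; then
  \<open>exp_state_prob_eq_edge_weight\<close> applies edge by edge. The sign chosen at a zero of
  \<open>\<phi>\<close> is immaterial.\<close>

lemma sum_signs_spin_cluster_weight:
  "(\<Sum>\<sigma>\<in>signs V. spin_cluster_weight I a \<kappa> (\<lambda>x. \<sigma> x * \<phi> x) \<omega>) = cluster_weight V I a \<kappa> (\<lambda>x. \<bar>\<phi> x\<bar>) \<omega>"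
proof -
  define s where "s = (\<lambda>x\<in>V. if 0 \<le> \<phi> x then 1 else -1 :: real)"
  have s: "s \<in> signs V" by (auto simp: s_def signs_def)
  have "(\<Sum>\<sigma>\<in>signs V. spin_cluster_weight I a \<kappa> (\<lambda>x. \<sigma> x * \<phi> x) \<omega>) =
    (\<Sum>\<sigma>\<in>signs V. spin_cluster_weight I a \<kappa> (\<lambda>x. (\<lambda>x\<in>V. s x * \<sigma> x) x * \<phi> x) \<omega>)"
    by (rule sum.reindex_bij_betw[OF bij_signs_mult[OF s], symmetric])
  also have "\<dots> = (\<Sum>\<sigma>\<in>signs V. spin_cluster_weight I a \<kappa> (\<lambda>x. \<sigma> x * \<bar>\<phi> x\<bar>) \<omega>)"
    by (intro sum.cong refl spin_cluster_weight_cong) (auto simp: s_def)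
  also have "\<dots> = cluster_weight V I a \<kappa> (\<lambda>x. \<bar>\<phi> x\<bar>) \<omega>"
    unfolding cluster_weight_def
  proof (rule sum.cong[OF refl])
    fix \<sigma> assume \<sigma>: "\<sigma> \<in> signs V"
    show "spin_cluster_weight I a \<kappa> (\<lambda>x. \<sigma> x * \<bar>\<phi> x\<bar>) \<omega> =
        (\<Prod>e\<in>I. edge_weight (edge_spin a \<kappa> (\<lambda>x. \<bar>\<phi> x\<bar>) e) (\<omega> e) (\<Prod>x\<in>a e. \<sigma> x))"
      unfolding spin_cluster_weight_def edge_spin_def prod.distrib[of \<sigma>]
      by (rule prod.cong[OF refl], rule exp_state_prob_eq_edge_weight)
        (use \<kappa>_nonneg prod_signs_values[OF \<sigma> a_subset] in \<open>auto intro: prod_nonneg\<close>)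
  qed
  finally show ?thesis .
qed

end

lemma prod_ext_spin:
  assumes "e \<in> ext_edges V E"
  shows "(\<Prod>x\<in>e. ext_spin \<phi> x) = (\<Prod>x\<in>Some -` e. \<phi> x)"
proof -
  from assms consider e' where "e = Some ` e'" | v where "e = {Some v, None}"
    unfolding ext_edges_def by blast
  then show ?thesis
  proof cases
    case 1
    then show ?thesis by (simp add: prod.reindex inj_vimage_image_eq ext_spin_def)
  next
    case 2
    then have "Some -` e = {v}" by auto
    then show ?thesis using 2 by (simp add: ext_spin_def)
  qed
qed

section \<open>The two Ising models inside the duplicated spin model\<close>

locale cluster_model =
  fixes V :: "'v set" and E :: "'v set set" and J :: "'v set \<Rightarrow> real" and \<beta> h :: real and \<rho> :: "real measure"
  assumes graph: "finite_graph V E" and J_nonneg: "\<And>e. e \<in> E \<Longrightarrow> 0 \<le> J e"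
    and \<beta>_nonneg: "0 \<le> \<beta>" and h_nonneg: "0 \<le> h" and reference: "reference_measure \<rho>"
begin

lemma finite_V: "finite V" using graph by (simp add: finite_graph_def)

lemma edge_subset: "e \<in> E \<Longrightarrow> e \<subseteq> V" using graph by (auto simp: finite_graph_def)

lemma ext_coupling_nonneg: "e \<in> ext_edges V E \<Longrightarrow> 0 \<le> ext_coupling J \<beta> h e"
  using J_nonneg \<beta>_nonneg h_nonneg by (auto simp: ext_edges_def ext_coupling_def inj_vimage_image_eq)

text \<open>The ghost spin equals 1 and drops out of all products, so a ghost edge becomes an
  interaction of a single sign. The field is thereby covered by the same lemmas as the
  couplings.\<close>

sublocale plus: ising V "ext_edges V E" "\<lambda>e. Some -` e" "ext_coupling J \<beta> h"
proof
  show "Some -` e \<subseteq> V" if "e \<in> ext_edges V E" for e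
    using that edge_subset by (auto simp: ext_edges_def)
qed (use finite_V finite_edges[OF graph] ext_coupling_nonneg in auto)

sublocale minus: ising V E "\<lambda>e. e" "\<lambda>e. \<beta> * J e"
  using finite_V finite_edges[OF graph] edge_subset J_nonneg \<beta>_nonneg by unfold_locales auto

lemma real_distribution: "real_distribution \<rho>" and symmetric: "distr \<rho> borel uminus = \<rho>"
  using reference by (simp_all add: reference_measure_def)

text \<open>On an edge, the product of two spins plus that of their copies is twice the sum of the
  products of half-sums and of half-differences. In the field term the half-differences cancel, so
  ghost edges occur only with \<open>p\<close>.\<close>

lemma spin_weight_duplicate:
  defines "p \<equiv> \<lambda>\<phi> \<phi>' u. (\<phi> u + \<phi>' u) / 2 :: real" and "m \<equiv> \<lambda>\<phi> \<phi>' u. (\<phi> u - \<phi>' u) / 2 :: real"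
  shows "spin_weight V E J \<beta> h \<phi> * spin_weight V E J \<beta> h \<phi>' =
    (\<Prod>e\<in>ext_edges V E. exp (2 * ext_coupling J \<beta> h e * (\<Prod>x\<in>Some -` e. p \<phi> \<phi>' x))) *
    (\<Prod>e\<in>E. exp (2 * (\<beta> * J e) * (\<Prod>x\<in>e. m \<phi> \<phi>' x)))"
proof -
  let ?p = "p \<phi> \<phi>'" and ?m = "m \<phi> \<phi>'"
  have edge: "(\<Prod>x\<in>e. \<phi> x) + (\<Prod>x\<in>e. \<phi>' x) = 2 * ((\<Prod>x\<in>e. ?p x) + (\<Prod>x\<in>e. ?m x))" if "e \<in> E" for e
  proof -
    have "card e = 2" using graph that by (simp add: finite_graph_def)
    then obtain u v where "e = {u, v}" "u \<noteq> v" by (auto simp: card_2_iff)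
    then show ?thesis by (simp add: p_def m_def field_simps)
  qed
  have "(\<Sum>e\<in>ext_edges V E. ext_coupling J \<beta> h e * (\<Prod>x\<in>Some -` e. ?p x)) =
    (\<Sum>e\<in>(`) Some ` E. ext_coupling J \<beta> h e * (\<Prod>x\<in>Some -` e. ?p x)) +
    (\<Sum>e\<in>(\<lambda>v. {Some v, None}) ` V. ext_coupling J \<beta> h e * (\<Prod>x\<in>Some -` e. ?p x))"
    unfolding ext_edges_def using finite_V minus.finite_I by (intro sum.union_disjoint) auto
  also have "(\<Sum>e\<in>(`) Some ` E. ext_coupling J \<beta> h e * (\<Prod>x\<in>Some -` e. ?p x)) = (\<Sum>e\<in>E. \<beta> * J e * (\<Prod>x\<in>e. ?p x))"
    by (subst sum.reindex) (auto simp: ext_coupling_def inj_vimage_image_eq inj_on_def inj_image_eq_iff)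
  also have "(\<Sum>e\<in>(\<lambda>v. {Some v, None}) ` V. ext_coupling J \<beta> h e * (\<Prod>x\<in>Some -` e. ?p x)) = (\<Sum>v\<in>V. h * ?p v)"
  proof (subst sum.reindex)
    show "inj_on (\<lambda>v. {Some v, None}) V" by (auto simp: inj_on_def doubleton_eq_iff)
    have "Some -` {Some v, None} = {v}" for v :: 'v by auto
    then show "(sum ((\<lambda>e. ext_coupling J \<beta> h e * (\<Prod>x\<in>Some -` e. ?p x)) \<circ> (\<lambda>v. {Some v, None})) V) = (\<Sum>v\<in>V. h * ?p v)"
      by (simp add: ext_coupling_def)
  qed
  finally have ext: "(\<Sum>e\<in>ext_edges V E. ext_coupling J \<beta> h e * (\<Prod>x\<in>Some -` e. ?p x)) =
    (\<Sum>e\<in>E. \<beta> * J e * (\<Prod>x\<in>e. ?p x)) + (\<Sum>v\<in>V. h * ?p v)" .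
  have "\<beta> * (\<Sum>e\<in>E. J e * (\<Prod>x\<in>e. \<phi> x)) + \<beta> * (\<Sum>e\<in>E. J e * (\<Prod>x\<in>e. \<phi>' x)) =
      (\<Sum>e\<in>E. \<beta> * J e * ((\<Prod>x\<in>e. \<phi> x) + (\<Prod>x\<in>e. \<phi>' x)))"
    by (simp add: sum_distrib_left sum.distrib[symmetric] algebra_simps)
  also have "\<dots> = (\<Sum>e\<in>E. \<beta> * J e * (2 * ((\<Prod>x\<in>e. ?p x) + (\<Prod>x\<in>e. ?m x))))"
    using edge by simp
  also have "\<dots> = 2 * (\<Sum>e\<in>E. \<beta> * J e * (\<Prod>x\<in>e. ?p x)) + 2 * (\<Sum>e\<in>E. \<beta> * J e * (\<Prod>x\<in>e. ?m x))"
    by (simp add: sum_distrib_left sum.distrib[symmetric] algebra_simps)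
  finally have "\<beta> * (\<Sum>e\<in>E. J e * (\<Prod>x\<in>e. \<phi> x)) + \<beta> * (\<Sum>e\<in>E. J e * (\<Prod>x\<in>e. \<phi>' x)) = \<dots>" .
  moreover have "2 * (h * ?p v) = h * \<phi> v + h * \<phi>' v" for v by (simp add: p_def field_simps)
  then have "h * (\<Sum>u\<in>V. \<phi> u) + h * (\<Sum>u\<in>V. \<phi>' u) = 2 * (\<Sum>v\<in>V. h * ?p v)"
    by (simp only: sum_distrib_left sum.distrib)
  ultimately have "(\<beta> * (\<Sum>e\<in>E. J e * (\<Prod>x\<in>e. \<phi> x)) + h * (\<Sum>u\<in>V. \<phi> u)) + (\<beta> * (\<Sum>e\<in>E. J e * (\<Prod>x\<in>e. \<phi>' x)) + h * (\<Sum>u\<in>V. \<phi>' u)) =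
    (\<Sum>e\<in>ext_edges V E. 2 * ext_coupling J \<beta> h e * (\<Prod>x\<in>Some -` e. ?p x)) + (\<Sum>e\<in>E. 2 * (\<beta> * J e) * (\<Prod>x\<in>e. ?m x))"
    using ext by (simp add: mult.assoc flip: sum_distrib_left)
  then show ?thesis
    unfolding spin_weight_def exp_add[symmetric] by (simp add: exp_sum[symmetric] plus.finite_I minus.finite_I exp_add[symmetric])
qed

lemma measurable_open_edges_minus:
  "(\<lambda>\<phi>. open_edges E (\<lambda>e. \<beta> * J e) \<phi>) \<in> spin_space V \<rightarrow>\<^sub>M prob_algebra (edge_space E)"
proof (rule measurable_open_edges[OF minus.finite_I])
  fix e assume e: "e \<in> E"
  have [measurable]: "(\<lambda>\<phi>. \<phi> x) \<in> borel_measurable (spin_space V)" if "x \<in> e" for x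
    using edge_subset[OF e] that by (intro measurable_component_singleton) auto
  show "(\<lambda>\<phi>. edge_prob (\<lambda>e. \<beta> * J e) \<phi> e) \<in> borel_measurable (spin_space V)"
    unfolding edge_prob_def by measurable
qed (use J_nonneg \<beta>_nonneg in \<open>intro edge_prob_range, auto\<close>)

lemma measurable_open_edges_plus:
  "(\<lambda>\<phi>. open_edges (ext_edges V E) (ext_coupling J \<beta> h) (ext_spin \<phi>)) \<in> spin_space V \<rightarrow>\<^sub>M prob_algebra (edge_space (ext_edges V E))"
proof (rule measurable_open_edges[OF plus.finite_I])
  fix e assume e: "e \<in> ext_edges V E"
  have [measurable]: "(\<lambda>\<phi>. ext_spin \<phi> x) \<in> borel_measurable (spin_space V)" if "x \<in> e" for x
    using plus.a_subset[OF e] that by (cases x) (auto simp: ext_spin_def intro!: measurable_component_singleton)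
  show "(\<lambda>\<phi>. edge_prob (ext_coupling J \<beta> h) (ext_spin \<phi>) e) \<in> borel_measurable (spin_space V)"
    unfolding edge_prob_def by measurable
qed (use ext_coupling_nonneg in \<open>intro edge_prob_range, auto\<close>)

abbreviation "plus_edges \<equiv> \<Pi>\<^sub>E e\<in>ext_edges V E. (UNIV :: bool set)"
abbreviation "minus_edges \<equiv> \<Pi>\<^sub>E e\<in>E. (UNIV :: bool set)"

definition edge_kernel where
  "edge_kernel = (\<lambda>(\<phi>p, \<phi>m). open_edges (ext_edges V E) (ext_coupling J \<beta> h) (ext_spin \<phi>p) \<bind> (\<lambda>\<omega>p.
      open_edges E (\<lambda>e. \<beta> * J e) \<phi>m \<bind> (\<lambda>\<omega>m. return (config_space V E) (\<phi>p, \<phi>m, \<omega>p, \<omega>m))))"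

lemma measurable_edge_kernel: "edge_kernel \<in> spin_space V \<Otimes>\<^sub>M spin_space V \<rightarrow>\<^sub>M prob_algebra (config_space V E)"
proof -
  note mm = measurable_compose[OF _ measurable_open_edges_minus] and mp = measurable_compose[OF _ measurable_open_edges_plus]
  show ?thesis
    unfolding edge_kernel_def split_beta'
    by (rule measurable_bind_prob_space2[OF mp[OF measurable_fst]], unfold split_beta',
        rule measurable_bind_prob_space2[OF mm[OF measurable_compose[OF measurable_fst measurable_snd]]], unfold split_beta',
        rule measurable_compose[OF _ measurable_return_prob_space]) measurable
qed

lemma nn_integral_edge_kernel:
  assumes H[measurable]: "H \<in> borel_measurable (config_space V E)"
    and \<phi>: "\<phi>p \<in> space (spin_space V)" "\<phi>m \<in> space (spin_space V)"
  shows "(\<integral>\<^sup>+x. H x \<partial>edge_kernel (\<phi>p, \<phi>m)) = (\<Sum>\<omega>p\<in>plus_edges. \<Sum>\<omega>m\<in>minus_edges.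
    ennreal ((\<Prod>e\<in>ext_edges V E. state_prob (ext_coupling J \<beta> h e) (\<Prod>x\<in>Some -` e. \<phi>p x) (\<omega>p e)) *
      (\<Prod>e\<in>E. state_prob (\<beta> * J e) (\<Prod>x\<in>e. \<phi>m x) (\<omega>m e))) * H (\<phi>p, \<phi>m, \<omega>p, \<omega>m))"
proof -
  let ?P = "open_edges (ext_edges V E) (ext_coupling J \<beta> h) (ext_spin \<phi>p)" and ?M = "open_edges E (\<lambda>e. \<beta> * J e) \<phi>m"
  let ?C = "config_space V E"
  note [measurable_cong] = sets_open_edges
  have P: "?M \<in> space (prob_algebra (edge_space E))"
    using \<phi>(2) measurable_open_edges_minus by (rule measurable_space[rotated])
  have ret: "(\<lambda>z. return ?C (\<phi>p, \<phi>m, fst z, snd z)) \<in> ?P \<Otimes>\<^sub>M edge_space E \<rightarrow>\<^sub>M prob_algebra ?C"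
    using \<phi> by (intro measurable_compose[OF _ measurable_return_prob_space]) measurable
  have 1: "(\<lambda>\<omega>p. ?M \<bind> (\<lambda>\<omega>m. return ?C (\<phi>p, \<phi>m, \<omega>p, \<omega>m))) \<in> ?P \<rightarrow>\<^sub>M subprob_algebra ?C"
    using measurable_bind_prob_space2[OF measurable_const[OF P], of "\<lambda>\<omega>p \<omega>m. return ?C (\<phi>p, \<phi>m, \<omega>p, \<omega>m)"] ret
    by (intro measurable_prob_algebraD) (simp add: split_beta')
  have 2: "(\<lambda>\<omega>m. return ?C (\<phi>p, \<phi>m, \<omega>p, \<omega>m)) \<in> ?M \<rightarrow>\<^sub>M subprob_algebra ?C" if "\<omega>p \<in> space ?P" for \<omega>p
  proof -
    have "\<omega>p \<in> space (edge_space (ext_edges V E))" using that by (simp add: space_open_edges)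
    then show ?thesis using \<phi> by (intro measurable_compose[OF _ return_measurable]) measurable
  qed
  have "(\<integral>\<^sup>+x. H x \<partial>edge_kernel (\<phi>p, \<phi>m)) = (\<integral>\<^sup>+\<omega>p. \<integral>\<^sup>+x. H x \<partial>(?M \<bind> (\<lambda>\<omega>m. return ?C (\<phi>p, \<phi>m, \<omega>p, \<omega>m))) \<partial>?P)"
    unfolding edge_kernel_def split by (rule nn_integral_bind[OF H 1])
  also have "\<dots> = (\<integral>\<^sup>+\<omega>p. \<integral>\<^sup>+\<omega>m. H (\<phi>p, \<phi>m, \<omega>p, \<omega>m) \<partial>?M \<partial>?P)"
  proof (rule nn_integral_cong)
    fix \<omega>p assume \<omega>p: "\<omega>p \<in> space ?P"
    have "(\<integral>\<^sup>+x. H x \<partial>(?M \<bind> (\<lambda>\<omega>m. return ?C (\<phi>p, \<phi>m, \<omega>p, \<omega>m)))) =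
        (\<integral>\<^sup>+\<omega>m. \<integral>\<^sup>+x. H x \<partial>return ?C (\<phi>p, \<phi>m, \<omega>p, \<omega>m) \<partial>?M)"
      by (rule nn_integral_bind[OF H 2[OF \<omega>p]])
    also have "\<dots> = (\<integral>\<^sup>+\<omega>m. H (\<phi>p, \<phi>m, \<omega>p, \<omega>m) \<partial>?M)"
    proof (rule nn_integral_cong)
      fix \<omega>m assume "\<omega>m \<in> space ?M"
      then have "(\<phi>p, \<phi>m, \<omega>p, \<omega>m) \<in> space ?C"
        using \<omega>p \<phi> by (auto simp: space_pair_measure space_open_edges)
      then show "(\<integral>\<^sup>+x. H x \<partial>return ?C (\<phi>p, \<phi>m, \<omega>p, \<omega>m)) = H (\<phi>p, \<phi>m, \<omega>p, \<omega>m)"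
        by (intro nn_integral_return H)
    qed
    finally show "(\<integral>\<^sup>+x. H x \<partial>(?M \<bind> (\<lambda>\<omega>m. return ?C (\<phi>p, \<phi>m, \<omega>p, \<omega>m)))) = (\<integral>\<^sup>+\<omega>m. H (\<phi>p, \<phi>m, \<omega>p, \<omega>m) \<partial>?M)" .
  qed
  also have "\<dots> = (\<Sum>\<omega>p\<in>plus_edges. ennreal (\<Prod>e\<in>ext_edges V E. state_prob (ext_coupling J \<beta> h e) (\<Prod>x\<in>e. ext_spin \<phi>p x) (\<omega>p e)) *
     (\<Sum>\<omega>m\<in>minus_edges. ennreal (\<Prod>e\<in>E. state_prob (\<beta> * J e) (\<Prod>x\<in>e. \<phi>m x) (\<omega>m e)) * H (\<phi>p, \<phi>m, \<omega>p, \<omega>m)))"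
    by (simp add: nn_integral_open_edges plus.finite_I minus.finite_I plus.\<kappa>_nonneg minus.\<kappa>_nonneg)
  finally show ?thesis
    by (simp add: sum_distrib_left prod_ext_spin mult.assoc ennreal_mult prod_nonneg state_prob_nonneg
        plus.\<kappa>_nonneg minus.\<kappa>_nonneg)
qed

end

lemma sum_swap3:
  "(\<Sum>x\<in>A. \<Sum>y\<in>B. \<Sum>z\<in>C. g x y z) = (\<Sum>z\<in>C. \<Sum>x\<in>A. \<Sum>y\<in>B. g x y z :: 'a :: comm_monoid_add)"
proof -
  have "(\<Sum>y\<in>B. \<Sum>z\<in>C. g x y z) = (\<Sum>z\<in>C. \<Sum>y\<in>B. g x y z)" for x by (rule sum.swap)
  then show ?thesis by (simp only:) (rule sum.swap)
qed

context cluster_model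
begin

abbreviation signed_config where
  "signed_config \<equiv> (\<lambda>(\<phi>p, \<phi>m, \<omega>p, \<omega>m). (\<lambda>u\<in>V. \<bar>\<phi>p u\<bar>, \<lambda>u\<in>V. - \<bar>\<phi>m u\<bar>, \<omega>p, \<lambda>e\<in>E. \<not> \<omega>m e))"

definition config_weight :: "('v \<Rightarrow> real \<times> real) \<Rightarrow> ('v option set \<Rightarrow> bool) \<Rightarrow> ('v set \<Rightarrow> bool) \<Rightarrow> real" where
  "config_weight \<zeta> \<omega>p \<omega>m = cluster_weight V (ext_edges V E) (\<lambda>e. Some -` e) (ext_coupling J \<beta> h) (\<lambda>u. fst (\<zeta> u)) \<omega>p *
     cluster_weight V E (\<lambda>e. e) (\<lambda>e. \<beta> * J e) (\<lambda>u. snd (\<zeta> u)) \<omega>m"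

definition config_at :: "('v \<Rightarrow> real \<times> real) \<Rightarrow> ('v option set \<Rightarrow> bool) \<Rightarrow> ('v set \<Rightarrow> bool) \<Rightarrow>
    ('v \<Rightarrow> real) \<times> ('v \<Rightarrow> real) \<times> ('v option set \<Rightarrow> bool) \<times> ('v set \<Rightarrow> bool)" where
  "config_at \<zeta> \<omega>p \<omega>m = (\<lambda>u\<in>V. fst (\<zeta> u), \<lambda>u\<in>V. - snd (\<zeta> u), \<omega>p, \<lambda>e\<in>E. \<not> \<omega>m e)"

text \<open>For \<open>F = 1\<close> this is the unnormalised density of the absolute values
  relative to the single-site laws; the quotient by that value is the conditional expectation of
  \<open>F\<close> given \<open>\<zeta>\<close>.\<close>

definition cluster_sum where
  "cluster_sum F \<zeta> = (\<Sum>\<omega>p\<in>plus_edges. \<Sum>\<omega>m\<in>minus_edges. config_weight \<zeta> \<omega>p \<omega>m * F (config_at \<zeta> \<omega>p \<omega>m) :: real)"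

lemma finite_configs: "finite plus_edges" "finite minus_edges"
  using plus.finite_I minus.finite_I by (auto intro: finite_PiE)

lemma measurable_signed_config [measurable]: "signed_config \<in> config_space V E \<rightarrow>\<^sub>M config_space V E"
  unfolding split_beta' by measurable

lemma measurable_fst_sites [measurable]: "(\<lambda>z. \<lambda>u\<in>V. fst (z u)) \<in> (site_space V) \<rightarrow>\<^sub>M spin_space V"
  by (rule measurable_sitewise) (intro borel_measurable_continuous_onI continuous_intros)

lemma measurable_snd_sites [measurable]: "(\<lambda>z. \<lambda>u\<in>V. snd (z u)) \<in> (site_space V) \<rightarrow>\<^sub>M spin_space V"
  by (rule measurable_sitewise) (intro borel_measurable_continuous_onI continuous_intros)

lemma measurable_neg_snd_sites [measurable]: "(\<lambda>z. \<lambda>u\<in>V. - snd (z u)) \<in> (site_space V) \<rightarrow>\<^sub>M spin_space V"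
  by (rule measurable_sitewise) (intro borel_measurable_continuous_onI continuous_intros)

lemma measurable_site_component:
  assumes "u \<in> V"
  shows "(\<lambda>z. fst (z u)) \<in> borel_measurable (site_space V)"
    "(\<lambda>z. snd (z u)) \<in> borel_measurable (site_space V)"
proof -
  have m: "(\<lambda>p. fst p) \<in> borel_measurable (borel :: (real \<times> real) measure)" "(\<lambda>p. snd p) \<in> borel_measurable (borel :: (real \<times> real) measure)"
    by (intro borel_measurable_continuous_onI continuous_intros)+
  show "(\<lambda>z. fst (z u)) \<in> borel_measurable (site_space V)"
    "(\<lambda>z. snd (z u)) \<in> borel_measurable (site_space V)"
    by (rule measurable_compose[OF measurable_component_singleton[OF assms] m(1)],
        rule measurable_compose[OF measurable_component_singleton[OF assms] m(2)])
qed

text \<open>The constant \<open>c\<close> gathers the partition functions and the number of sign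
  patterns. It is the same for all \<open>F\<close>, so the case \<open>F = 1\<close> later fixes
  the normalisation.\<close>

lemma expectation_signed_config:
  obtains c :: ennreal where
    "\<And>F. F \<in> borel_measurable (config_space V E) \<Longrightarrow> (\<And>x. x \<in> space (config_space V E) \<Longrightarrow> 0 \<le> F x) \<Longrightarrow>
      (\<integral>\<^sup>+x. ennreal (F (signed_config x)) \<partial>double_cluster_swapping V E J \<beta> h \<rho>) =
      c * (\<integral>\<^sup>+z. ennreal (cluster_sum F (\<lambda>u\<in>V. (\<bar>fst (z u)\<bar>, \<bar>snd (z u)\<bar>))) \<partial>(\<Pi>\<^sub>M u\<in>V. rotated_measure \<rho>))"
proof -
  let ?w = "spin_weight V E J \<beta> h"
  let ?C = "config_space V E" and ?D = "double_cluster_swapping V E J \<beta> h \<rho>" and ?\<Pi> = "\<Pi>\<^sub>M u\<in>V. \<rho>" and ?S = "spin_model V E J \<beta> h \<rho>"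
  let ?N = "\<Pi>\<^sub>M u\<in>V. rotated_measure \<rho>" and ?B = "site_space V"
  interpret real_distribution \<rho> by (rule real_distribution)
  interpret \<Pi>: prob_space ?\<Pi> by (intro prob_space_PiM prob_space_axioms)
  have [measurable_cong]: "sets ?\<Pi> = sets (spin_space V)" by (intro sets_PiM_cong) auto
  have [measurable_cong]: "sets ?N = sets ?B" by (intro sets_PiM_cong) (simp_all add: sets_rotated_measure[OF real_distribution])
  have sp\<Pi>: "space ?\<Pi> = space (spin_space V)" by (simp add: space_PiM)
  have [measurable]: "?w \<in> borel_measurable ?\<Pi>"
    using measurable_spin_weight[OF graph] by measurable
  define Z where "Z = (\<integral>\<^sup>+y. ennreal (?w y) \<partial>?\<Pi>)"
  define w where "w x = ennreal (?w x) / Z" for x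
  have [measurable]: "w \<in> borel_measurable ?\<Pi>" unfolding w_def by measurable
  have S: "?S = density ?\<Pi> w" by (simp add: spin_model_def normalized_density_def Z_def w_def[abs_def])
  have S_in: "?S \<in> space (prob_algebra (spin_space V))"
    by (rule spin_model_in_prob_algebra[OF graph J_nonneg \<beta>_nonneg h_nonneg reference])
  then have [measurable_cong]: "sets ?S = sets (spin_space V)" and S_prob: "prob_space ?S"
    by (auto simp: space_prob_algebra)
  have SS: "?S \<Otimes>\<^sub>M ?S = density (?\<Pi> \<Otimes>\<^sub>M ?\<Pi>) (\<lambda>(x, y). w x * w y)"
    using prob_space_imp_sigma_finite[OF S_prob] unfolding S
    by (intro pair_measure_density \<Pi>.sigma_finite_measure_axioms) auto
  define N where "N = (of_nat (card (signs V) * card (signs V)) :: ennreal)"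
  have N: "N \<noteq> 0" "N \<noteq> \<top>"
  proof -
    have "(\<lambda>v\<in>V. 1) \<in> signs V" by (auto simp: signs_def)
    then have "card (signs V) \<noteq> 0" using finite_signs[OF finite_V] by auto
    then show "N \<noteq> 0" by (simp add: N_def)
    show "N \<noteq> \<top>" by (simp only: N_def ennreal_of_nat_neq_top not_False_eq_True)
  qed
  define T where "T x = (\<lambda>u\<in>V. ((fst x u + snd x u) / 2, (fst x u - snd x u) / 2))" for x :: "('v \<Rightarrow> real) \<times> ('v \<Rightarrow> real)"
  define Tp Tm where "Tp x = (\<lambda>u\<in>V. (fst x u + snd x u) / 2)" and "Tm x = (\<lambda>u\<in>V. (fst x u - snd x u) / 2)"
    for x :: "('v \<Rightarrow> real) \<times> ('v \<Rightarrow> real)"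
  have [measurable]: "Tp \<in> spin_space V \<Otimes>\<^sub>M spin_space V \<rightarrow>\<^sub>M spin_space V" "Tm \<in> spin_space V \<Otimes>\<^sub>M spin_space V \<rightarrow>\<^sub>M spin_space V"
    unfolding Tp_def[abs_def] Tm_def[abs_def] by measurable
  have dcs: "?D = (?S \<Otimes>\<^sub>M ?S) \<bind> (\<lambda>x. edge_kernel (Tp x, Tm x))"
    unfolding double_cluster_swapping_def edge_kernel_def Tp_def Tm_def by (simp add: split_beta' Let_def)
  have ker: "(\<lambda>x. edge_kernel (Tp x, Tm x)) \<in> ?S \<Otimes>\<^sub>M ?S \<rightarrow>\<^sub>M subprob_algebra ?C"
    by (intro measurable_prob_algebraD measurable_compose[OF _ measurable_edge_kernel]) measurable
  let ?wp = "spin_cluster_weight (ext_edges V E) (\<lambda>e. Some -` e) (ext_coupling J \<beta> h)"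
  let ?wm = "spin_cluster_weight E (\<lambda>e. e) (\<lambda>e. \<beta> * J e)"
  show ?thesis
  proof (rule that[of "inverse Z * inverse Z * inverse N"])
    fix F :: "_ \<Rightarrow> real" assume F[measurable]: "F \<in> borel_measurable ?C" and F0: "\<And>x. x \<in> space ?C \<Longrightarrow> 0 \<le> F x"
    define H where "H x = ennreal (F (signed_config x))" for x
    have H[measurable]: "H \<in> borel_measurable ?C" unfolding H_def by measurable
    \<comment> \<open>Boltzmann weight and edge law of a signed configuration, merged. The signs
      enter only through the two weights, because \<open>H\<close> sees the spins through
      \<open>signed_config\<close>.\<close>
    define G where "G z = (\<Sum>\<omega>p\<in>plus_edges. \<Sum>\<omega>m\<in>minus_edges.
      ennreal (?wp (\<lambda>u. fst (z u)) \<omega>p * ?wm (\<lambda>u. snd (z u)) \<omega>m) * H (\<lambda>u\<in>V. fst (z u), \<lambda>u\<in>V. snd (z u), \<omega>p, \<omega>m))" for z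
    have G[measurable]: "G \<in> borel_measurable ?B"
      unfolding G_def
    proof (intro borel_measurable_sum borel_measurable_times_ennreal)
      fix \<omega>p \<omega>m assume \<omega>: "\<omega>p \<in> plus_edges" "\<omega>m \<in> minus_edges"
      have [measurable]: "(\<lambda>z. \<Prod>x\<in>Some -` e. fst (z x)) \<in> borel_measurable ?B" if "e \<in> ext_edges V E" for e
        using plus.a_subset[OF that] by (intro borel_measurable_prod measurable_site_component) auto
      have [measurable]: "(\<lambda>z. \<Prod>x\<in>e. snd (z x)) \<in> borel_measurable ?B" if "e \<in> E" for e
        using edge_subset[OF that] by (intro borel_measurable_prod measurable_site_component) auto
      have "(\<lambda>z. ?wp (\<lambda>u. fst (z u)) \<omega>p) \<in> borel_measurable ?B" "(\<lambda>z. ?wm (\<lambda>u. snd (z u)) \<omega>m) \<in> borel_measurable ?B"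
        unfolding spin_cluster_weight_def state_prob_def open_prob_def by measurable
      then show "(\<lambda>z. ennreal (?wp (\<lambda>u. fst (z u)) \<omega>p * ?wm (\<lambda>u. snd (z u)) \<omega>m)) \<in> borel_measurable ?B" by measurable
      have "\<omega>p \<in> space (edge_space (ext_edges V E))" "\<omega>m \<in> space (edge_space E)" using \<omega> by (auto simp: space_PiM)
      then show "(\<lambda>z. H (\<lambda>u\<in>V. fst (z u), \<lambda>u\<in>V. snd (z u), \<omega>p, \<omega>m)) \<in> borel_measurable ?B"
        by (intro measurable_compose[OF _ H] measurable_Pair measurable_fst_sites measurable_snd_sites measurable_const)
    qed
    have kernel: "w (fst x) * w (snd x) * (\<integral>\<^sup>+y. H y \<partial>edge_kernel (Tp x, Tm x)) = inverse Z * inverse Z * G (T x)"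
      if x: "x \<in> space (?\<Pi> \<Otimes>\<^sub>M ?\<Pi>)" for x
    proof -
      let ?sp = "\<lambda>\<omega>p. \<Prod>e\<in>ext_edges V E. state_prob (ext_coupling J \<beta> h e) (\<Prod>y\<in>Some -` e. Tp x y) (\<omega>p e)"
      let ?sm = "\<lambda>\<omega>m. \<Prod>e\<in>E. state_prob (\<beta> * J e) (\<Prod>y\<in>e. Tm x y) (\<omega>m e)"
      have T: "Tp x \<in> space (spin_space V)" "Tm x \<in> space (spin_space V)"
        by (auto simp: Tp_def Tm_def space_PiM)
      have TT: "(\<lambda>u\<in>V. fst (T x u)) = Tp x" "(\<lambda>u\<in>V. snd (T x u)) = Tm x"
        by (auto simp: T_def Tp_def Tm_def)
      have wpm: "?wp (\<lambda>u. fst (T x u)) \<omega>p = ?wp (Tp x) \<omega>p" "?wm (\<lambda>u. snd (T x u)) \<omega>m = ?wm (Tm x) \<omega>m" for \<omega>p \<omega>m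
        by (intro plus.spin_cluster_weight_cong minus.spin_cluster_weight_cong; simp add: T_def Tp_def Tm_def)+
      have "?w (fst x) * ?w (snd x) =
        (\<Prod>e\<in>ext_edges V E. exp (2 * ext_coupling J \<beta> h e * (\<Prod>y\<in>Some -` e. Tp x y))) *
        (\<Prod>e\<in>E. exp (2 * (\<beta> * J e) * (\<Prod>y\<in>e. Tm x y)))"
      proof -
        have "(\<Prod>y\<in>Some -` e. Tp x y) = (\<Prod>y\<in>Some -` e. (fst x y + snd x y) / 2)" if "e \<in> ext_edges V E" for e
          using plus.a_subset[OF that] by (intro prod.cong) (auto simp: Tp_def)
        moreover have "(\<Prod>y\<in>e. Tm x y) = (\<Prod>y\<in>e. (fst x y - snd x y) / 2)" if "e \<in> E" for e
          using edge_subset[OF that] by (intro prod.cong) (auto simp: Tm_def)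
        ultimately show ?thesis unfolding spin_weight_duplicate by simp
      qed
      then have "?w (fst x) * ?w (snd x) *
          (?sp \<omega>p *
           ?sm \<omega>m) = ?wp (Tp x) \<omega>p * ?wm (Tm x) \<omega>m" for \<omega>p \<omega>m
        by (simp only: spin_cluster_weight_def prod.distrib mult_ac)
      then have "ennreal (?w (fst x)) * ennreal (?w (snd x)) *
          ennreal (?sp \<omega>p *
           ?sm \<omega>m) = ennreal (?wp (Tp x) \<omega>p * ?wm (Tm x) \<omega>m)" for \<omega>p \<omega>m
        by (subst ennreal_mult[symmetric], simp add: spin_weight_def, simp add: spin_weight_def,
            subst ennreal_mult[symmetric])
          (auto simp: spin_weight_def intro!: mult_nonneg_nonneg prod_nonneg state_prob_nonneg plus.\<kappa>_nonneg minus.\<kappa>_nonneg)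
      then have "ennreal (?w (fst x)) * ennreal (?w (snd x)) *
          (\<integral>\<^sup>+y. H y \<partial>edge_kernel (Tp x, Tm x)) = G (T x)"
        unfolding nn_integral_edge_kernel[OF H T] G_def TT wpm by (simp add: sum_distrib_left mult.assoc[symmetric])
      then show ?thesis by (simp add: w_def divide_ennreal_def mult_ac)
    qed
    have "(\<integral>\<^sup>+x. H x \<partial>?D) = (\<integral>\<^sup>+x. \<integral>\<^sup>+y. H y \<partial>edge_kernel (Tp x, Tm x) \<partial>(?S \<Otimes>\<^sub>M ?S))"
      unfolding dcs by (rule nn_integral_bind[OF H ker])
    also have "\<dots> = (\<integral>\<^sup>+x. w (fst x) * w (snd x) * (\<integral>\<^sup>+y. H y \<partial>edge_kernel (Tp x, Tm x)) \<partial>(?\<Pi> \<Otimes>\<^sub>M ?\<Pi>))"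
    proof -
      have "(\<lambda>x. \<integral>\<^sup>+y. H y \<partial>edge_kernel (Tp x, Tm x)) \<in> borel_measurable (?S \<Otimes>\<^sub>M ?S)"
        by (rule measurable_compose[OF ker nn_integral_measurable_subprob_algebra[OF H]])
      then have "(\<lambda>x. \<integral>\<^sup>+y. H y \<partial>edge_kernel (Tp x, Tm x)) \<in> borel_measurable (?\<Pi> \<Otimes>\<^sub>M ?\<Pi>)"
        unfolding S by (simp cong: sets_pair_measure_cong measurable_cong_sets add: SS[unfolded S])
      then show ?thesis unfolding SS by (subst nn_integral_density) (auto simp: split_beta')
    qed
    also have "\<dots> = (\<integral>\<^sup>+x. inverse Z * inverse Z * G (T x) \<partial>(?\<Pi> \<Otimes>\<^sub>M ?\<Pi>))"
      by (rule nn_integral_cong) (rule kernel)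
    also have "\<dots> = inverse Z * inverse Z * (\<integral>\<^sup>+x. G (T x) \<partial>(?\<Pi> \<Otimes>\<^sub>M ?\<Pi>))"
    proof (rule nn_integral_cmult)
      have "T \<in> ?\<Pi> \<Otimes>\<^sub>M ?\<Pi> \<rightarrow>\<^sub>M ?B" unfolding T_def[abs_def] by measurable
      then show "(\<lambda>x. G (T x)) \<in> borel_measurable (?\<Pi> \<Otimes>\<^sub>M ?\<Pi>)" by measurable
    qed
    also have "(\<integral>\<^sup>+x. G (T x) \<partial>(?\<Pi> \<Otimes>\<^sub>M ?\<Pi>)) = (\<integral>\<^sup>+z. G z \<partial>?N)"
      unfolding T_def by (rule nn_integral_pair_rotated[OF real_distribution finite_V G])
    \<comment> \<open>The number \<open>N\<close> of sign patterns is inserted to produce the sum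
      over signs; it cancels because it is neither 0 nor infinite.\<close>
    also have "(\<integral>\<^sup>+z. G z \<partial>?N) = inverse N * (N * (\<integral>\<^sup>+z. G z \<partial>?N))"
    proof -
      have "inverse N * N = 1"
        using ennreal_divide_self[of N] N by (simp add: divide_ennreal_def mult.commute less_top)
      then show ?thesis by (simp add: mult.assoc[symmetric])
    qed
    also have "N * (\<integral>\<^sup>+z. G z \<partial>?N) =
        (\<integral>\<^sup>+z. (\<Sum>\<sigma>\<in>signs V. \<Sum>\<tau>\<in>signs V. G (\<lambda>u\<in>V. (\<sigma> u * fst (z u), \<tau> u * snd (z u)))) \<partial>?N)"
      unfolding N_def by (rule nn_integral_rotated_sign_average[OF real_distribution finite_V symmetric G])
    also have "\<dots> = (\<integral>\<^sup>+z. ennreal (cluster_sum F (\<lambda>u\<in>V. (\<bar>fst (z u)\<bar>, \<bar>snd (z u)\<bar>))) \<partial>?N)"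
    proof (rule nn_integral_cong)
      fix z :: "'v \<Rightarrow> real \<times> real"
      let ?\<zeta> = "\<lambda>u\<in>V. (\<bar>fst (z u)\<bar>, \<bar>snd (z u)\<bar>)"
      let ?W = "\<lambda>\<sigma> \<tau> \<omega>p \<omega>m. ?wp (\<lambda>u. \<sigma> u * fst (z u)) \<omega>p * ?wm (\<lambda>u. \<tau> u * snd (z u)) \<omega>m"
      let ?F = "\<lambda>\<omega>p \<omega>m. ennreal (F (config_at ?\<zeta> \<omega>p \<omega>m))"
      let ?cp = "cluster_weight V (ext_edges V E) (\<lambda>e. Some -` e) (ext_coupling J \<beta> h) (\<lambda>u. \<bar>fst (z u)\<bar>)"
      let ?cm = "cluster_weight V E (\<lambda>e. e) (\<lambda>e. \<beta> * J e) (\<lambda>u. \<bar>snd (z u)\<bar>)"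
      have cw: "config_weight ?\<zeta> \<omega>p \<omega>m = ?cp \<omega>p * ?cm \<omega>m" for \<omega>p \<omega>m
        unfolding config_weight_def
        by (intro arg_cong2[where f = "(*)"] plus.cluster_weight_cong minus.cluster_weight_cong) auto
      have c0: "0 \<le> ?cp \<omega>p" "0 \<le> ?cm \<omega>m" for \<omega>p \<omega>m
        by (auto intro: plus.cluster_weight_nonneg minus.cluster_weight_nonneg)
      have H_eq: "H (\<lambda>u\<in>V. \<sigma> u * fst (z u), \<lambda>u\<in>V. \<tau> u * snd (z u), \<omega>p, \<omega>m) = ?F \<omega>p \<omega>m"
        if "\<sigma> \<in> signs V" "\<tau> \<in> signs V" for \<sigma> \<tau> \<omega>p \<omega>m
      proof -
        have "\<bar>\<sigma> u\<bar> = 1" "\<bar>\<tau> u\<bar> = 1" if "u \<in> V" for u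
          using signs_values[OF \<open>\<sigma> \<in> signs V\<close> that] signs_values[OF \<open>\<tau> \<in> signs V\<close> that] by auto
        then show ?thesis by (auto simp: H_def config_at_def abs_mult restrict_def fun_eq_iff intro!: arg_cong[where f = "\<lambda>x. ennreal (F x)"])
      qed
      have "(\<Sum>\<sigma>\<in>signs V. \<Sum>\<tau>\<in>signs V. G (\<lambda>u\<in>V. (\<sigma> u * fst (z u), \<tau> u * snd (z u)))) =
        (\<Sum>\<sigma>\<in>signs V. \<Sum>\<tau>\<in>signs V. \<Sum>\<omega>p\<in>plus_edges. \<Sum>\<omega>m\<in>minus_edges.
          ennreal (?W \<sigma> \<tau> \<omega>p \<omega>m) * ?F \<omega>p \<omega>m)"
      proof (intro sum.cong refl)
        fix \<sigma> \<tau> assume st: "\<sigma> \<in> signs V" "\<tau> \<in> signs V"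
        let ?z = "\<lambda>u\<in>V. (\<sigma> u * fst (z u), \<tau> u * snd (z u))"
        have "?wp (\<lambda>u. fst (?z u)) \<omega>p = ?wp (\<lambda>u. \<sigma> u * fst (z u)) \<omega>p" "?wm (\<lambda>u. snd (?z u)) \<omega>m = ?wm (\<lambda>u. \<tau> u * snd (z u)) \<omega>m" for \<omega>p \<omega>m
          by (intro plus.spin_cluster_weight_cong minus.spin_cluster_weight_cong; simp)+
        moreover have "(\<lambda>u\<in>V. fst (?z u)) = (\<lambda>u\<in>V. \<sigma> u * fst (z u))" "(\<lambda>u\<in>V. snd (?z u)) = (\<lambda>u\<in>V. \<tau> u * snd (z u))" by auto
        ultimately show "G ?z = (\<Sum>\<omega>p\<in>plus_edges. \<Sum>\<omega>m\<in>minus_edges.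
          ennreal (?W \<sigma> \<tau> \<omega>p \<omega>m) * ?F \<omega>p \<omega>m)"
          unfolding G_def by (simp only: H_eq[OF st])
      qed
      \<comment> \<open>The sums over signs move inside, where \<open>F\<close> no longer depends on
        them; there they factorise into the two random cluster weights.\<close>
      also have "\<dots> = (\<Sum>\<omega>p\<in>plus_edges. \<Sum>\<omega>m\<in>minus_edges. (\<Sum>\<sigma>\<in>signs V. \<Sum>\<tau>\<in>signs V.
          ennreal (?W \<sigma> \<tau> \<omega>p \<omega>m)) * ?F \<omega>p \<omega>m)"
        unfolding sum_distrib_right
        by (subst sum_swap3) (intro sum.cong refl, rule sum_swap3)
      also have "\<dots> = (\<Sum>\<omega>p\<in>plus_edges. \<Sum>\<omega>m\<in>minus_edges. ennreal (?cp \<omega>p * ?cm \<omega>m) * ?F \<omega>p \<omega>m)"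
      proof (intro sum.cong refl arg_cong2[where f = "(*)"])
        fix \<omega>p \<omega>m
        have "(\<Sum>\<sigma>\<in>signs V. \<Sum>\<tau>\<in>signs V. ennreal (?W \<sigma> \<tau> \<omega>p \<omega>m)) =
          ennreal (\<Sum>\<sigma>\<in>signs V. \<Sum>\<tau>\<in>signs V. ?W \<sigma> \<tau> \<omega>p \<omega>m)"
          by (simp add: sum_ennreal sum_nonneg mult_nonneg_nonneg plus.spin_cluster_weight_nonneg minus.spin_cluster_weight_nonneg)
        also have "(\<Sum>\<sigma>\<in>signs V. \<Sum>\<tau>\<in>signs V. ?W \<sigma> \<tau> \<omega>p \<omega>m) = ?cp \<omega>p * ?cm \<omega>m"
          unfolding plus.sum_signs_spin_cluster_weight[symmetric] minus.sum_signs_spin_cluster_weight[symmetric]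
          by (rule sum_product[symmetric])
        finally show "(\<Sum>\<sigma>\<in>signs V. \<Sum>\<tau>\<in>signs V. ennreal (?W \<sigma> \<tau> \<omega>p \<omega>m)) = ennreal (?cp \<omega>p * ?cm \<omega>m)" .
      qed
      also have "\<dots> = (\<Sum>\<omega>p\<in>plus_edges. \<Sum>\<omega>m\<in>minus_edges. ennreal (config_weight ?\<zeta> \<omega>p \<omega>m * F (config_at ?\<zeta> \<omega>p \<omega>m)))"
      proof (intro sum.cong refl)
        fix \<omega>p \<omega>m assume "\<omega>p \<in> plus_edges" "\<omega>m \<in> minus_edges"
        then have "config_at ?\<zeta> \<omega>p \<omega>m \<in> space ?C"
          by (auto simp: config_at_def space_pair_measure space_PiM)
        then show "ennreal (?cp \<omega>p * ?cm \<omega>m) * ?F \<omega>p \<omega>m = ennreal (config_weight ?\<zeta> \<omega>p \<omega>m * F (config_at ?\<zeta> \<omega>p \<omega>m))"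
          unfolding cw using c0 F0 by (intro ennreal_mult[symmetric]) auto
      qed
      also have "\<dots> = ennreal (cluster_sum F ?\<zeta>)"
      proof -
        have "0 \<le> config_weight ?\<zeta> \<omega>p \<omega>m * F (config_at ?\<zeta> \<omega>p \<omega>m)" if "\<omega>p \<in> plus_edges" "\<omega>m \<in> minus_edges" for \<omega>p \<omega>m
          unfolding cw using c0 that
          by (intro mult_nonneg_nonneg F0) (auto simp: config_at_def space_pair_measure space_PiM)
        then show ?thesis unfolding cluster_sum_def by (simp add: sum_ennreal sum_nonneg)
      qed
      finally show "(\<Sum>\<sigma>\<in>signs V. \<Sum>\<tau>\<in>signs V. G (\<lambda>u\<in>V. (\<sigma> u * fst (z u), \<tau> u * snd (z u)))) = ennreal (cluster_sum F ?\<zeta>)" .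
    qed
    finally show "(\<integral>\<^sup>+x. ennreal (F (signed_config x)) \<partial>?D) =
      inverse Z * inverse Z * inverse N * (\<integral>\<^sup>+z. ennreal (cluster_sum F (\<lambda>u\<in>V. (\<bar>fst (z u)\<bar>, \<bar>snd (z u)\<bar>))) \<partial>?N)"
      unfolding H_def by (simp add: mult.assoc)
  qed
qed

end

section \<open>The FKG inequality\<close>

text \<open>\<open>bool\<close> is a two-point chain, ordered by \<open>of_bool\<close>, so the
  Ahlswede-Daykin theorem for subsets follows by tensorisation.\<close>

lemma four_functions_bool_PiM:
  assumes "finite I"
  shows "four_functions \<top> (count_space (\<Pi>\<^sub>E e\<in>I. (UNIV :: bool set)))
    (\<lambda>x y. \<lambda>e\<in>I. x e \<or> y e) (\<lambda>x y. \<lambda>e\<in>I. x e \<and> y e)"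
proof -
  have eq: "(\<lambda>x y. if of_bool y \<le> (of_bool x :: real) then x else y) = (\<or>)"
    "(\<lambda>x y. if of_bool y \<le> (of_bool x :: real) then y else x) = (\<and>)"
    by (auto simp: fun_eq_iff)
  have "four_functions \<top> (count_space (UNIV :: bool set)) (\<or>) (\<and>)"
    using four_functions_chain[of \<top> "count_space UNIV" "of_bool :: bool \<Rightarrow> real"] unfolding eq .
  from four_functions_PiM[OF assms this] show ?thesis
    using assms by (simp add: sigma_finite_measure_count_space_finite count_space_PiM_finite)
qed

text \<open>The second family of edges carries the reversed order, as needed for
  \<open>-\<omega>\<^sub>m\<close>.\<close>

lemma sum_four_functions_bool:
  fixes f1 f2 f3 f4 :: "('a \<Rightarrow> bool) \<Rightarrow> ('b \<Rightarrow> bool) \<Rightarrow> real"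
  assumes I: "finite I" and I': "finite I'"
  defines "P \<equiv> \<Pi>\<^sub>E e\<in>I. (UNIV :: bool set)" and "M \<equiv> \<Pi>\<^sub>E e\<in>I'. (UNIV :: bool set)"
  assumes nonneg: "\<And>x x'. x \<in> P \<Longrightarrow> x' \<in> M \<Longrightarrow> 0 \<le> f1 x x' \<and> 0 \<le> f2 x x' \<and> 0 \<le> f3 x x' \<and> 0 \<le> f4 x x'"
    and le: "\<And>x x' y y'. x \<in> P \<Longrightarrow> x' \<in> M \<Longrightarrow> y \<in> P \<Longrightarrow> y' \<in> M \<Longrightarrow>
      f1 x x' * f2 y y' \<le> f3 (\<lambda>e\<in>I. x e \<or> y e) (\<lambda>e\<in>I'. x' e \<and> y' e) * f4 (\<lambda>e\<in>I. x e \<and> y e) (\<lambda>e\<in>I'. x' e \<or> y' e)"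
  shows "(\<Sum>x\<in>P. \<Sum>x'\<in>M. f1 x x') * (\<Sum>x\<in>P. \<Sum>x'\<in>M. f2 x x') \<le> (\<Sum>x\<in>P. \<Sum>x'\<in>M. f3 x x') * (\<Sum>x\<in>P. \<Sum>x'\<in>M. f4 x x')"
proof -
  have fin: "finite P" "finite M" unfolding P_def M_def using I I' by (auto intro: finite_PiE)
  have int: "(\<integral>\<^sup>+p. ennreal (f (fst p) (snd p)) \<partial>count_space (P \<times> M)) = ennreal (\<Sum>x\<in>P. \<Sum>x'\<in>M. f x x')"
    if "\<And>x x'. x \<in> P \<Longrightarrow> x' \<in> M \<Longrightarrow> 0 \<le> f x x'" for f :: "('a \<Rightarrow> bool) \<Rightarrow> ('b \<Rightarrow> bool) \<Rightarrow> real"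
  proof -
    have "(\<Sum>p\<in>P \<times> M. ennreal (f (fst p) (snd p))) = ennreal (\<Sum>p\<in>P \<times> M. f (fst p) (snd p))"
      using that by (intro sum_ennreal) auto
    then show ?thesis using fin by (simp add: nn_integral_count_space_finite sum.cartesian_product split_beta')
  qed
  have closed: "(\<lambda>e\<in>I. Q (x e) (y e)) \<in> P" for Q and x y :: "'a \<Rightarrow> bool" by (simp add: P_def)
  have closed': "(\<lambda>e\<in>I'. Q (x e) (y e)) \<in> M" for Q and x y :: "'b \<Rightarrow> bool" by (simp add: M_def)
  have "four_functions \<top> (count_space P \<Otimes>\<^sub>M count_space M)
    (\<lambda>x y. (\<lambda>e\<in>I. fst x e \<or> fst y e, \<lambda>e\<in>I'. snd x e \<and> snd y e)) (\<lambda>x y. (\<lambda>e\<in>I. fst x e \<and> fst y e, \<lambda>e\<in>I'. snd x e \<or> snd y e))"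
    using four_functions_pair[OF four_functions_bool_PiM[OF I] four_functions_swap[OF four_functions_bool_PiM[OF I']]] fin
    by (simp add: P_def[symmetric] M_def[symmetric] sigma_finite_measure_count_space_finite closed)
  then have "four_functions \<top> (count_space (P \<times> M))
    (\<lambda>x y. (\<lambda>e\<in>I. fst x e \<or> fst y e, \<lambda>e\<in>I'. snd x e \<and> snd y e)) (\<lambda>x y. (\<lambda>e\<in>I. fst x e \<and> fst y e, \<lambda>e\<in>I'. snd x e \<or> snd y e))"
    using fin by (simp add: pair_measure_count_space)
  from four_functionsD[OF this, of "\<lambda>p. ennreal (f1 (fst p) (snd p))" "\<lambda>p. ennreal (f2 (fst p) (snd p))"
    "\<lambda>p. ennreal (f3 (fst p) (snd p))" "\<lambda>p. ennreal (f4 (fst p) (snd p))"]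
  have "(\<integral>\<^sup>+p. ennreal (f1 (fst p) (snd p)) \<partial>count_space (P \<times> M)) * (\<integral>\<^sup>+p. ennreal (f2 (fst p) (snd p)) \<partial>count_space (P \<times> M)) \<le>
    (\<integral>\<^sup>+p. ennreal (f3 (fst p) (snd p)) \<partial>count_space (P \<times> M)) * (\<integral>\<^sup>+p. ennreal (f4 (fst p) (snd p)) \<partial>count_space (P \<times> M))"
    using le nonneg closed closed' by (fastforce simp: ennreal_mult[symmetric] intro!: ennreal_leI)
  then show ?thesis
    using nonneg by (simp add: int ennreal_mult[symmetric] sum_nonneg)
qed

context ising
begin

lemma ising_partition_mono:
  assumes "\<And>v. v \<in> V \<Longrightarrow> 0 \<le> \<xi> v" "\<And>v. v \<in> V \<Longrightarrow> \<xi> v \<le> \<xi>' v"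
  shows "ising_partition V I a \<kappa> \<xi> \<le> ising_partition V I a \<kappa> \<xi>'"
  unfolding ising_partition_def
proof (rule sum_signs_mono[OF finite_V finite_I a_subset])
  fix e assume "e \<in> I"
  then show "sign_dominated (\<lambda>s. exp (edge_spin a \<kappa> \<xi> e * s)) (\<lambda>s. exp (edge_spin a \<kappa> \<xi>' e * s))"
    using edge_spin_nonneg[of \<xi> e] edge_spin_mono[of \<xi> \<xi>' e] assms by (intro sign_dominated_exp) auto
qed

lemma ising_partition_cong:
  assumes "\<And>x. x \<in> V \<Longrightarrow> \<phi> x = \<psi> x"
  shows "ising_partition V I a \<kappa> \<phi> = ising_partition V I a \<kappa> \<psi>"
  unfolding sum_cluster_weight[symmetric] using cluster_weight_cong[OF assms] by simp

end

section \<open>Edges given the absolute values, and the density of the absolute values\<close>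

context cluster_model
begin

abbreviation "configs \<equiv> space (config_space V E)"

definition nonneg_sites :: "('v \<Rightarrow> real \<times> real) \<Rightarrow> bool" where
  "nonneg_sites \<zeta> \<longleftrightarrow> (\<forall>u\<in>V. 0 \<le> fst (\<zeta> u) \<and> 0 \<le> snd (\<zeta> u))"

definition le_sites :: "('v \<Rightarrow> real \<times> real) \<Rightarrow> ('v \<Rightarrow> real \<times> real) \<Rightarrow> bool" where
  "le_sites \<zeta> \<zeta>' \<longleftrightarrow> (\<forall>u\<in>V. fst (\<zeta> u) \<le> fst (\<zeta>' u) \<and> snd (\<zeta>' u) \<le> snd (\<zeta> u))"

lemma config_weight_nonneg: "nonneg_sites \<zeta> \<Longrightarrow> 0 \<le> config_weight \<zeta> \<omega>p \<omega>m"
  unfolding config_weight_def nonneg_sites_def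
  by (intro mult_nonneg_nonneg plus.cluster_weight_nonneg minus.cluster_weight_nonneg) auto

text \<open>For the minus edges \<open>\<zeta>\<close> and \<open>\<zeta>'\<close> exchange roles,
  because \<open>le_sites\<close> reverses the second coordinate; the upper site configuration
  therefore receives the meet of the minus edges.\<close>

lemma config_weight_holley:
  assumes "nonneg_sites \<zeta>" "nonneg_sites \<zeta>'" "le_sites \<zeta> \<zeta>'"
  shows "config_weight \<zeta> x x' * config_weight \<zeta>' y y' \<le>
    config_weight \<zeta>' (\<lambda>e\<in>ext_edges V E. x e \<or> y e) (\<lambda>e\<in>E. x' e \<and> y' e) *
    config_weight \<zeta> (\<lambda>e\<in>ext_edges V E. x e \<and> y e) (\<lambda>e\<in>E. x' e \<or> y' e)"
proof -
  let ?p = "\<lambda>\<zeta>. cluster_weight V (ext_edges V E) (\<lambda>e. Some -` e) (ext_coupling J \<beta> h) (\<lambda>u. fst (\<zeta> u))"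
  let ?m = "\<lambda>\<zeta>. cluster_weight V E (\<lambda>e. e) (\<lambda>e. \<beta> * J e) (\<lambda>u. snd (\<zeta> u))"
  have "?p \<zeta> x * ?p \<zeta>' y \<le> ?p \<zeta>' (\<lambda>e\<in>ext_edges V E. x e \<or> y e) * ?p \<zeta> (\<lambda>e\<in>ext_edges V E. x e \<and> y e)"
    using assms by (intro plus.cluster_weight_holley) (auto simp: nonneg_sites_def le_sites_def)
  moreover have "?m \<zeta>' y' * ?m \<zeta> x' \<le> ?m \<zeta> (\<lambda>e\<in>E. y' e \<or> x' e) * ?m \<zeta>' (\<lambda>e\<in>E. y' e \<and> x' e)"
    using assms by (intro minus.cluster_weight_holley) (auto simp: nonneg_sites_def le_sites_def)
  moreover have "0 \<le> ?p \<zeta> \<omega>" "0 \<le> ?p \<zeta>' \<omega>" "0 \<le> ?m \<zeta> \<omega>'" "0 \<le> ?m \<zeta>' \<omega>'" for \<omega> \<omega>'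
    using assms by (auto simp: nonneg_sites_def intro: plus.cluster_weight_nonneg minus.cluster_weight_nonneg)
  ultimately have "(?p \<zeta> x * ?p \<zeta>' y) * (?m \<zeta>' y' * ?m \<zeta> x') \<le>
    (?p \<zeta>' (\<lambda>e\<in>ext_edges V E. x e \<or> y e) * ?p \<zeta> (\<lambda>e\<in>ext_edges V E. x e \<and> y e)) * (?m \<zeta> (\<lambda>e\<in>E. y' e \<or> x' e) * ?m \<zeta>' (\<lambda>e\<in>E. y' e \<and> x' e))"
    by (intro mult_mono[of "?p \<zeta> x * ?p \<zeta>' y"]) auto
  then show ?thesis by (simp add: config_weight_def mult_ac disj_commute conj_commute)
qed

lemma config_at_in_space:
  assumes "\<omega>p \<in> plus_edges" shows "config_at \<zeta> \<omega>p \<omega>m \<in> configs"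
  using assms by (auto simp: config_at_def space_pair_measure space_PiM)

lemma config_at_mono:
  assumes "le_sites \<zeta> \<zeta>'" "x \<in> plus_edges" "y \<in> plus_edges"
    and "\<And>e. e \<in> ext_edges V E \<Longrightarrow> x e \<Longrightarrow> y e" "\<And>e. e \<in> E \<Longrightarrow> y' e \<Longrightarrow> x' e"
  shows "config_at \<zeta> x x' \<le> config_at \<zeta>' y y'"
proof -
  have "x e \<le> y e" for e
    using assms(2-4) by (cases "e \<in> ext_edges V E") (auto simp: PiE_iff extensional_def)
  then show ?thesis using assms by (auto simp: config_at_def le_sites_def le_fun_def)
qed

text \<open>Two facts in one: for \<open>G = 1\<close> the conditional expectation of
  \<open>F\<close> increases from \<open>\<zeta>\<close> to \<open>\<zeta>'\<close>, and for
  \<open>\<zeta> = \<zeta>'\<close> this is the FKG inequality for the edges given the absolute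
  values.\<close>

lemma cluster_sum_mult_le:
  assumes \<zeta>: "nonneg_sites \<zeta>" "nonneg_sites \<zeta>'" "le_sites \<zeta> \<zeta>'"
    and F: "mono_on (configs) F" "\<And>x. x \<in> configs \<Longrightarrow> 0 \<le> F x"
    and G: "mono_on (configs) G" "\<And>x. x \<in> configs \<Longrightarrow> 0 \<le> G x"
  shows "cluster_sum F \<zeta> * cluster_sum G \<zeta>' \<le> cluster_sum (\<lambda>x. F x * G x) \<zeta>' * cluster_sum (\<lambda>_. 1) \<zeta>"
  unfolding cluster_sum_def
proof (rule sum_four_functions_bool[OF plus.finite_I minus.finite_I], goal_cases)
  case (1 x x')
  then show ?case
    using config_weight_nonneg[OF \<zeta>(1)] config_weight_nonneg[OF \<zeta>(2)] F(2) G(2) config_at_in_space by simp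
next
  case (2 x x' y y')
  let ?j = "\<lambda>e\<in>ext_edges V E. x e \<or> y e" and ?j' = "\<lambda>e\<in>E. x' e \<and> y' e"
  have j: "?j \<in> plus_edges" by simp
  have refl: "le_sites \<zeta>' \<zeta>'" by (simp add: le_sites_def)
  have "F (config_at \<zeta> x x') \<le> F (config_at \<zeta>' ?j ?j')"
    using 2 j by (intro mono_onD[OF F(1)] config_at_in_space config_at_mono[OF \<zeta>(3)]) auto
  moreover have "G (config_at \<zeta>' y y') \<le> G (config_at \<zeta>' ?j ?j')"
    using 2 j by (intro mono_onD[OF G(1)] config_at_in_space config_at_mono[OF refl]) auto
  ultimately have "F (config_at \<zeta> x x') * G (config_at \<zeta>' y y') \<le> F (config_at \<zeta>' ?j ?j') * G (config_at \<zeta>' ?j ?j')"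
    using F(2) G(2) 2 j config_at_in_space by (intro mult_mono) auto
  then have "(config_weight \<zeta> x x' * config_weight \<zeta>' y y') * (F (config_at \<zeta> x x') * G (config_at \<zeta>' y y')) \<le>
    (config_weight \<zeta>' ?j ?j' * config_weight \<zeta> (\<lambda>e\<in>ext_edges V E. x e \<and> y e) (\<lambda>e\<in>E. x' e \<or> y' e)) *
    (F (config_at \<zeta>' ?j ?j') * G (config_at \<zeta>' ?j ?j'))"
    using config_weight_holley[OF \<zeta>] F(2) G(2) 2 config_at_in_space config_weight_nonneg \<zeta>
    by (intro mult_mono[of "config_weight \<zeta> x x' * config_weight \<zeta>' y y'"]) auto
  then show ?case by (simp only: mult_ac mult_1_right mult_1_left)
qed

lemma cluster_sum_one:
  "cluster_sum (\<lambda>_. 1) \<zeta> = ising_partition V (ext_edges V E) (\<lambda>e. Some -` e) (ext_coupling J \<beta> h) (\<lambda>u. fst (\<zeta> u)) *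
    ising_partition V E (\<lambda>e. e) (\<lambda>e. \<beta> * J e) (\<lambda>u. snd (\<zeta> u))"
  unfolding plus.sum_cluster_weight[symmetric] minus.sum_cluster_weight[symmetric]
  by (simp add: cluster_sum_def config_weight_def sum_product)

abbreviation sites_join where "sites_join \<zeta> \<zeta>' \<equiv> \<lambda>u\<in>V. site_join (\<zeta> u) (\<zeta>' u)"
abbreviation sites_meet where "sites_meet \<zeta> \<zeta>' \<equiv> \<lambda>u\<in>V. site_meet (\<zeta> u) (\<zeta>' u)"

lemma cluster_sum_one_pos: "0 < cluster_sum (\<lambda>_. 1) \<zeta>"
  unfolding cluster_sum_one using plus.ising_partition_pos minus.ising_partition_pos by simp

lemma cluster_sum_one_log_supermodular:
  assumes "nonneg_sites \<zeta>" "nonneg_sites \<zeta>'"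
  shows "cluster_sum (\<lambda>_. 1) \<zeta> * cluster_sum (\<lambda>_. 1) \<zeta>' \<le> cluster_sum (\<lambda>_. 1) (sites_join \<zeta> \<zeta>') * cluster_sum (\<lambda>_. 1) (sites_meet \<zeta> \<zeta>')"
proof -
  let ?p = "ising_partition V (ext_edges V E) (\<lambda>e. Some -` e) (ext_coupling J \<beta> h)"
  let ?m = "ising_partition V E (\<lambda>e. e) (\<lambda>e. \<beta> * J e)"
  have "?p (\<lambda>u. fst (\<zeta> u)) * ?p (\<lambda>u. fst (\<zeta>' u)) \<le> ?p (\<lambda>u. max (fst (\<zeta> u)) (fst (\<zeta>' u))) * ?p (\<lambda>u. min (fst (\<zeta> u)) (fst (\<zeta>' u)))"
    using assms by (intro plus.ising_partition_log_supermodular) (auto simp: nonneg_sites_def)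
  moreover have "?m (\<lambda>u. snd (\<zeta> u)) * ?m (\<lambda>u. snd (\<zeta>' u)) \<le> ?m (\<lambda>u. max (snd (\<zeta> u)) (snd (\<zeta>' u))) * ?m (\<lambda>u. min (snd (\<zeta> u)) (snd (\<zeta>' u)))"
    using assms by (intro minus.ising_partition_log_supermodular) (auto simp: nonneg_sites_def)
  ultimately have "(?p (\<lambda>u. fst (\<zeta> u)) * ?p (\<lambda>u. fst (\<zeta>' u))) * (?m (\<lambda>u. snd (\<zeta> u)) * ?m (\<lambda>u. snd (\<zeta>' u))) \<le>
    (?p (\<lambda>u. max (fst (\<zeta> u)) (fst (\<zeta>' u))) * ?p (\<lambda>u. min (fst (\<zeta> u)) (fst (\<zeta>' u)))) *
    (?m (\<lambda>u. max (snd (\<zeta> u)) (snd (\<zeta>' u))) * ?m (\<lambda>u. min (snd (\<zeta> u)) (snd (\<zeta>' u))))"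
    using plus.ising_partition_pos minus.ising_partition_pos
    by (intro mult_mono[of "?p (\<lambda>u. fst (\<zeta> u)) * ?p (\<lambda>u. fst (\<zeta>' u))"]) (auto intro: less_imp_le)
  moreover have "?p (\<lambda>u. fst (sites_join \<zeta> \<zeta>' u)) = ?p (\<lambda>u. max (fst (\<zeta> u)) (fst (\<zeta>' u)))"
    "?p (\<lambda>u. fst (sites_meet \<zeta> \<zeta>' u)) = ?p (\<lambda>u. min (fst (\<zeta> u)) (fst (\<zeta>' u)))"
    "?m (\<lambda>u. snd (sites_join \<zeta> \<zeta>' u)) = ?m (\<lambda>u. min (snd (\<zeta> u)) (snd (\<zeta>' u)))"
    "?m (\<lambda>u. snd (sites_meet \<zeta> \<zeta>' u)) = ?m (\<lambda>u. max (snd (\<zeta> u)) (snd (\<zeta>' u)))"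
    by (intro plus.ising_partition_cong minus.ising_partition_cong; simp add: site_join_def site_meet_def)+
  ultimately show ?thesis unfolding cluster_sum_one by (simp only: mult_ac)
qed

lemma cluster_sum_nonneg:
  assumes "nonneg_sites \<zeta>" "\<And>x. x \<in> configs \<Longrightarrow> 0 \<le> F x"
  shows "0 \<le> cluster_sum F \<zeta>"
  unfolding cluster_sum_def by (intro sum_nonneg mult_nonneg_nonneg config_weight_nonneg assms config_at_in_space)

lemma cluster_sum_mono:
  assumes "nonneg_sites \<zeta>" "\<And>x. x \<in> configs \<Longrightarrow> F x \<le> G x"
  shows "cluster_sum F \<zeta> \<le> cluster_sum G \<zeta>"
  unfolding cluster_sum_def by (intro sum_mono mult_left_mono config_weight_nonneg assms config_at_in_space)

text \<open>The two stages meet here: both conditional expectations increase on passing to the join,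
  FKG for the edges holds at the join, and \<open>?Z\<close> is log-supermodular. Multiplying by the
  square of \<open>?Z ?M\<close> avoids quotients. The outcome is the pointwise hypothesis of
  \<open>four_functions\<close> for the site measures.\<close>

lemma cluster_sum_four_functions:
  assumes \<zeta>: "nonneg_sites \<zeta>" "nonneg_sites \<zeta>'"
    and F: "mono_on (configs) F" "\<And>x. x \<in> configs \<Longrightarrow> 0 \<le> F x"
    and G: "mono_on (configs) G" "\<And>x. x \<in> configs \<Longrightarrow> 0 \<le> G x"
  shows "cluster_sum F \<zeta> * cluster_sum G \<zeta>' \<le>
    cluster_sum (\<lambda>x. F x * G x) (sites_join \<zeta> \<zeta>') * cluster_sum (\<lambda>_. 1) (sites_meet \<zeta> \<zeta>')"
proof -
  let ?M = "sites_join \<zeta> \<zeta>'" and ?m = "sites_meet \<zeta> \<zeta>'"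
  let ?Z = "cluster_sum (\<lambda>_. 1)" and ?FG = "cluster_sum (\<lambda>x. F x * G x)"
  have M: "nonneg_sites ?M" "le_sites \<zeta> ?M" "le_sites \<zeta>' ?M" "le_sites ?M ?M"
    using \<zeta> by (auto simp: nonneg_sites_def le_sites_def site_join_def)
  have one: "mono_on (configs) (\<lambda>_. 1 :: real)" by (simp add: mono_on_def)
  have nn: "0 \<le> cluster_sum F \<zeta>" "0 \<le> cluster_sum G \<zeta>'" "0 \<le> cluster_sum F ?M" "0 \<le> cluster_sum G ?M" "0 \<le> ?FG ?M"
    using \<zeta> M F(2) G(2) by (auto intro!: cluster_sum_nonneg)
  have Z: "0 < ?Z \<zeta>" "0 < ?Z \<zeta>'" "0 < ?Z ?M" "0 < ?Z ?m" by (rule cluster_sum_one_pos)+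
  have F_le: "cluster_sum F \<zeta> * ?Z ?M \<le> cluster_sum F ?M * ?Z \<zeta>"
    using cluster_sum_mult_le[OF \<zeta>(1) M(1,2) F one] by simp
  have G_le: "cluster_sum G \<zeta>' * ?Z ?M \<le> cluster_sum G ?M * ?Z \<zeta>'"
    using cluster_sum_mult_le[OF \<zeta>(2) M(1,3) G one] by simp
  have FG: "cluster_sum F ?M * cluster_sum G ?M \<le> ?FG ?M * ?Z ?M"
    by (rule cluster_sum_mult_le[OF M(1,1,4) F G])
  have "(cluster_sum F \<zeta> * cluster_sum G \<zeta>') * (?Z ?M * ?Z ?M) = (cluster_sum F \<zeta> * ?Z ?M) * (cluster_sum G \<zeta>' * ?Z ?M)"
    by (simp only: mult_ac)
  also have "\<dots> \<le> (cluster_sum F ?M * ?Z \<zeta>) * (cluster_sum G ?M * ?Z \<zeta>')"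
    using nn Z by (intro mult_mono F_le G_le mult_nonneg_nonneg) auto
  also have "\<dots> = (cluster_sum F ?M * cluster_sum G ?M) * (?Z \<zeta> * ?Z \<zeta>')" by (simp only: mult_ac)
  also have "\<dots> \<le> (?FG ?M * ?Z ?M) * (?Z ?M * ?Z ?m)"
    using nn Z by (intro mult_mono FG cluster_sum_one_log_supermodular \<zeta> mult_nonneg_nonneg) auto
  also have "\<dots> = (?FG ?M * ?Z ?m) * (?Z ?M * ?Z ?M)" by (simp only: mult_ac)
  finally show ?thesis using Z(3) by (simp add: mult_le_cancel_right)
qed

lemma measurable_cluster_sum:
  assumes F[measurable]: "F \<in> borel_measurable (config_space V E)"
  shows "cluster_sum F \<in> borel_measurable (site_space V)"
  unfolding cluster_sum_def[abs_def]
proof (intro borel_measurable_sum borel_measurable_times)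
  let ?B = "site_space V"
  fix \<omega>p \<omega>m assume \<omega>: "\<omega>p \<in> plus_edges" "\<omega>m \<in> minus_edges"
  have [measurable]: "(\<lambda>z. \<Prod>x\<in>Some -` e. fst (z x)) \<in> borel_measurable ?B" if "e \<in> ext_edges V E" for e
    using plus.a_subset[OF that] by (intro borel_measurable_prod measurable_site_component) auto
  have [measurable]: "(\<lambda>z. \<Prod>x\<in>e. snd (z x)) \<in> borel_measurable ?B" if "e \<in> E" for e
    using edge_subset[OF that] by (intro borel_measurable_prod measurable_site_component) auto
  show "(\<lambda>\<zeta>. config_weight \<zeta> \<omega>p \<omega>m) \<in> borel_measurable ?B"
    unfolding config_weight_def cluster_weight_def edge_weight_def edge_spin_def by measurable
  have "\<omega>p \<in> space (edge_space (ext_edges V E))" "(\<lambda>e\<in>E. \<not> \<omega>m e) \<in> space (edge_space E)"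
    using \<omega> by (auto simp: space_PiM)
  then show "(\<lambda>\<zeta>. F (config_at \<zeta> \<omega>p \<omega>m)) \<in> borel_measurable ?B"
    unfolding config_at_def
    by (intro measurable_compose[OF _ F] measurable_Pair measurable_fst_sites measurable_neg_snd_sites measurable_const)
qed

end

section \<open>Truncation to bounded functions and its removal\<close>

context cluster_model
begin

text \<open>A sublattice on which cluster sums of bounded functions are bounded: multiplication by
  its indicator preserves the pointwise hypothesis and supplies the bound that
  \<open>four_functions 1\<close> asks for after rescaling.\<close>

definition site_box :: "real \<Rightarrow> ('v \<Rightarrow> real \<times> real) set" where
  "site_box R = {\<zeta>. \<forall>u\<in>V. 0 \<le> fst (\<zeta> u) \<and> fst (\<zeta> u) \<le> R \<and> 0 \<le> snd (\<zeta> u) \<and> snd (\<zeta> u) \<le> R}"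

lemma site_box_nonneg: "\<zeta> \<in> site_box R \<Longrightarrow> nonneg_sites \<zeta>"
  by (auto simp: site_box_def nonneg_sites_def)

lemma site_box_lattice:
  assumes "\<zeta> \<in> site_box R" "\<zeta>' \<in> site_box R"
  shows "sites_join \<zeta> \<zeta>' \<in> site_box R" "sites_meet \<zeta> \<zeta>' \<in> site_box R"
  using assms by (auto simp: site_box_def site_join_def site_meet_def min_def max_def)

lemma measurable_site_box: "(indicator (site_box R) :: _ \<Rightarrow> ennreal) \<in> borel_measurable (site_space V)"
proof -
  let ?B = "site_space V"
  have [measurable]: "(\<lambda>z. fst (z u)) \<in> borel_measurable ?B" "(\<lambda>z. snd (z u)) \<in> borel_measurable ?B" if "u \<in> V" for u
    using measurable_site_component[OF that] by auto
  let ?S = "{\<zeta> \<in> space ?B. \<forall>u\<in>V. 0 \<le> fst (\<zeta> u) \<and> fst (\<zeta> u) \<le> R \<and> 0 \<le> snd (\<zeta> u) \<and> snd (\<zeta> u) \<le> R}"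
  have "?S \<in> sets ?B" using finite_V by measurable
  then have "(indicator ?S :: _ \<Rightarrow> ennreal) \<in> borel_measurable ?B" by (rule borel_measurable_indicator)
  moreover have "(indicator ?S :: _ \<Rightarrow> ennreal) \<in> borel_measurable ?B \<longleftrightarrow> (indicator (site_box R) :: _ \<Rightarrow> ennreal) \<in> borel_measurable ?B"
    by (rule measurable_cong) (auto simp: indicator_def site_box_def)
  ultimately show ?thesis by blast
qed

definition abs_sites :: "('v \<Rightarrow> real \<times> real) \<Rightarrow> ('v \<Rightarrow> real \<times> real)" where
  "abs_sites z = (\<lambda>u\<in>V. (\<bar>fst (z u)\<bar>, \<bar>snd (z u)\<bar>))"

lemma nonneg_abs_sites: "nonneg_sites (abs_sites z)"
  by (simp add: nonneg_sites_def abs_sites_def)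

lemma abs_sites_in_box: "abs_sites z \<in> site_box R \<longleftrightarrow> (\<forall>u\<in>V. \<bar>fst (z u)\<bar> \<le> R \<and> \<bar>snd (z u)\<bar> \<le> R)"
  by (auto simp: site_box_def abs_sites_def)

text \<open>Both partition functions increase in every absolute value, so the corner
  \<open>(R, R)\<close> dominates. It is the largest point in the plain order of both coordinates,
  not in that of \<open>le_sites\<close>.\<close>

lemma cluster_sum_bounded_on_box:
  assumes "\<zeta> \<in> site_box R" and F: "\<And>x. x \<in> configs \<Longrightarrow> F x \<le> N" and N: "0 \<le> N"
  shows "cluster_sum F \<zeta> \<le> N * cluster_sum (\<lambda>_. 1) (\<lambda>_. (R, R))"
proof -
  note \<zeta> = site_box_nonneg[OF assms(1)]
  have "cluster_sum F \<zeta> \<le> cluster_sum (\<lambda>_. N) \<zeta>"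
    by (intro cluster_sum_mono \<zeta> F)
  also have "\<dots> = N * cluster_sum (\<lambda>_. 1) \<zeta>"
    by (simp add: cluster_sum_def sum_distrib_left mult.commute)
  also have "cluster_sum (\<lambda>_. 1) \<zeta> \<le> cluster_sum (\<lambda>_. 1) (\<lambda>_. (R, R))"
    unfolding cluster_sum_one using assms(1) plus.ising_partition_pos minus.ising_partition_pos
    by (intro mult_mono plus.ising_partition_mono minus.ising_partition_mono) (auto simp: site_box_def intro: less_imp_le)
  finally show ?thesis using N by (simp add: mult_left_mono)
qed

context
  assumes class_E: "class_E \<rho>"
begin

lemma four_functions_sites:
  "four_functions 1 (\<Pi>\<^sub>M u\<in>V. site_measure \<rho>) sites_join sites_meet"
proof -
  have "prob_space (site_measure \<rho>)"
  proof -
    interpret real_distribution \<rho> by (rule real_distribution)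
    interpret pair_prob_space \<rho> \<rho> ..
    show ?thesis unfolding site_measure_def by (intro P.prob_space_distr measurable_site_coords) simp
  qed
  moreover have "space (site_measure \<rho>) = UNIV" by (simp add: site_measure_def)
  ultimately show ?thesis
    by (intro four_functions_PiM finite_V four_functions_site_measure real_distribution class_E)
      (auto intro: prob_space_imp_sigma_finite)
qed

lemma truncated_cluster_sum_FKG:
  fixes R N :: real
  assumes F[measurable]: "F \<in> borel_measurable (config_space V E)" and G[measurable]: "G \<in> borel_measurable (config_space V E)"
    and F_mono: "mono_on (configs) F" and F_bounds: "\<And>x. x \<in> configs \<Longrightarrow> 0 \<le> F x \<and> F x \<le> N"
    and G_mono: "mono_on (configs) G" and G_bounds: "\<And>x. x \<in> configs \<Longrightarrow> 0 \<le> G x \<and> G x \<le> N"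
    and N: "0 \<le> N"
  defines "A \<equiv> \<lambda>H. \<integral>\<^sup>+z. ennreal (cluster_sum H (abs_sites z)) * indicator (site_box R) (abs_sites z) \<partial>(\<Pi>\<^sub>M u\<in>V. rotated_measure \<rho>)"
  shows "A F * A G \<le> A (\<lambda>x. F x * G x) * A (\<lambda>_. 1)"
proof -
  let ?S = "\<Pi>\<^sub>M u\<in>V. site_measure \<rho>" and ?B = "site_space V"
  let ?C = "config_space V E" and ?FG = "\<lambda>x. F x * G x"
  define f where "f H \<zeta> = ennreal (cluster_sum H \<zeta>) * indicator (site_box R) \<zeta>" for H \<zeta>
  have sets: "sets ?S = sets ?B" by (intro sets_PiM_cong) (simp_all add: site_measure_def)
  have f: "f H \<in> borel_measurable ?B" if "H \<in> borel_measurable ?C" for H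
    unfolding f_def[abs_def] using measurable_cluster_sum[OF that] measurable_site_box by measurable
  have A: "A H = (\<integral>\<^sup>+\<zeta>. f H \<zeta> \<partial>?S)" if "H \<in> borel_measurable ?C" for H
    using nn_integral_site_measure_PiM[OF real_distribution finite_V f[OF that]]
    by (simp add: A_def f_def abs_sites_def)
  \<comment> \<open>\<open>N * N + N + 1\<close> exceeds the bounds \<open>N\<close>,
    \<open>N * N\<close> and 1 of all four test functions at once, and is positive even for
    \<open>N = 0\<close>.\<close>
  define K where "K = (N * N + N + 1) * cluster_sum (\<lambda>_. 1) (\<lambda>_. (R, R))"
  have Z: "0 < cluster_sum (\<lambda>_. 1) (\<lambda>_. (R, R))" by (rule cluster_sum_one_pos)
  have bound: "f H \<zeta> \<le> ennreal K" if H: "\<And>x. x \<in> space ?C \<Longrightarrow> H x \<le> N * N + N + 1" for H \<zeta>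
  proof (cases "\<zeta> \<in> site_box R")
    case True
    then show ?thesis
      using cluster_sum_bounded_on_box[OF True H] N by (simp add: f_def K_def ennreal_leI)
  qed (simp add: f_def)
  have FG: "0 \<le> F x * G x" "F x * G x \<le> N * N" if "x \<in> space ?C" for x
    using F_bounds[OF that] G_bounds[OF that] N by (auto intro: mult_mono)
  have "(\<integral>\<^sup>+\<zeta>. f F \<zeta> \<partial>?S) * (\<integral>\<^sup>+\<zeta>. f G \<zeta> \<partial>?S) \<le> (\<integral>\<^sup>+\<zeta>. f ?FG \<zeta> \<partial>?S) * (\<integral>\<^sup>+\<zeta>. f (\<lambda>_. 1) \<zeta> \<partial>?S)"
  proof (rule four_functions_bounded[OF four_functions_sites])
    show "0 < K" using Z N by (auto simp: K_def intro!: mult_pos_pos add_nonneg_pos)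
    show "f F \<in> borel_measurable ?S" "f G \<in> borel_measurable ?S" "f ?FG \<in> borel_measurable ?S" "f (\<lambda>_. 1) \<in> borel_measurable ?S"
      unfolding measurable_cong_sets[OF sets refl] by (intro f; measurable)+
    have NN: "0 \<le> N * N" using N by simp
    have b: "F x \<le> N * N + N + 1" "G x \<le> N * N + N + 1" "F x * G x \<le> N * N + N + 1" "1 \<le> N * N + N + 1"
      if "x \<in> space ?C" for x
      using F_bounds[OF that] G_bounds[OF that] FG[OF that] N NN by linarith+
    show "f F \<zeta> \<le> ennreal K" for \<zeta> by (rule bound) (rule b(1))
    show "f G \<zeta> \<le> ennreal K" for \<zeta> by (rule bound) (rule b(2))
    show "f ?FG \<zeta> \<le> ennreal K" for \<zeta> by (rule bound) (rule b(3))
    show "f (\<lambda>_. 1) \<zeta> \<le> ennreal K" for \<zeta> by (rule bound) (rule b(4))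
    fix \<zeta> \<zeta>'
    show "f F \<zeta> * f G \<zeta>' \<le> f ?FG (sites_join \<zeta> \<zeta>') * f (\<lambda>_. 1) (sites_meet \<zeta> \<zeta>')"
    proof (cases "\<zeta> \<in> site_box R \<and> \<zeta>' \<in> site_box R")
      case True
      then have nn: "nonneg_sites \<zeta>" "nonneg_sites \<zeta>'" and box: "sites_join \<zeta> \<zeta>' \<in> site_box R" "sites_meet \<zeta> \<zeta>' \<in> site_box R"
        using site_box_nonneg site_box_lattice by auto
      have "cluster_sum F \<zeta> * cluster_sum G \<zeta>' \<le> cluster_sum ?FG (sites_join \<zeta> \<zeta>') * cluster_sum (\<lambda>_. 1) (sites_meet \<zeta> \<zeta>')"
        using F_bounds G_bounds by (intro cluster_sum_four_functions nn F_mono G_mono) auto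
      moreover have "0 \<le> cluster_sum F \<zeta>" "0 \<le> cluster_sum G \<zeta>'" "0 \<le> cluster_sum ?FG (sites_join \<zeta> \<zeta>')"
        "0 \<le> cluster_sum (\<lambda>_. 1) (sites_meet \<zeta> \<zeta>')"
        using F_bounds G_bounds nn box by (auto intro!: cluster_sum_nonneg site_box_nonneg mult_nonneg_nonneg)
      ultimately show ?thesis using True box by (simp add: f_def ennreal_mult[symmetric] ennreal_leI)
    qed (auto simp: f_def)
  qed
  then show ?thesis by (simp add: A)
qed

text \<open>Capping by \<open>n\<close> keeps \<open>F\<close> and \<open>G\<close> increasing.
  Monotone convergence recovers the left side as the cap and the box grow together, while on the
  right truncation only makes the integrals smaller.\<close>

lemma cluster_sum_FKG:
  assumes F[measurable]: "F \<in> borel_measurable (config_space V E)" and G[measurable]: "G \<in> borel_measurable (config_space V E)"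
    and F_mono: "mono_on (configs) F" and F_nonneg: "\<And>x. x \<in> configs \<Longrightarrow> 0 \<le> F x"
    and G_mono: "mono_on (configs) G" and G_nonneg: "\<And>x. x \<in> configs \<Longrightarrow> 0 \<le> G x"
  defines "I \<equiv> \<lambda>H. \<integral>\<^sup>+z. ennreal (cluster_sum H (abs_sites z)) \<partial>(\<Pi>\<^sub>M u\<in>V. rotated_measure \<rho>)"
  shows "I F * I G \<le> I (\<lambda>x. F x * G x) * I (\<lambda>_. 1)"
proof -
  let ?N = "\<Pi>\<^sub>M u\<in>V. rotated_measure \<rho>" and ?B = "site_space V"
  let ?C = "config_space V E" and ?K = "I (\<lambda>x. F x * G x) * I (\<lambda>_. 1)"
  have sets: "sets ?N = sets ?B" by (intro sets_PiM_cong) (simp_all add: sets_rotated_measure[OF real_distribution])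
  define a where "a H n z = ennreal (cluster_sum (\<lambda>x. min (H x) (real n)) (abs_sites z)) * indicator (site_box (real n)) (abs_sites z)"
    for H :: "_ \<Rightarrow> real" and n :: nat and z
  define A where "A H n = (\<integral>\<^sup>+z. a H n z \<partial>?N)" for H n
  have "abs_sites \<in> ?B \<rightarrow>\<^sub>M ?B" unfolding abs_sites_def[abs_def] by (rule measurable_sitewise[OF measurable_abs_pair])
  then have abs_meas: "abs_sites \<in> ?N \<rightarrow>\<^sub>M ?B" by (simp add: measurable_cong_sets[OF sets refl])
  have A_sup: "I H = (SUP n. A H n)" and A_inc: "incseq (A H)"
    if H[measurable]: "H \<in> borel_measurable ?C" and nonneg: "\<And>x. x \<in> space ?C \<Longrightarrow> 0 \<le> H x" for H
  proof -
    have inc: "incseq (a H)"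
    proof (intro incseq_SucI le_funI)
      fix n z
      have "cluster_sum (\<lambda>x. min (H x) (real n)) (abs_sites z) \<le> cluster_sum (\<lambda>x. min (H x) (real (Suc n))) (abs_sites z)"
        by (intro cluster_sum_mono nonneg_abs_sites) (auto simp: min_def)
      moreover have "indicator (site_box (real n)) (abs_sites z) \<le> (indicator (site_box (real (Suc n))) (abs_sites z) :: ennreal)"
        by (fastforce simp: indicator_def abs_sites_in_box)
      ultimately show "a H n z \<le> a H (Suc n) z" unfolding a_def by (intro mult_mono ennreal_leI) auto
    qed
    have meas: "a H n \<in> borel_measurable ?N" for n
      unfolding a_def[abs_def]
      using measurable_compose[OF abs_meas measurable_cluster_sum, of "\<lambda>x. min (H x) (real n)"]
        measurable_compose[OF abs_meas measurable_site_box[of "real n"]] by measurable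
    have lim: "(\<lambda>n. a H n z) \<longlonglongrightarrow> ennreal (cluster_sum H (abs_sites z))" for z
    proof -
      let ?X = "(\<lambda>u. \<bar>fst (z u)\<bar>) ` V \<union> (\<lambda>u. \<bar>snd (z u)\<bar>) ` V \<union>
        (\<lambda>(x, y). H (config_at (abs_sites z) x y)) ` (plus_edges \<times> minus_edges)"
      have "finite ?X" using finite_V finite_configs by auto
      \<comment> \<open>At a fixed \<open>z\<close> only finitely many coordinates and values of
        \<open>H\<close> matter, so the truncation is eventually exact.\<close>
      then obtain n0 :: nat where n0: "\<And>x. x \<in> ?X \<Longrightarrow> x \<le> real n0"
        by (meson bdd_above_finite bdd_above_def real_arch_simple order_trans)
      have "a H n z = ennreal (cluster_sum H (abs_sites z))" if "n0 \<le> n" for n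
      proof -
        have n: "x \<le> real n" if "x \<in> ?X" for x using n0[OF that] \<open>n0 \<le> n\<close> by simp
        then have "abs_sites z \<in> site_box (real n)" by (auto simp: abs_sites_in_box)
        moreover have "min (H (config_at (abs_sites z) x y)) (real n) = H (config_at (abs_sites z) x y)"
          if "x \<in> plus_edges" "y \<in> minus_edges" for x y
        proof -
          have "H (config_at (abs_sites z) x y) \<in> ?X"
            using that by (intro UnI2 image_eqI[of _ _ "(x, y)"]) auto
          then show ?thesis using n by (auto simp: min_def)
        qed
        then have "cluster_sum (\<lambda>x. min (H x) (real n)) (abs_sites z) = cluster_sum H (abs_sites z)"
          unfolding cluster_sum_def by (intro sum.cong refl) auto
        ultimately show ?thesis by (simp add: a_def)
      qed
      then show ?thesis by (intro tendsto_eventually) (auto simp: eventually_sequentially)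
    qed
    have "A H \<longlonglongrightarrow> I H" unfolding A_def I_def by (rule nn_integral_LIMSEQ[OF inc meas lim])
    moreover show "incseq (A H)"
      using inc unfolding A_def by (auto simp: incseq_def le_fun_def intro!: nn_integral_mono)
    ultimately show "I H = (SUP n. A H n)" using LIMSEQ_unique[OF _ LIMSEQ_SUP] by blast
  qed
  have diag: "A F n * A G n \<le> ?K" for n
  proof -
    have mono: "mono_on (space ?C) (\<lambda>x. min (H x) (real n))" if "mono_on (space ?C) H" for H
      using that unfolding mono_on_def by (intro allI impI min.mono) auto
    have "A F n * A G n \<le>
      (\<integral>\<^sup>+z. ennreal (cluster_sum (\<lambda>x. min (F x) (real n) * min (G x) (real n)) (abs_sites z)) * indicator (site_box (real n)) (abs_sites z) \<partial>?N) *
      (\<integral>\<^sup>+z. ennreal (cluster_sum (\<lambda>_. 1) (abs_sites z)) * indicator (site_box (real n)) (abs_sites z) \<partial>?N)"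
      unfolding A_def a_def
      by (rule truncated_cluster_sum_FKG[where N = "real n"]) (use F_nonneg G_nonneg F_mono G_mono mono in auto)
    also have "\<dots> \<le> ?K"
      unfolding I_def
    proof (intro mult_mono nn_integral_mono)
      fix z
      have "cluster_sum (\<lambda>x. min (F x) (real n) * min (G x) (real n)) (abs_sites z) \<le> cluster_sum (\<lambda>x. F x * G x) (abs_sites z)"
        using F_nonneg G_nonneg by (intro cluster_sum_mono nonneg_abs_sites mult_mono) auto
      then show "ennreal (cluster_sum (\<lambda>x. min (F x) (real n) * min (G x) (real n)) (abs_sites z)) * indicator (site_box (real n)) (abs_sites z)
          \<le> ennreal (cluster_sum (\<lambda>x. F x * G x) (abs_sites z))"
        by (auto simp: indicator_def ennreal_leI)
      show "ennreal (cluster_sum (\<lambda>_. 1) (abs_sites z)) * indicator (site_box (real n)) (abs_sites z) \<le> ennreal (cluster_sum (\<lambda>_. 1) (abs_sites z))"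
        by (auto simp: indicator_def)
    qed auto
    finally show ?thesis .
  qed
  \<comment> \<open>The two suprema have independent indices; monotonicity reduces them to the
    diagonal.\<close>
  have "A F i * A G k \<le> ?K" for i k
  proof -
    have "A F i * A G k \<le> A F (max i k) * A G (max i k)"
      using incseqD[OF A_inc[OF F F_nonneg], of i "max i k"] incseqD[OF A_inc[OF G G_nonneg], of k "max i k"]
      by (intro mult_mono) auto
    also have "\<dots> \<le> ?K" by (rule diag)
    finally show ?thesis .
  qed
  moreover have "I F = (SUP n. A F n)" "I G = (SUP n. A G n)"
    using F_nonneg G_nonneg by (auto intro!: A_sup)
  ultimately show ?thesis
    by (simp add: SUP_mult_left_ennreal SUP_mult_right_ennreal SUP_le_iff)
qed

text \<open>Total mass 1 gives \<open>c * ?I (\<lambda>_. 1) = 1\<close>, so multiplying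
  \<open>cluster_sum_FKG\<close> by \<open>c * c\<close> absorbs the extra factor on its right
  side.\<close>

lemma satisfies_FKG_signed_config:
  "satisfies_FKG (double_cluster_swapping V E J \<beta> h \<rho>) (config_space V E) signed_config"
  unfolding satisfies_FKG_def
proof (intro ballI impI)
  let ?C = "config_space V E" and ?D = "double_cluster_swapping V E J \<beta> h \<rho>"
  fix F G :: "_ \<Rightarrow> real"
  assume F: "F \<in> borel_measurable ?C" and G: "G \<in> borel_measurable ?C" and nn: "\<forall>x\<in>space ?C. 0 \<le> F x \<and> 0 \<le> G x"
    and mono: "mono_on (space ?C) F" "mono_on (space ?C) G"
  obtain c where c: "\<And>H. H \<in> borel_measurable ?C \<Longrightarrow> (\<And>x. x \<in> space ?C \<Longrightarrow> 0 \<le> H x) \<Longrightarrow>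
      (\<integral>\<^sup>+x. ennreal (H (signed_config x)) \<partial>?D) = c * (\<integral>\<^sup>+z. ennreal (cluster_sum H (abs_sites z)) \<partial>(\<Pi>\<^sub>M u\<in>V. rotated_measure \<rho>))"
    unfolding abs_sites_def by (rule expectation_signed_config) blast
  let ?I = "\<lambda>H. \<integral>\<^sup>+z. ennreal (cluster_sum H (abs_sites z)) \<partial>(\<Pi>\<^sub>M u\<in>V. rotated_measure \<rho>)"
  have "prob_space ?D"
    using double_cluster_swapping_in_prob_algebra[OF graph J_nonneg \<beta>_nonneg h_nonneg reference] by (simp add: space_prob_algebra)
  then interpret prob_space ?D .
  have one: "c * ?I (\<lambda>_. 1) = 1"
    using c[of "\<lambda>_. 1"] emeasure_space_1 by simp
  have "(c * ?I F) * (c * ?I G) = (c * c) * (?I F * ?I G)" by (simp only: mult_ac)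
  also have "\<dots> \<le> (c * c) * (?I (\<lambda>x. F x * G x) * ?I (\<lambda>_. 1))"
    using F G nn mono by (intro mult_left_mono cluster_sum_FKG) auto
  also have "\<dots> = (c * ?I (\<lambda>x. F x * G x)) * (c * ?I (\<lambda>_. 1))" by (simp only: mult_ac)
  finally have "(c * ?I F) * (c * ?I G) \<le> c * ?I (\<lambda>x. F x * G x)" by (simp add: one)
  moreover have "(\<lambda>x. F x * G x) \<in> borel_measurable ?C" using F G by measurable
  ultimately show "(\<integral>\<^sup>+x. ennreal (F (signed_config x)) \<partial>?D) * (\<integral>\<^sup>+x. ennreal (G (signed_config x)) \<partial>?D)
      \<le> (\<integral>\<^sup>+x. ennreal (F (signed_config x) * G (signed_config x)) \<partial>?D)"
    using c[of F] c[of G] c[of "\<lambda>x. F x * G x"] F G nn by simp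
qed

text \<open>FKG is applied to \<open>F\<close> and \<open>B - G\<close>, where the upper bound
  \<open>B\<close> of \<open>G\<close> exists because there are finitely many edge configurations.
  As a function of the complemented minus edges, \<open>B - G\<close> is increasing and
  nonnegative.\<close>

lemma negatively_associated_edges:
  "negatively_associated (double_cluster_swapping V E J \<beta> h \<rho>)
     (edge_space (ext_edges V E)) (\<lambda>(\<phi>p, \<phi>m, \<omega>p, \<omega>m). \<omega>p) (edge_space E) (\<lambda>(\<phi>p, \<phi>m, \<omega>p, \<omega>m). \<omega>m)"
  unfolding negatively_associated_def
proof (intro ballI impI)
  let ?C = "config_space V E" and ?D = "double_cluster_swapping V E J \<beta> h \<rho>"
  let ?\<Omega>p = "edge_space (ext_edges V E)" and ?\<Omega>m = "edge_space E"
  let ?p = "\<lambda>(\<phi>p :: 'v \<Rightarrow> real, \<phi>m :: 'v \<Rightarrow> real, \<omega>p :: 'v option set \<Rightarrow> bool, \<omega>m :: 'v set \<Rightarrow> bool). \<omega>p"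
  let ?m = "\<lambda>(\<phi>p :: 'v \<Rightarrow> real, \<phi>m :: 'v \<Rightarrow> real, \<omega>p :: 'v option set \<Rightarrow> bool, \<omega>m :: 'v set \<Rightarrow> bool). \<omega>m"
  fix F :: "_ \<Rightarrow> real" and G :: "_ \<Rightarrow> real"
  assume F[measurable]: "F \<in> borel_measurable ?\<Omega>p" and G[measurable]: "G \<in> borel_measurable ?\<Omega>m"
    and F0: "\<forall>x\<in>space ?\<Omega>p. 0 \<le> F x" and G0: "\<forall>y\<in>space ?\<Omega>m. 0 \<le> G y"
    and F_mono: "mono_on (space ?\<Omega>p) F" and G_mono: "mono_on (space ?\<Omega>m) G"
  have D: "prob_space ?D" "sets ?D = sets ?C"
    using double_cluster_swapping_in_prob_algebra[OF graph J_nonneg \<beta>_nonneg h_nonneg reference] by (simp_all add: space_prob_algebra)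
  interpret prob_space ?D by fact
  note [measurable_cong] = D(2)
  have sp: "space ?D = space ?C" by (rule sets_eq_imp_space_eq[OF D(2)])
  have fin: "finite (space ?\<Omega>p)" "finite (space ?\<Omega>m)"
    using finite_configs by (simp_all add: space_PiM)
  obtain K where K: "\<And>x. x \<in> space ?\<Omega>p \<Longrightarrow> F x \<le> K"
    using bdd_above_finite[OF finite_imageI[OF fin(1), of F]] by (auto simp: bdd_above_def)
  obtain B where B: "\<And>x. x \<in> space ?\<Omega>m \<Longrightarrow> G x \<le> B"
    using bdd_above_finite[OF finite_imageI[OF fin(2), of G]] by (auto simp: bdd_above_def)
  have "(\<lambda>e\<in>E. False) \<in> space ?\<Omega>m" by (simp add: space_PiM)
  then have B0: "0 \<le> B" using G0 B by (meson order_trans)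
  define neg where "neg \<omega> = (\<lambda>e\<in>E. \<not> \<omega> e)" for \<omega> :: "'v set \<Rightarrow> bool"
  have neg_meas[measurable]: "neg \<in> ?\<Omega>m \<rightarrow>\<^sub>M ?\<Omega>m" unfolding neg_def by measurable
  define F' where "F' x = F (fst (snd (snd x)))" for x :: "('v \<Rightarrow> real) \<times> ('v \<Rightarrow> real) \<times> ('v option set \<Rightarrow> bool) \<times> ('v set \<Rightarrow> bool)"
  \<comment> \<open>\<open>neg\<close> undoes the complement taken in
    \<open>signed_config\<close>.\<close>
  define G' where "G' x = B - G (neg (snd (snd (snd x))))" for x :: "('v \<Rightarrow> real) \<times> ('v \<Rightarrow> real) \<times> ('v option set \<Rightarrow> bool) \<times> ('v set \<Rightarrow> bool)"
  have neg_in: "neg \<omega> \<in> space ?\<Omega>m" for \<omega> by (simp add: neg_def space_PiM)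
  have neg_neg: "neg (neg \<omega>) = \<omega>" if "\<omega> \<in> space ?\<Omega>m" for \<omega>
    using that by (auto simp: neg_def space_PiM PiE_iff extensional_def fun_eq_iff)
  have FKG: "(\<integral>\<^sup>+x. ennreal (F' (signed_config x)) \<partial>?D) * (\<integral>\<^sup>+x. ennreal (G' (signed_config x)) \<partial>?D)
      \<le> (\<integral>\<^sup>+x. ennreal (F' (signed_config x) * G' (signed_config x)) \<partial>?D)"
  proof (rule satisfies_FKG_signed_config[unfolded satisfies_FKG_def, THEN bspec, THEN bspec, THEN mp, THEN mp, THEN mp])
    show "F' \<in> borel_measurable ?C" unfolding F'_def by measurable
    show "G' \<in> borel_measurable ?C" unfolding G'_def by measurable
    show "\<forall>x\<in>space ?C. 0 \<le> F' x \<and> 0 \<le> G' x"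
      using F0 B[OF neg_in] by (auto simp: F'_def G'_def space_pair_measure)
    show "mono_on (space ?C) F'"
      using F_mono by (auto simp: mono_on_def F'_def space_pair_measure)
    show "mono_on (space ?C) G'"
    proof (rule mono_onI)
      fix x y assume "x \<in> space ?C" "y \<in> space ?C" "x \<le> y"
      then have "neg (snd (snd (snd y))) \<le> neg (snd (snd (snd x)))"
        by (auto simp: neg_def le_fun_def less_eq_prod_def)
      then show "G' x \<le> G' y" using mono_onD[OF G_mono neg_in neg_in] by (simp add: G'_def)
    qed
  qed
  let ?F = "\<lambda>x. F (?p x)" and ?G = "\<lambda>x. G (?m x)"
  define e where "e H = (\<integral>\<^sup>+x. ennreal (H x) \<partial>?D)" for H
  have X: "F' (signed_config x) = F (?p x)" "G' (signed_config x) = B - G (?m x)" if "x \<in> space ?D" for x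
  proof -
    have "?m x \<in> space ?\<Omega>m" using that unfolding sp by (auto simp: space_pair_measure)
    moreover have "snd (snd (snd (signed_config x))) = neg (?m x)" by (simp add: neg_def split_beta')
    ultimately show "G' (signed_config x) = B - G (?m x)" by (simp add: G'_def neg_neg)
    show "F' (signed_config x) = F (?p x)" by (simp add: F'_def split_beta')
  qed
  have bnd: "0 \<le> F (?p x)" "F (?p x) \<le> K" "0 \<le> G (?m x)" "G (?m x) \<le> B" if "x \<in> space ?D" for x
    using that F0 G0 K B unfolding sp by (auto simp: space_pair_measure split: prod.splits)
  have [measurable]: "?F \<in> borel_measurable ?D" "?G \<in> borel_measurable ?D"
    unfolding split_beta' by measurable
  \<comment> \<open>The relations for \<open>B - G\<close> are kept additive, since subtraction in
    \<open>ennreal\<close> is truncated; the common term \<open>a * b\<close> is cancelled at the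
    end, once it is known to be finite.\<close>
  have arith: "a * b + f \<le> a * b + a * g" if "a * b \<le> d" "d + f = t" "t = a * s" "b + g = s" for a b d f g s t :: ennreal
    using add_right_mono[OF that(1), of f] unfolding that(2,3) that(4)[symmetric] by (simp add: distrib_left)
  have "e ?F * e (\<lambda>x. B - G (?m x)) \<le> e (\<lambda>x. F (?p x) * (B - G (?m x)))"
    using FKG unfolding e_def by (simp add: X cong: nn_integral_cong)
  moreover have "e (\<lambda>x. F (?p x) * (B - G (?m x))) + e (\<lambda>x. F (?p x) * G (?m x)) = e (\<lambda>x. F (?p x) * B)"
  proof -
    have "ennreal (F (?p x) * (B - G (?m x))) + ennreal (F (?p x) * G (?m x)) = ennreal (F (?p x) * B)"
      if "x \<in> space ?D" for x
    proof -
      have nn: "0 \<le> F (?p x) * (B - G (?m x))" "0 \<le> F (?p x) * G (?m x)" using bnd[OF that] by simp_all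
      show ?thesis unfolding ennreal_plus[OF nn, symmetric] by (simp add: algebra_simps)
    qed
    then show ?thesis
      unfolding e_def by (subst nn_integral_add[symmetric]) (simp_all cong: nn_integral_cong)
  qed
  moreover have "e (\<lambda>x. F (?p x) * B) = e ?F * ennreal B"
    unfolding e_def using B0 by (simp add: ennreal_mult'' nn_integral_multc)
  moreover have "e (\<lambda>x. B - G (?m x)) + e ?G = ennreal B"
  proof -
    have "e (\<lambda>x. B - G (?m x)) + e ?G = (\<integral>\<^sup>+x. ennreal B \<partial>?D)"
    proof -
      have "ennreal (B - G (?m x)) + ennreal (G (?m x)) = ennreal B" if "x \<in> space ?D" for x
        using bnd(3,4)[OF that] by (simp flip: ennreal_plus)
      then show ?thesis
        unfolding e_def by (subst nn_integral_add[symmetric]) (simp_all cong: nn_integral_cong)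
    qed
    then show ?thesis by (simp add: emeasure_space_1)
  qed
  ultimately have "e ?F * e (\<lambda>x. B - G (?m x)) + e (\<lambda>x. F (?p x) * G (?m x)) \<le>
      e ?F * e (\<lambda>x. B - G (?m x)) + e ?F * e ?G"
    by (rule arith)
  moreover have "e ?F * e (\<lambda>x. B - G (?m x)) < \<top>"
  proof -
    have "e ?F \<le> (\<integral>\<^sup>+x. ennreal K \<partial>?D)"
      unfolding e_def by (intro nn_integral_mono ennreal_leI bnd(2))
    moreover have "e (\<lambda>x. B - G (?m x)) \<le> (\<integral>\<^sup>+x. ennreal B \<partial>?D)"
      unfolding e_def using bnd(3) by (intro nn_integral_mono ennreal_leI) simp
    ultimately show ?thesis by (auto simp: emeasure_space_1 ennreal_mult_less_top intro: le_less_trans)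
  qed
  ultimately show "(\<integral>\<^sup>+x. ennreal (F (?p x) * G (?m x)) \<partial>?D) \<le> (\<integral>\<^sup>+x. ennreal (F (?p x)) \<partial>?D) * (\<integral>\<^sup>+x. ennreal (G (?m x)) \<partial>?D)"
    unfolding e_def[symmetric] by (auto simp: ennreal_add_left_cancel_le)
qed

end

end

theorem proposition6:
  fixes V :: "'v set" and E :: "'v set set" and J :: "'v set \<Rightarrow> real"
    and \<beta> h :: real and \<rho> :: "real measure"
  assumes "finite_graph V E"
    and "\<And>e. e \<in> E \<Longrightarrow> 0 \<le> J e"
    and "0 \<le> \<beta>" and "0 \<le> h"
    and "reference_measure \<rho>"
    and "class_E \<rho>"
  shows "satisfies_FKG (double_cluster_swapping V E J \<beta> h \<rho>) (config_space V E)
           (\<lambda>(\<phi>\<^sub>p, \<phi>\<^sub>m, \<omega>\<^sub>p, \<omega>\<^sub>m).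
              (\<lambda>u\<in>V. \<bar>\<phi>\<^sub>p u\<bar>, \<lambda>u\<in>V. - \<bar>\<phi>\<^sub>m u\<bar>, \<omega>\<^sub>p, \<lambda>e\<in>E. \<not> \<omega>\<^sub>m e)) \<and>
         negatively_associated (double_cluster_swapping V E J \<beta> h \<rho>)
           (edge_space (ext_edges V E)) (\<lambda>(\<phi>\<^sub>p, \<phi>\<^sub>m, \<omega>\<^sub>p, \<omega>\<^sub>m). \<omega>\<^sub>p)
           (edge_space E) (\<lambda>(\<phi>\<^sub>p, \<phi>\<^sub>m, \<omega>\<^sub>p, \<omega>\<^sub>m). \<omega>\<^sub>m)"
proof -
  interpret cluster_model V E J \<beta> h \<rho>
    using assms by unfold_locales
  show ?thesis
    using satisfies_FKG_signed_config[OF assms(6)] negatively_associated_edges[OF assms(6)] by blast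
qed

end
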